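(* Let $\gamma_0$ be a smooth convex simple closed plane curve with smooth parametrization $X_0:S^1\to\gamma_0$. For any smooth function $H(p,q):(0,\infty)\times(0,\infty)\to\mathbb{R}$, the nonlocal flow $$\frac{\partial X}{\partial t}(\varphi,t)=\left(H(L(t),A(t))-\frac{1}{k(\varphi,t)}\right)\mathbf{N}_{in}(\varphi,t),\qquad X(\varphi,0)=X_0(\varphi),\quad \varphi\in S^1,$$ has a smooth convex solution defined on $S^1\times[0,T_* )$ for some time $T_*>0$. Moreover, during the time interval $[0,T_* )$, the parametrization of $\gamma_t$ by its outward normal angle $\theta$ is given by $$P(\theta,t)=e^{t}\int_{-\infty}^{\infty}\frac{1}{2\sqrt{\pi t}}e^{-\frac{\xi^2}{4t}}\Big[u(\theta-\xi,0)(\cos\theta,\sin\theta)+u_\theta(\theta-\xi,0)(-\sin\theta,\cos\theta)\Big]d\xi+\left(\frac{L(t)}{2\pi}-\frac{L(0)}{2\pi}e^{t}\right)(\cos\theta,\sin\theta).$$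
   Context: "Convex" means strictly convex: a convex closed plane curve has positive curvature everywhere. $S^1=\mathbb{R}/2\pi\mathbb{Z}$. For each $t$, $\gamma_t$ is the closed curve parametrized by $X(\cdot,t)$; $k(\varphi,t)$ is its curvature and $\mathbf{N}_{in}(\varphi,t)$ its inward unit normal at the point $X(\varphi,t)$; $L(t)$ is the length of $\gamma_t$ and $A(t)$ its enclosed area. A convex solution is one for which every $\gamma_t$ is a convex simple closed curve. The support function of a convex closed curve $\gamma$ is $u(\theta)=\langle X(\theta),(\cos\theta,\sin\theta)\rangle$, where $X(\theta)$ is the unique point of $\gamma$ with outward unit normal $(\cos\theta,\sin\theta)$. $u(\theta,0)$ denotes the support function of $\gamma_0$, regarded as a $2\pi$-periodic function on $\mathbb{R}$. Parametrization by the outward normal angle means that $P(\theta,t)$ is the point of $\gamma_t$ with outward unit normal $(\cos\theta,\sin\theta)$. At $t=0$ the heat-kernel integral is understood as its limit as $t\to0^+$. *)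

theory Defs
  imports "HOL-Analysis.Analysis"
begin

text \<open>
  Continuous differentiability of order \<open>k\<close> on a set, with derivatives taken within the set.
  On an open set this is the usual notion; on \<open>UNIV \<times> {0..<T}\<close>
  it means that all partial derivatives exist and are continuous up to and including time 0
  (derivatives within that set are unique).
\<close>

primrec Ck_on ::
  "nat \<Rightarrow> ('a::euclidean_space \<Rightarrow> 'b::real_normed_vector) \<Rightarrow> 'a set \<Rightarrow> bool" where
  "Ck_on 0 f S \<longleftrightarrow> continuous_on S f"
| "Ck_on (Suc k) f S \<longleftrightarrow>
     (\<exists>f'. (\<forall>x\<in>S. (f has_derivative f' x) (at x within S)) \<and>
           (\<forall>v. Ck_on k (\<lambda>x. f' x v) S))"

definition smooth_on :: "('a::euclidean_space \<Rightarrow> 'b::real_normed_vector) \<Rightarrow> 'a set \<Rightarrow> bool" where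
  "smooth_on f S \<longleftrightarrow> (\<forall>k. Ck_on k f S)"

text \<open>
  The Euclidean plane is the type \<open>complex\<close> with its real inner product; the
  vector \<open>(cos \<theta>, sin \<theta>)\<close> is \<open>cis \<theta>\<close>. Functions on the circle are
  \<open>2\<pi>\<close>-periodic functions on the real line. Neither orientation of a curve is preferred:
  the inward normal is the unit normal pointing into the bounded side of the curve.
\<close>

definition regular_simple_closed_curve :: "(real \<Rightarrow> complex) \<Rightarrow> bool" where
  "regular_simple_closed_curve c \<longleftrightarrow>
     smooth_on c UNIV \<and> (\<forall>\<phi>. c (\<phi> + 2 * pi) = c \<phi>) \<and>
     (\<forall>\<phi>. vector_derivative c (at \<phi>) \<noteq> 0) \<and> inj_on c {0..<2 * pi}"

definition inward_normal :: "(real \<Rightarrow> complex) \<Rightarrow> real \<Rightarrow> complex" where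
  "inward_normal c \<phi> =
     (THE N. norm N = 1 \<and> inner N (vector_derivative c (at \<phi>)) = 0 \<and>
             (\<exists>\<epsilon>>0. \<forall>s. 0 < s \<and> s < \<epsilon> \<longrightarrow> c \<phi> + s *\<^sub>R N \<in> inside (range c)))"

definition outward_normal :: "(real \<Rightarrow> complex) \<Rightarrow> real \<Rightarrow> complex" where
  "outward_normal c \<phi> = - inward_normal c \<phi>"

definition unit_tangent :: "(real \<Rightarrow> complex) \<Rightarrow> real \<Rightarrow> complex" where
  "unit_tangent c \<phi> = vector_derivative c (at \<phi>) /\<^sub>R norm (vector_derivative c (at \<phi>))"

text \<open>
  Curvature with respect to the inward normal, from the Frenet equation
  \<open>dT/ds = k N\<close> with \<open>ds = |c'| d\<phi>\<close>. It does not change when the orientation is reversed.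
\<close>

definition curvature :: "(real \<Rightarrow> complex) \<Rightarrow> real \<Rightarrow> real" where
  "curvature c \<phi> =
     inner (vector_derivative (unit_tangent c) (at \<phi>) /\<^sub>R norm (vector_derivative c (at \<phi>)))
           (inward_normal c \<phi>)"

definition convex_simple_closed_curve :: "(real \<Rightarrow> complex) \<Rightarrow> bool" where
  "convex_simple_closed_curve c \<longleftrightarrow>
     regular_simple_closed_curve c \<and> (\<forall>\<phi>. curvature c \<phi> > 0)"

definition curve_length :: "(real \<Rightarrow> complex) \<Rightarrow> real" where
  "curve_length c = integral {0..2 * pi} (\<lambda>\<phi>. norm (vector_derivative c (at \<phi>)))"

definition enclosed_area :: "(real \<Rightarrow> complex) \<Rightarrow> real" where
  "enclosed_area c = measure lebesgue (inside (range c))"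

definition normal_angle_point :: "(real \<Rightarrow> complex) \<Rightarrow> real \<Rightarrow> complex" where
  "normal_angle_point c \<theta> = (THE p. \<exists>\<phi>. p = c \<phi> \<and> outward_normal c \<phi> = cis \<theta>)"

definition support_function :: "(real \<Rightarrow> complex) \<Rightarrow> real \<Rightarrow> real" where
  "support_function c \<theta> = inner (normal_angle_point c \<theta>) (cis \<theta>)"

definition smooth_convex_solution ::
  "(real \<Rightarrow> real \<Rightarrow> real) \<Rightarrow> (real \<Rightarrow> complex) \<Rightarrow> real \<Rightarrow> (real \<Rightarrow> real \<Rightarrow> complex) \<Rightarrow> bool" where
  "smooth_convex_solution H X\<^sub>0 T X \<longleftrightarrow>
     smooth_on (\<lambda>(\<phi>, t). X \<phi> t) (UNIV \<times> {0..<T}) \<and>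
     (\<forall>t\<in>{0..<T}. convex_simple_closed_curve (\<lambda>\<phi>. X \<phi> t)) \<and>
     (\<forall>\<phi>. X \<phi> 0 = X\<^sub>0 \<phi>) \<and>
     (\<forall>\<phi>. \<forall>t\<in>{0..<T}.
        ((\<lambda>s. X \<phi> s) has_vector_derivative
           (H (curve_length (\<lambda>\<psi>. X \<psi> t)) (enclosed_area (\<lambda>\<psi>. X \<psi> t))
              - 1 / curvature (\<lambda>\<psi>. X \<psi> t) \<phi>) *\<^sub>R inward_normal (\<lambda>\<psi>. X \<psi> t) \<phi>)
          (at t within {0..<T}))"

definition heat_kernel_integral :: "(real \<Rightarrow> real) \<Rightarrow> real \<Rightarrow> real \<Rightarrow> complex" where
  "heat_kernel_integral u t \<theta> =
     (LINT \<xi>|lborel. (1 / (2 * sqrt (pi * t)) * exp (- \<xi>\<^sup>2 / (4 * t))) *\<^sub>R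
        (u (\<theta> - \<xi>) *\<^sub>R Complex (cos \<theta>) (sin \<theta>) +
         deriv u (\<theta> - \<xi>) *\<^sub>R Complex (- sin \<theta>) (cos \<theta>)))"

definition heat_term :: "(real \<Rightarrow> real) \<Rightarrow> real \<Rightarrow> real \<Rightarrow> complex" where
  "heat_term u t \<theta> =
     (if t = 0 then Lim (at_right 0) (\<lambda>s. heat_kernel_integral u s \<theta>)
      else heat_kernel_integral u t \<theta>)"

end

theory Submission
  imports Defs "HOL-Probability.Distributions" "HOL-Real_Asymp.Real_Asymp"
begin

text \<open>
  In terms of the support function \<open>u\<close>, a curve parametrized by its outward normal angle is
  \<open>P = u cis + u' \<i> cis\<close>, its radius of curvature is \<open>\<rho> = u + u''\<close>, and the flow becomes
  \<open>u\<^sub>t = u + u'' - H\<close>, where \<open>H\<close> depends on time only. Hence \<open>u = exp t * v + l t\<close> with \<open>v\<close> the solution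
  of the heat equation with the same initial value, and length and area are polynomials in \<open>l\<close> with
  coefficients smooth in \<open>t\<close>; this leaves a scalar ODE for \<open>l\<close>. The material parametrization is recovered
  from the ODE \<open>\<theta>\<^sub>t = - \<rho>' / \<rho>\<close> for the normal angle, which expresses that the velocity is normal.
  That the normal angle of the initial curve is a global parameter rests on Hopf's theorem on turning tangents.
\<close>

section \<open>Functions of class C^k\<close>

text \<open>The nonlocal term is constant along each curve, so it only adds a function of time to
  the support function and the remaining evolution is linear. The heat flow preserves the mean over
  a period, so L(t) = exp t * L(0) + 2 pi l(t); this is why the last coefficient of the formula is
  l(t).

  Two points need care. Smoothness has to hold up to t = 0, where the heat kernel is singular:
  rescaling the variable turns the kernel into a fixed Gaussian measure, and the square root of t
  that remains in the argument is removed by an integration by parts. And the area is the Lebesgue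
  measure of the inside of a point set, so it is tied to the support function by slicing the convex
  body.

  The existence time shrinks three times: for the width equation, for positivity of the radius of
  curvature, and for the angle equation.\<close>

lemma Ck_on_cong:
  assumes "\<And>x. x \<in> S \<Longrightarrow> f x = g x"
  shows "Ck_on k f S \<longleftrightarrow> Ck_on k g S"
proof (cases k)
  case 0
  then show ?thesis using continuous_on_cong[OF refl assms] by simp
next
  case (Suc n)
  have "(f has_derivative f') (at x within S) \<longleftrightarrow> (g has_derivative f') (at x within S)" if "x \<in> S" for x f'
    using has_derivative_transform[OF that, of f g f'] has_derivative_transform[OF that, of g f f'] assms
    by auto
  then show ?thesis using Suc by auto
qed

lemma Ck_on_subset: "Ck_on k f S \<Longrightarrow> T \<subseteq> S \<Longrightarrow> Ck_on k f T"
proof (induction k arbitrary: f)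
  case 0
  then show ?case by (auto intro: continuous_on_subset)
next
  case (Suc k)
  then obtain f' where "\<forall>x\<in>S. (f has_derivative f' x) (at x within S)"
    "\<forall>v. Ck_on k (\<lambda>x. f' x v) S" by auto
  then show ?case using Suc.IH Suc.prems(2)
    by (auto intro!: exI[of _ f'] intro: has_derivative_subset)
qed

lemma Ck_on_SucI:
  assumes "\<And>x. x \<in> S \<Longrightarrow> (f has_derivative f' x) (at x within S)"
    "\<And>v. Ck_on k (\<lambda>x. f' x v) S"
  shows "Ck_on (Suc k) f S"
  using assms by auto

lemma Ck_on_SucE:
  assumes "Ck_on (Suc k) f S"
  obtains f' where "\<And>x. x \<in> S \<Longrightarrow> (f has_derivative f' x) (at x within S)"
    "\<And>v. Ck_on k (\<lambda>x. f' x v) S"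
  using assms by auto

lemma Ck_on_Suc_imp: "Ck_on (Suc k) f S \<Longrightarrow> Ck_on k f S"
proof (induction k arbitrary: f)
  case 0
  then obtain f' where "\<forall>x\<in>S. (f has_derivative f' x) (at x within S)" by auto
  then show ?case by (auto intro: has_derivative_continuous_on)
next
  case (Suc k)
  obtain f' where 1: "\<And>x. x \<in> S \<Longrightarrow> (f has_derivative f' x) (at x within S)"
    "\<And>v. Ck_on (Suc k) (\<lambda>x. f' x v) S" using Ck_on_SucE[OF Suc.prems] by blast
  show ?case by (rule Ck_on_SucI[where f'=f']) (use 1 Suc.IH in blast)+
qed

lemma Ck_on_imp_continuous_on: "Ck_on k f S \<Longrightarrow> continuous_on S f"
  by (induction k) (auto dest!: Ck_on_Suc_imp simp del: Ck_on.simps(2))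

lemma Ck_on_const: "Ck_on k (\<lambda>x. c) S"
proof (induction k arbitrary: c)
  case (Suc k)
  show ?case by (rule Ck_on_SucI[where f'="\<lambda>x v. 0"]) (auto simp: Suc)
qed simp

lemma Ck_on_linear_compose:
  assumes "bounded_linear h" "Ck_on k f S"
  shows "Ck_on k (\<lambda>x. h (f x)) S"
  using assms(2)
proof (induction k arbitrary: f)
  case 0
  then show ?case by (auto intro: bounded_linear.continuous_on[OF assms(1)])
next
  case (Suc k)
  then obtain f' where 1: "\<And>x. x \<in> S \<Longrightarrow> (f has_derivative f' x) (at x within S)"
    "\<And>v. Ck_on k (\<lambda>x. f' x v) S" using Ck_on_SucE by blast
  show ?case
    by (rule Ck_on_SucI[where f'="\<lambda>x v. h (f' x v)"])
      (use 1 Suc.IH bounded_linear.has_derivative[OF assms(1)] in blast)+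
qed

lemma Ck_on_linear: "bounded_linear h \<Longrightarrow> Ck_on k h S"
proof -
  assume h: "bounded_linear h"
  have id: "Ck_on k (\<lambda>x. x) S"
  proof (cases k)
    case (Suc n)
    have "Ck_on (Suc n) (\<lambda>x. x) S"
      by (rule Ck_on_SucI[where f'="\<lambda>x v. v"]) (auto simp: Ck_on_const)
    then show ?thesis using Suc by simp
  qed auto
  from Ck_on_linear_compose[OF h id] show ?thesis .
qed

lemma Ck_on_add:
  assumes "Ck_on k f S" "Ck_on k g S"
  shows "Ck_on k (\<lambda>x. f x + g x) S"
  using assms
proof (induction k arbitrary: f g)
  case 0
  then show ?case by (auto intro: continuous_on_add)
next
  case (Suc k)
  obtain f' where 1: "\<And>x. x \<in> S \<Longrightarrow> (f has_derivative f' x) (at x within S)"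
    "\<And>v. Ck_on k (\<lambda>x. f' x v) S" using Ck_on_SucE[OF Suc.prems(1)] by blast
  obtain g' where 2: "\<And>x. x \<in> S \<Longrightarrow> (g has_derivative g' x) (at x within S)"
    "\<And>v. Ck_on k (\<lambda>x. g' x v) S" using Ck_on_SucE[OF Suc.prems(2)] by blast
  show ?case
    by (rule Ck_on_SucI[where f'="\<lambda>x v. f' x v + g' x v"])
      (use 1 2 Suc.IH has_derivative_add in blast)+
qed

lemma Ck_on_bilinear:
  assumes b: "bounded_bilinear b" and "Ck_on k f S" "Ck_on k g S"
  shows "Ck_on k (\<lambda>x. b (f x) (g x)) S"
  using assms(2,3)
proof (induction k arbitrary: f g)
  case 0
  then show ?case by (auto intro: bounded_bilinear.continuous_on[OF b])
next
  case (Suc k)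
  obtain f' where 1: "\<And>x. x \<in> S \<Longrightarrow> (f has_derivative f' x) (at x within S)"
    "\<And>v. Ck_on k (\<lambda>x. f' x v) S" using Ck_on_SucE[OF Suc.prems(1)] by blast
  obtain g' where 2: "\<And>x. x \<in> S \<Longrightarrow> (g has_derivative g' x) (at x within S)"
    "\<And>v. Ck_on k (\<lambda>x. g' x v) S" using Ck_on_SucE[OF Suc.prems(2)] by blast
  note fg = Suc.prems[THEN Ck_on_Suc_imp]
  show ?case
  proof (rule Ck_on_SucI[where f'="\<lambda>x v. b (f x) (g' x v) + b (f' x v) (g x)"])
    fix x assume "x \<in> S"
    then show "((\<lambda>x. b (f x) (g x)) has_derivative (\<lambda>v. b (f x) (g' x v) + b (f' x v) (g x))) (at x within S)"
      using bounded_bilinear.FDERIV[OF b 1(1) 2(1)] by blast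
  qed (intro Ck_on_add Suc.IH fg 1 2)
qed

lemmas Ck_on_mult = Ck_on_bilinear[OF bounded_bilinear_mult]
lemmas Ck_on_scaleR = Ck_on_bilinear[OF bounded_bilinear_scaleR]
lemmas Ck_on_inner = Ck_on_bilinear[OF bounded_bilinear_inner]

lemma Ck_on_uminus: "Ck_on k f S \<Longrightarrow> Ck_on k (\<lambda>x. - f x) S"
  by (rule Ck_on_linear_compose[OF bounded_linear_minus[OF bounded_linear_ident]])

lemma Ck_on_diff: "Ck_on k f S \<Longrightarrow> Ck_on k g S \<Longrightarrow> Ck_on k (\<lambda>x. f x - g x) S"
  using Ck_on_add[OF _ Ck_on_uminus, of k f S g] by simp

lemma Ck_on_sum: "(\<And>i. i \<in> I \<Longrightarrow> Ck_on k (f i) S) \<Longrightarrow> Ck_on k (\<lambda>x. \<Sum>i\<in>I. f i x) S"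
  by (induction I rule: infinite_finite_induct) (auto simp: Ck_on_const intro: Ck_on_add)

lemma Ck_on_compose:
  assumes "Ck_on k g T" "Ck_on k f S" "f ` S \<subseteq> T"
  shows "Ck_on k (\<lambda>x. g (f x)) S"
  using assms
proof (induction k arbitrary: f g)
  case 0
  then show ?case by (auto intro: continuous_on_compose2)
next
  case (Suc k)
  obtain f' where 1: "\<And>x. x \<in> S \<Longrightarrow> (f has_derivative f' x) (at x within S)"
    "\<And>v. Ck_on k (\<lambda>x. f' x v) S" using Ck_on_SucE[OF Suc.prems(2)] by blast
  obtain g' where 2: "\<And>x. x \<in> T \<Longrightarrow> (g has_derivative g' x) (at x within T)"
    "\<And>v. Ck_on k (\<lambda>x. g' x v) T" using Ck_on_SucE[OF Suc.prems(1)] by blast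
  have f: "Ck_on k f S" by (rule Ck_on_Suc_imp[OF Suc.prems(2)])
  \<comment> \<open>\<open>Ck_on\<close> controls \<open>g'\<close> in a fixed direction, while the
    chain rule produces the direction \<open>f' x v\<close>, which moves with \<open>x\<close>;
    expanding it in the basis brings back fixed directions.\<close>
  have eq: "g' (f x) (f' x v) = (\<Sum>b\<in>Basis. (f' x v \<bullet> b) *\<^sub>R g' (f x) b)" if "x \<in> S" for x v
  proof -
    have "linear (g' (f x))"
      using 2(1)[of "f x"] that Suc.prems(3) has_derivative_linear by blast
    then have "g' (f x) (\<Sum>b\<in>Basis. (f' x v \<bullet> b) *\<^sub>R b) = (\<Sum>b\<in>Basis. (f' x v \<bullet> b) *\<^sub>R g' (f x) b)"
      by (simp add: linear_sum linear_scale)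
    then show ?thesis by (simp add: euclidean_representation)
  qed
  show ?case
  proof (rule Ck_on_SucI[where f'="\<lambda>x v. g' (f x) (f' x v)"])
    fix x assume x: "x \<in> S"
    show "((\<lambda>x. g (f x)) has_derivative (\<lambda>v. g' (f x) (f' x v))) (at x within S)"
      using diff_chain_within[OF 1(1)[OF x] has_derivative_subset[OF 2(1) Suc.prems(3)]] x Suc.prems(3)
      by (auto simp: o_def)
  next
    fix v
    have "Ck_on k (\<lambda>x. \<Sum>b\<in>Basis. (f' x v \<bullet> b) *\<^sub>R g' (f x) b) S"
      by (intro Ck_on_sum Ck_on_scaleR Ck_on_inner 1 Ck_on_const Suc.IH[OF 2(2) f Suc.prems(3)])
    then show "Ck_on k (\<lambda>x. g' (f x) (f' x v)) S"
      by (subst Ck_on_cong[OF eq])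
  qed
qed

lemma Ck_on_fst: "Ck_on k f S \<Longrightarrow> Ck_on k (\<lambda>x. fst (f x)) S"
  by (rule Ck_on_linear_compose[OF bounded_linear_fst])

lemma Ck_on_snd: "Ck_on k f S \<Longrightarrow> Ck_on k (\<lambda>x. snd (f x)) S"
  by (rule Ck_on_linear_compose[OF bounded_linear_snd])

lemma Ck_on_id: "Ck_on k (\<lambda>x. x) S"
  by (rule Ck_on_linear[OF bounded_linear_ident])

lemma Ck_on_Pair:
  assumes "Ck_on k f S" "Ck_on k g S"
  shows "Ck_on k (\<lambda>x. (f x, g x)) S"
proof -
  have "bounded_linear (\<lambda>x. (x, 0))" "bounded_linear (\<lambda>x. (0, x))"
    by (intro bounded_linear_Pair bounded_linear_ident bounded_linear_zero)+
  from Ck_on_add[OF this[THEN Ck_on_linear_compose]] assms show ?thesis by fastforce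
qed

lemma Ck_on_vector_SucI:
  assumes "\<And>x. x \<in> S \<Longrightarrow> (f has_vector_derivative f' x) (at x within S)" "Ck_on k f' S"
  shows "Ck_on (Suc k) f S"
  by (rule Ck_on_SucI[where f'="\<lambda>x v. v *\<^sub>R f' x"])
    (use assms in \<open>auto simp: has_vector_derivative_def intro: Ck_on_scaleR Ck_on_const\<close>)

text \<open>A class of functions closed under differentiation within \<open>S\<close> consists of
  smooth functions. This settles \<open>exp\<close> and the multiples of \<open>cis\<close> without
  higher derivatives being computed.\<close>

lemma Ck_on_vector_coinduct:
  assumes "\<And>f. P f \<Longrightarrow> \<exists>f'. P f' \<and> (\<forall>x\<in>S. (f has_vector_derivative f' x) (at x within S))" "P f"
  shows "Ck_on k f S"
  using assms(2)
proof (induction k arbitrary: f)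
  case 0
  then obtain f' where "\<forall>x\<in>S. (f has_vector_derivative f' x) (at x within S)" using assms(1) by blast
  then show ?case
    by (auto intro: has_vector_derivative_continuous simp: continuous_on_eq_continuous_within)
next
  case (Suc k)
  then show ?case using assms(1)[of f] Ck_on_vector_SucI by meson
qed

lemma Ck_on_exp_real: "Ck_on k (exp :: real \<Rightarrow> real) S"
  by (rule Ck_on_vector_coinduct[where P="\<lambda>f. f = exp"])
    (auto intro!: DERIV_exp[THEN DERIV_subset] simp flip: has_real_derivative_iff_has_vector_derivative)

lemma has_vector_derivative_cis: "(cis has_vector_derivative \<i> * cis x) (at x within S)"
  unfolding has_vector_derivative_complex_iff
  by (auto intro!: derivative_eq_intros)

lemma Ck_on_cis: "Ck_on k cis S"
proof -
  have "Ck_on k (\<lambda>x. 1 * cis x) S"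
  proof (rule Ck_on_vector_coinduct[where P="\<lambda>f. \<exists>a. f = (\<lambda>x. a * cis x)"])
    fix f assume "\<exists>a. f = (\<lambda>x. a * cis x)"
    then obtain a where f: "f = (\<lambda>x. a * cis x)" by blast
    have "(f has_vector_derivative (a * \<i>) * cis x) (at x within S)" for x
      unfolding f mult.assoc by (intro has_vector_derivative_mult_right has_vector_derivative_cis)
    then show "\<exists>f'. (\<exists>a. f' = (\<lambda>x. a * cis x)) \<and> (\<forall>x\<in>S. (f has_vector_derivative f' x) (at x within S))"
      by (intro exI[of _ "\<lambda>x. (a * \<i>) * cis x"]) blast
  qed blast
  then show ?thesis by simp
qed

lemma Ck_on_inverse_real:
  assumes "0 \<notin> S"
  shows "Ck_on k (inverse :: real \<Rightarrow> real) S"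
proof (induction k)
  case 0
  then show ?case using assms by (auto intro!: continuous_intros)
next
  case (Suc k)
  show ?case
  proof (rule Ck_on_vector_SucI[where f'="\<lambda>x. - (inverse x * inverse x)"])
    fix x assume "x \<in> S"
    then have "x \<noteq> 0" using assms by auto
    then show "(inverse has_vector_derivative - (inverse x * inverse x)) (at x within S)"
      unfolding has_real_derivative_iff_has_vector_derivative[symmetric]
      by (auto intro!: derivative_eq_intros)
  qed (intro Ck_on_uminus Ck_on_mult Suc)
qed

lemma Ck_on_inverse:
  fixes f :: "'a::euclidean_space \<Rightarrow> real"
  assumes "Ck_on k f S" "\<And>x. x \<in> S \<Longrightarrow> f x \<noteq> 0"
  shows "Ck_on k (\<lambda>x. inverse (f x)) S"
  by (rule Ck_on_compose[OF Ck_on_inverse_real assms(1), of "- {0}"]) (use assms in auto)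

lemma Ck_on_divide:
  fixes f :: "'a::euclidean_space \<Rightarrow> real"
  assumes "Ck_on k f S" "Ck_on k g S" "\<And>x. x \<in> S \<Longrightarrow> g x \<noteq> 0"
  shows "Ck_on k (\<lambda>x. f x / g x) S"
  unfolding divide_inverse by (intro Ck_on_mult Ck_on_inverse assms)

lemma Ck_on_exp:
  fixes f :: "'a::euclidean_space \<Rightarrow> real"
  shows "Ck_on k f S \<Longrightarrow> Ck_on k (\<lambda>x. exp (f x)) S"
  by (rule Ck_on_compose[OF Ck_on_exp_real, where T=UNIV]) auto

lemma Ck_on_cis_compose:
  shows "Ck_on k f S \<Longrightarrow> Ck_on k (\<lambda>x. cis (f x)) S"
  by (rule Ck_on_compose[OF Ck_on_cis, where T=UNIV]) auto

text \<open>Continuity is asked of \<open>ft\<close>: the step in the second variable is estimated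
  by the mean value inequality along \<open>I\<close>, the step in the first by differentiability at
  \<open>p\<close> itself.\<close>

lemma has_derivative_continuous_partials:
  fixes f :: "real \<times> real \<Rightarrow> 'b::real_normed_vector"
  assumes fx: "\<And>x t. x \<in> A \<Longrightarrow> t \<in> I \<Longrightarrow> ((\<lambda>x. f (x, t)) has_vector_derivative fx (x, t)) (at x within A)"
    and ft: "\<And>x t. x \<in> A \<Longrightarrow> t \<in> I \<Longrightarrow> ((\<lambda>t. f (x, t)) has_vector_derivative ft (x, t)) (at t within I)"
    and "continuous_on (A \<times> I) ft" "convex I" and p: "p \<in> A \<times> I"
  shows "(f has_derivative (\<lambda>v. fst v *\<^sub>R fx p + snd v *\<^sub>R ft p)) (at p within A \<times> I)"
proof -
  obtain x t where p: "p = (x, t)" "x \<in> A" "t \<in> I" using p by auto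
  have "((\<lambda>(x, t). f (x, t)) has_derivative (\<lambda>(u, v). u *\<^sub>R fx (x, t) + v *\<^sub>R ft (x, t)))
     (at (x, t) within A \<times> I)"
  proof (rule has_derivative_eq_rhs)
    show "((\<lambda>(x, t). f (x, t)) has_derivative
      (\<lambda>(u, v). u *\<^sub>R fx (x, t) + blinfun_apply (blinfun_scaleR_left (ft (x, t))) v)) (at (x, t) within A \<times> I)"
    proof (rule has_derivative_partialsI[where fy="\<lambda>x t. blinfun_scaleR_left (ft (x, t))"])
      show "((\<lambda>x. f (x, t)) has_derivative (\<lambda>u. u *\<^sub>R fx (x, t))) (at x within A)"
        using fx p by (simp add: has_vector_derivative_def)
      show "((\<lambda>t. f (x, t)) has_derivative blinfun_apply (blinfun_scaleR_left (ft (x, t)))) (at t within I)"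
        if "x \<in> A" "t \<in> I" for x t
        using ft that by (simp add: has_vector_derivative_def)
      have "continuous_on (A \<times> I) (\<lambda>p. blinfun_scaleR_left (ft p))"
        by (intro continuous_intros assms(3))
      then show "continuous (at (x, t) within A \<times> I) (\<lambda>(x, t). blinfun_scaleR_left (ft (x, t)))"
        using p by (simp add: continuous_on_eq_continuous_within case_prod_unfold)
    qed (use p assms in auto)
  qed (auto simp: blinfun_scaleR_left.rep_eq)
  then show ?thesis
    by (simp add: p case_prod_unfold)
qed

lemma Ck_on_partialsI:
  fixes f :: "real \<times> real \<Rightarrow> 'b::real_normed_vector"
  assumes fx: "\<And>x t. x \<in> A \<Longrightarrow> t \<in> I \<Longrightarrow> ((\<lambda>x. f (x, t)) has_vector_derivative fx (x, t)) (at x within A)"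
    and ft: "\<And>x t. x \<in> A \<Longrightarrow> t \<in> I \<Longrightarrow> ((\<lambda>t. f (x, t)) has_vector_derivative ft (x, t)) (at t within I)"
    and "Ck_on k fx (A \<times> I)" "Ck_on k ft (A \<times> I)" "convex I"
  shows "Ck_on (Suc k) f (A \<times> I)"
  by (rule Ck_on_SucI[OF has_derivative_continuous_partials[OF fx ft Ck_on_imp_continuous_on[OF assms(4)] assms(5)]])
    (intro Ck_on_add Ck_on_scaleR Ck_on_const assms | assumption)+

lemma Ck_on_slice_fst:
  assumes "Ck_on k f (A \<times> I)" "t \<in> I"
  shows "Ck_on k (\<lambda>x. f (x, t)) A"
  by (rule Ck_on_compose[OF assms(1)]) (use assms(2) in \<open>auto intro: Ck_on_Pair Ck_on_id Ck_on_const\<close>)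

lemma Ck_on_slice_snd:
  assumes "Ck_on k f (A \<times> I)" "x \<in> A"
  shows "Ck_on k (\<lambda>t. f (x, t)) I"
  by (rule Ck_on_compose[OF assms(1)]) (use assms(2) in \<open>auto intro: Ck_on_Pair Ck_on_id Ck_on_const\<close>)

text \<open>\<open>Ck_on\<close> yields a separate derivative for each order. Uniqueness identifies
  them all with \<open>vector_derivative\<close>, so a single function has every order of
  regularity.\<close>

lemma smooth_on_vector_derivative:
  fixes f :: "real \<Rightarrow> 'b::real_normed_vector"
  assumes "smooth_on f UNIV"
  shows "(f has_vector_derivative vector_derivative f (at x)) (at x)"
    "smooth_on (\<lambda>x. vector_derivative f (at x)) UNIV"
proof -
  have *: "\<exists>g. (\<forall>x. (f has_vector_derivative g x) (at x)) \<and> Ck_on k g UNIV" for k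
  proof -
    have "Ck_on (Suc k) f UNIV" using assms by (auto simp: smooth_on_def simp del: Ck_on.simps)
    then obtain f' where 1: "\<And>x. (f has_derivative f' x) (at x)"
      "\<And>v. Ck_on k (\<lambda>x. f' x v) UNIV" by (elim Ck_on_SucE) auto
    have "(f has_vector_derivative f' x 1) (at x)" for x
    proof -
      have "f' x = (\<lambda>r. r *\<^sub>R f' x 1)"
        by (intro ext linear_scale[OF has_derivative_linear[OF 1(1)[of x]], of _ 1, unfolded real_scaleR_def mult_1_right])
      then show ?thesis unfolding has_vector_derivative_def by (rule has_derivative_eq_rhs[OF 1(1)])
    qed
    then have "\<forall>x. (f has_vector_derivative f' x 1) (at x)" by blast
    then show ?thesis using 1(2)[of 1] by (intro exI[of _ "\<lambda>x. f' x 1"] conjI)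
  qed
  show 1: "(f has_vector_derivative vector_derivative f (at x)) (at x)"
    using *[of 0] vector_derivative_at by metis
  show "smooth_on (\<lambda>x. vector_derivative f (at x)) UNIV"
    unfolding smooth_on_def
  proof
    fix k obtain g where "\<And>x. (f has_vector_derivative g x) (at x)" "Ck_on k g UNIV"
      using * by blast
    moreover from this have "vector_derivative f (at x) = g x" for x
      by (auto intro: vector_derivative_at)
    ultimately show "Ck_on k (\<lambda>x. vector_derivative f (at x)) UNIV" by simp
  qed
qed

lemma Ck_on_partial_fst:
  fixes f :: "real \<times> real \<Rightarrow> 'b::real_normed_vector"
  assumes "Ck_on (Suc k) f (A \<times> I)" "open A"
  obtains g where "Ck_on k g (A \<times> I)"
    "\<And>x t. x \<in> A \<Longrightarrow> t \<in> I \<Longrightarrow> ((\<lambda>x. f (x, t)) has_vector_derivative g (x, t)) (at x)"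
proof -
  obtain f' where 1: "\<And>p. p \<in> A \<times> I \<Longrightarrow> (f has_derivative f' p) (at p within A \<times> I)"
    "\<And>v. Ck_on k (\<lambda>x. f' x v) (A \<times> I)" using Ck_on_SucE[OF assms(1)] by blast
  have "((\<lambda>x. f (x, t)) has_vector_derivative f' (x, t) (1, 0)) (at x)" if "x \<in> A" "t \<in> I" for x t
  proof -
    have "((\<lambda>x. (x, t)) has_derivative (\<lambda>v. (v, 0))) (at x within A)"
      by (auto intro!: derivative_eq_intros)
    from diff_chain_within[OF this has_derivative_subset[OF 1(1)]] that
    have "((\<lambda>x. f (x, t)) has_derivative (\<lambda>v. f' (x, t) (v, 0))) (at x within A)"
      by (auto simp: o_def)
    moreover have "(\<lambda>v. f' (x, t) (v, 0)) = (\<lambda>v. v *\<^sub>R f' (x, t) (1, 0))"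
    proof
      fix v have "f' (x, t) (v *\<^sub>R (1, 0)) = v *\<^sub>R f' (x, t) (1, 0)"
        by (rule linear_scale[OF has_derivative_linear[OF 1(1)]]) (use that in auto)
      moreover have "v *\<^sub>R (1, 0) = (v, 0 :: real)" for v :: real by simp
      ultimately show "f' (x, t) (v, 0) = v *\<^sub>R f' (x, t) (1, 0)" by metis
    qed
    ultimately have "((\<lambda>x. f (x, t)) has_derivative (\<lambda>v. v *\<^sub>R f' (x, t) (1, 0))) (at x within A)"
      by (rule has_derivative_eq_rhs)
    then show ?thesis
      unfolding has_vector_derivative_def at_within_open[OF that(1) assms(2)] .
  qed
  then show thesis using that[OF 1(2)[of "(1, 0)"]] by blast
qed

lemma Ck_on_partial_snd:
  fixes f :: "real \<times> real \<Rightarrow> 'b::real_normed_vector"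
  assumes "Ck_on (Suc k) f (A \<times> I)"
  obtains g where "Ck_on k g (A \<times> I)"
    "\<And>x t. x \<in> A \<Longrightarrow> t \<in> I \<Longrightarrow> ((\<lambda>t. f (x, t)) has_vector_derivative g (x, t)) (at t within I)"
proof -
  obtain f' where 1: "\<And>p. p \<in> A \<times> I \<Longrightarrow> (f has_derivative f' p) (at p within A \<times> I)"
    "\<And>v. Ck_on k (\<lambda>x. f' x v) (A \<times> I)" using Ck_on_SucE[OF assms(1)] by blast
  have "((\<lambda>t. f (x, t)) has_vector_derivative f' (x, t) (0, 1)) (at t within I)" if "x \<in> A" "t \<in> I" for x t
  proof -
    have "((\<lambda>t. (x, t)) has_derivative (\<lambda>v. (0, v))) (at t within I)"
      by (auto intro!: derivative_eq_intros)
    from diff_chain_within[OF this has_derivative_subset[OF 1(1)]] that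
    have "((\<lambda>t. f (x, t)) has_derivative (\<lambda>v. f' (x, t) (0, v))) (at t within I)"
      by (auto simp: o_def)
    moreover have "(\<lambda>v. f' (x, t) (0, v)) = (\<lambda>v. v *\<^sub>R f' (x, t) (0, 1))"
    proof
      fix v have "f' (x, t) (v *\<^sub>R (0, 1)) = v *\<^sub>R f' (x, t) (0, 1)"
        by (rule linear_scale[OF has_derivative_linear[OF 1(1)]]) (use that in auto)
      moreover have "v *\<^sub>R (0, 1) = (0 :: real, v)" for v :: real by simp
      ultimately show "f' (x, t) (0, v) = v *\<^sub>R f' (x, t) (0, 1)" by metis
    qed
    ultimately have "((\<lambda>t. f (x, t)) has_derivative (\<lambda>v. v *\<^sub>R f' (x, t) (0, 1))) (at t within I)"
      by (rule has_derivative_eq_rhs)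
    then show ?thesis unfolding has_vector_derivative_def .
  qed
  then show thesis using that[OF 1(2)[of "(0, 1)"]] by blast
qed

text \<open>Openness of \<open>A\<close> makes the partial derivative unique, so the witnesses for
  the different orders coincide.\<close>

lemma smooth_on_partial_fst:
  fixes f :: "real \<times> real \<Rightarrow> 'b::real_normed_vector"
  assumes "smooth_on f (A \<times> I)" "open A"
  obtains fx where "smooth_on fx (A \<times> I)"
    "\<And>x t. x \<in> A \<Longrightarrow> t \<in> I \<Longrightarrow> ((\<lambda>x. f (x, t)) has_vector_derivative fx (x, t)) (at x)"
proof
  let ?fx = "\<lambda>p. vector_derivative (\<lambda>x. f (x, snd p)) (at (fst p))"
  have *: "\<exists>g. (\<forall>x\<in>A. \<forall>t\<in>I. ((\<lambda>x. f (x, t)) has_vector_derivative g (x, t)) (at x)) \<and> Ck_on k g (A \<times> I)" for k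
  proof -
    have "Ck_on (Suc k) f (A \<times> I)" using assms by (auto simp: smooth_on_def simp del: Ck_on.simps)
    from Ck_on_partial_fst[OF this assms(2)] show ?thesis by metis
  qed
  show 1: "((\<lambda>x. f (x, t)) has_vector_derivative ?fx (x, t)) (at x)" if "x \<in> A" "t \<in> I" for x t
  proof -
    obtain g where "\<forall>x\<in>A. \<forall>t\<in>I. ((\<lambda>x. f (x, t)) has_vector_derivative g (x, t)) (at x)"
      using *[of 0] by blast
    then have "((\<lambda>x. f (x, t)) has_vector_derivative g (x, t)) (at x)" using that by blast
    then show ?thesis using vector_derivative_at[of "\<lambda>x. f (x, t)" "g (x, t)" x] by simp
  qed
  show "smooth_on ?fx (A \<times> I)"
    unfolding smooth_on_def
  proof
    fix k obtain g where g: "\<And>x t. x \<in> A \<Longrightarrow> t \<in> I \<Longrightarrow> ((\<lambda>x. f (x, t)) has_vector_derivative g (x, t)) (at x)"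
      "Ck_on k g (A \<times> I)"
      using * by blast
    have "?fx p = g p" if "p \<in> A \<times> I" for p
      using that g(1)[THEN vector_derivative_at] by auto
    then show "Ck_on k ?fx (A \<times> I)" by (rule iffD2[OF Ck_on_cong g(2)])
  qed
qed

section \<open>Smooth periodic functions and the heat flow\<close>

definition smooth_periodic :: "(real \<Rightarrow> real) \<Rightarrow> bool" where
  "smooth_periodic u \<longleftrightarrow> smooth_on u UNIV \<and> (\<forall>x. u (x + 2 * pi) = u x)"

lemma smooth_periodic_deriv:
  assumes "smooth_periodic u"
  shows "(u has_real_derivative deriv u x) (at x)" "smooth_periodic (deriv u)"
proof -
  note 1 = smooth_on_vector_derivative[OF assms[unfolded smooth_periodic_def, THEN conjunct1]]
  have eq: "vector_derivative u (at x) = deriv u x" for x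
    using 1(1)[of x] by (metis DERIV_imp_deriv has_real_derivative_iff_has_vector_derivative)
  show d: "(u has_real_derivative deriv u x) (at x)" for x
    using 1(1)[of x] unfolding eq by (simp add: has_real_derivative_iff_has_vector_derivative)
  have "deriv u (x + 2 * pi) = deriv u x" for x
  proof -
    have "((\<lambda>x. u (x + 2 * pi)) has_real_derivative deriv u (x + 2 * pi)) (at x)"
      using d[of "x + 2 * pi"] by (simp add: DERIV_shift)
    then show ?thesis using assms d[of x] by (auto simp: smooth_periodic_def intro: DERIV_unique)
  qed
  then show "smooth_periodic (deriv u)"
    using 1(2) unfolding eq by (simp add: smooth_periodic_def)
qed

lemma smooth_periodic_DERIV: 
  "smooth_periodic u \<Longrightarrow> (g has_real_derivative g') (at x within S) \<Longrightarrow>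
    ((\<lambda>x. u (g x)) has_real_derivative deriv u (g x) * g') (at x within S)"
  by (rule DERIV_chain2[OF smooth_periodic_deriv(1)])

lemma periodic_int:
  fixes u :: "real \<Rightarrow> 'a"
  assumes "\<And>x. u (x + 2 * pi) = u x"
  shows "u (x + 2 * pi * of_int n) = u x"
proof -
  have plus: "u (x + 2 * pi * real n) = u x" for x n
  proof (induction n)
    case (Suc n)
    then show ?case using assms[of "x + 2 * pi * real n"] by (simp add: algebra_simps)
  qed simp
  show ?thesis
  proof (cases "n \<ge> 0")
    case True
    then show ?thesis using plus[of x "nat n"] by simp
  next
    case False
    then show ?thesis using plus[of "x + 2 * pi * of_int n" "nat (-n)"] by simp
  qed
qed

lemma periodic_representative:
  obtains y :: real and n :: int where "y \<in> {a..<a + 2 * pi}" "x = y + 2 * pi * of_int n"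
proof -
  define n where "n = \<lfloor>(x - a) / (2 * pi)\<rfloor>"
  have "of_int n \<le> (x - a) / (2 * pi)" "(x - a) / (2 * pi) < of_int n + 1" by (auto simp: n_def)
  then have "x - 2 * pi * of_int n \<in> {a..<a + 2 * pi}" by (auto simp: field_simps)
  from that[OF this, of n] show thesis by simp
qed

lemma smooth_periodic_continuous_on: "smooth_periodic u \<Longrightarrow> continuous_on S u"
  unfolding smooth_periodic_def smooth_on_def
  using Ck_on.simps(1) continuous_on_subset by blast

lemma smooth_periodic_bounded:
  assumes "smooth_periodic u"
  obtains B where "B \<ge> 0" "\<And>x. \<bar>u x\<bar> \<le> B"
proof -
  have "bounded (u ` {0..2*pi})"
    by (intro compact_imp_bounded compact_continuous_image smooth_periodic_continuous_on assms) auto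
  then obtain B where B: "\<forall>x\<in>{0..2*pi}. \<bar>u x\<bar> \<le> B" by (auto simp: bounded_iff)
  have "\<bar>u x\<bar> \<le> B" for x
  proof -
    obtain y n where y: "y \<in> {0..<0 + 2 * pi}" "x = y + 2 * pi * of_int n" by (rule periodic_representative)
    have "u (y + 2 * pi * of_int n) = u y" by (rule periodic_int) (use assms in \<open>simp add: smooth_periodic_def\<close>)
    then show ?thesis using B y by auto
  qed
  moreover from this[of 0] have "B \<ge> 0" by simp
  ultimately show ?thesis using that by blast
qed

section \<open>Gaussian averages and the heat flow of a periodic function\<close>

abbreviation gauss :: "real measure" where "gauss \<equiv> density lborel (\<lambda>x. ennreal (std_normal_density x))"

interpretation gauss: prob_space gauss
  by (rule prob_space_normal_density) simp

lemma gauss_UNIV [simp]: "gauss.prob UNIV = 1"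
  using gauss.prob_space by simp

lemma integral_gauss:
  fixes f :: "real \<Rightarrow> 'a::{banach, second_countable_topology}"
  assumes "f \<in> borel_measurable borel"
  shows "(LINT z|gauss. f z) = (LINT z|lborel. std_normal_density z *\<^sub>R f z)"
  using assms by (subst integral_density) auto

lemma integrable_gauss_bounded:
  fixes f :: "real \<Rightarrow> real"
  assumes "continuous_on UNIV f" "\<And>z. \<bar>f z\<bar> \<le> B"
  shows "integrable gauss f"
  by (rule gauss.integrable_const_bound[of _ B])
    (use assms in \<open>auto intro: borel_measurable_continuous_onI\<close>)

lemma integrable_gauss_moment: "integrable gauss (\<lambda>z. \<bar>z\<bar> ^ k)"
  by (subst integrable_density) (auto simp: integrable_std_normal_moment_abs)

lemma integrable_gauss_mult:
  fixes f :: "real \<Rightarrow> real"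
  assumes "continuous_on UNIV f" "\<And>z. \<bar>f z\<bar> \<le> B" "continuous_on UNIV g" "integrable gauss g"
  shows "integrable gauss (\<lambda>z. g z * f z)"
proof (rule Bochner_Integration.integrable_bound[OF integrable_mult_left[OF assms(4), of B]])
  show "(\<lambda>z. g z * f z) \<in> borel_measurable gauss"
    using assms by (auto intro!: borel_measurable_continuous_onI continuous_intros)
  show "AE z in gauss. norm (g z * f z) \<le> norm (g z * B)"
    using assms(2) abs_ge_zero by (intro AE_I2) (auto simp: abs_mult intro!: mult_left_mono order.trans[OF assms(2)])
qed

lemma Taylor_bound1:
  assumes "smooth_periodic u" "\<And>x. \<bar>deriv u x\<bar> \<le> B"
  shows "\<bar>u x - u y\<bar> \<le> B * \<bar>x - y\<bar>"
  using field_differentiable_bound[of UNIV u "deriv u" B x y] smooth_periodic_deriv(1)[OF assms(1)] assms(2)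
  by auto

text \<open>The mean value inequality for \<open>u y - y * deriv u x\<close>, whose derivative is at
  most \<open>B * \<bar>h\<bar>\<close> on the ball of radius \<open>\<bar>h\<bar>\<close>. The
  constant is not the sharp one; what matters below is the quadratic order.\<close>

lemma Taylor_bound2:
  assumes u: "smooth_periodic u" and B: "\<And>x. \<bar>deriv (deriv u) x\<bar> \<le> B"
  shows "\<bar>u (x + h) - u x - h * deriv u x\<bar> \<le> B * h\<^sup>2"
proof -
  have B0: "B \<ge> 0" using B[of 0] by simp
  have d: "((\<lambda>y. u y - y * deriv u x) has_real_derivative deriv u y - deriv u x) (at y within S)" for y S
    by (auto intro!: derivative_eq_intros smooth_periodic_deriv(1)[OF u, THEN DERIV_subset])
  have "norm (deriv u y - deriv u x) \<le> B * \<bar>h\<bar>" if "y \<in> cball x \<bar>h\<bar>" for y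
  proof -
    have "\<bar>deriv u y - deriv u x\<bar> \<le> B * \<bar>y - x\<bar>"
      by (rule Taylor_bound1[OF smooth_periodic_deriv(2)[OF u] B])
    also have "\<dots> \<le> B * \<bar>h\<bar>" using that B0 by (intro mult_left_mono) (auto simp: dist_norm)
    finally show ?thesis by simp
  qed
  then have "norm ((u (x + h) - (x + h) * deriv u x) - (u x - x * deriv u x)) \<le> B * \<bar>h\<bar> * norm ((x + h) - x)"
    by (intro field_differentiable_bound[OF convex_cball[of x "\<bar>h\<bar>"] d]) (auto simp: dist_norm)
  then show ?thesis by (simp add: algebra_simps power2_eq_square)
qed

lemma DERIV_quadratic_boundI:
  fixes F :: "real \<Rightarrow> real"
  assumes "\<And>h. \<bar>F (x + h) - F x - h * D\<bar> \<le> C * h\<^sup>2"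
  shows "(F has_real_derivative D) (at x)"
  unfolding DERIV_def LIM_zero_iff[of _ D, symmetric]
proof (rule Lim_null_comparison)
  show "((\<lambda>h. C * \<bar>h\<bar>) \<longlongrightarrow> 0) (at 0)" by (auto intro!: tendsto_eq_intros)
  have "\<bar>(F (x + h) - F x) / h - D\<bar> \<le> C * \<bar>h\<bar>" if "h \<noteq> 0" for h
  proof -
    have "(F (x + h) - F x) / h - D = (F (x + h) - F x - h * D) / h" using that by (simp add: field_simps)
    then have "\<bar>(F (x + h) - F x) / h - D\<bar> = \<bar>F (x + h) - F x - h * D\<bar> / \<bar>h\<bar>"
      by simp
    also have "\<dots> \<le> C * h\<^sup>2 / \<bar>h\<bar>" using assms by (intro divide_right_mono) auto
    also have "\<dots> = C * \<bar>h\<bar>" using that by (simp add: power2_eq_square field_simps abs_if)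
    finally show ?thesis .
  qed
  then show "\<forall>\<^sub>F h in at 0. norm ((F (x + h) - F x) / h - D) \<le> C * \<bar>h\<bar>"
    by (auto simp: eventually_at_filter)
qed

text \<open>Differentiation under the integral by an explicit error bound: the second order Taylor
  error of \<open>u\<close>, integrated, is at most \<open>h\<^sup>2\<close> times a bound of
  \<open>u''\<close> times the second moment of \<open>q\<close>. The choice \<open>q = 1\<close>
  gives the space derivative, \<open>q z = - z\<close> the derivative in the scale of the
  Gaussian.\<close>

lemma gauss_integral_DERIV:
  fixes q c :: "real \<Rightarrow> real"
  assumes u: "smooth_periodic u" and c: "continuous_on UNIV c" "continuous_on UNIV q"
    and q: "integrable gauss q" "integrable gauss (\<lambda>z. (q z)\<^sup>2)"
  shows "((\<lambda>r. LINT z|gauss. u (c z + r * q z)) has_real_derivative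
    (LINT z|gauss. q z * deriv u (c z + r * q z))) (at r)"
proof -
  note u' = smooth_periodic_deriv(2)[OF u]
  obtain B0 B1 B2 where B: "\<And>x. \<bar>u x\<bar> \<le> B0" "\<And>x. \<bar>deriv u x\<bar> \<le> B1" "\<And>x. \<bar>deriv (deriv u) x\<bar> \<le> B2"
    using smooth_periodic_bounded[OF u] smooth_periodic_bounded[OF u']
      smooth_periodic_bounded[OF smooth_periodic_deriv(2)[OF u']] by metis
  have cont: "continuous_on UNIV (\<lambda>z. f (c z + r * q z))" if "smooth_periodic f" for f r
    by (rule continuous_on_compose2[OF smooth_periodic_continuous_on[OF that, of UNIV]])
      (auto intro!: continuous_intros c)
  have iu: "integrable gauss (\<lambda>z. u (c z + r * q z))" for r
    by (rule integrable_gauss_bounded[OF cont[OF u] B(1)])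
  have iu': "integrable gauss (\<lambda>z. q z * deriv u (c z + r * q z))"
    by (rule integrable_gauss_mult[OF cont[OF u'] B(2) c(2) q(1)])
  show ?thesis
  proof (rule DERIV_quadratic_boundI[where C="B2 * (LINT z|gauss. (q z)\<^sup>2)"])
    fix h
    have "\<bar>(LINT z|gauss. u (c z + (r + h) * q z)) - (LINT z|gauss. u (c z + r * q z)) -
        h * (LINT z|gauss. q z * deriv u (c z + r * q z))\<bar>
      = \<bar>LINT z|gauss. u (c z + (r + h) * q z) - u (c z + r * q z) - h * (q z * deriv u (c z + r * q z))\<bar>"
      using iu iu' by simp
    also have "\<dots> \<le> (LINT z|gauss. \<bar>u (c z + (r + h) * q z) - u (c z + r * q z) - h * (q z * deriv u (c z + r * q z))\<bar>)"
      by (rule integral_abs_bound)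
    also have "\<dots> \<le> (LINT z|gauss. (B2 * h\<^sup>2) * (q z)\<^sup>2)"
    proof (rule integral_mono)
      fix z
      have "\<bar>u ((c z + r * q z) + h * q z) - u (c z + r * q z) - h * q z * deriv u (c z + r * q z)\<bar> \<le> B2 * (h * q z)\<^sup>2"
        by (rule Taylor_bound2[OF u B(3)])
      then show "\<bar>u (c z + (r + h) * q z) - u (c z + r * q z) - h * (q z * deriv u (c z + r * q z))\<bar> \<le> B2 * h\<^sup>2 * (q z)\<^sup>2"
        by (simp add: algebra_simps power_mult_distrib)
    qed (use iu iu' q in auto)
    also have "\<dots> = B2 * (LINT z|gauss. (q z)\<^sup>2) * h\<^sup>2" by simp
    finally show "\<bar>(LINT z|gauss. u (c z + (r + h) * q z)) - (LINT z|gauss. u (c z + r * q z)) -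
        h * (LINT z|gauss. q z * deriv u (c z + r * q z))\<bar> \<le> B2 * (LINT z|gauss. (q z)\<^sup>2) * h\<^sup>2" .
  qed
qed

text \<open>The normal density has derivative \<open>- z\<close> times itself, so the density times
  \<open>g' z - z * g z\<close> is the derivative of the density times \<open>g\<close>, which
  vanishes at both ends of the line.\<close>

lemma gauss_integral_by_parts:
  fixes g g' :: "real \<Rightarrow> real"
  assumes g: "\<And>z. (g has_real_derivative g' z) (at z)" "continuous_on UNIV g'"
    and B: "\<And>z. \<bar>g z\<bar> \<le> B" "\<And>z. \<bar>g' z\<bar> \<le> B'"
  shows "(LINT z|gauss. z * g z) = (LINT z|gauss. g' z)"
proof -
  let ?\<phi> = "std_normal_density"
  have cg: "continuous_on UNIV g" using g(1) by (meson DERIV_continuous_on has_field_derivative_at_within)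
  have i1: "integrable gauss (\<lambda>z. z * g z)"
    using integrable_gauss_moment[of 1]
    by (intro integrable_gauss_mult[OF cg B(1)]) (auto intro!: continuous_intros simp: integrable_abs_iff)
  have i2: "integrable gauss g'" by (rule integrable_gauss_bounded[OF g(2) B(2)])
  have i: "integrable gauss (\<lambda>z. g' z - z * g z)" using i1 i2 by auto
  have m: "(\<lambda>z. g' z - z * g z) \<in> borel_measurable borel"
    by (intro borel_measurable_continuous_onI continuous_intros cg g(2))
  have il: "integrable lborel (\<lambda>z. ?\<phi> z * (g' z - z * g z))"
    using i m by (subst (asm) integrable_density) auto
  have d: "(?\<phi> has_real_derivative (- z * ?\<phi> z)) (at z)" for z
  proof -
    have "((\<lambda>z. (1 / sqrt (2 * pi)) * exp (- z\<^sup>2 / 2)) has_real_derivative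
        (1 / sqrt (2 * pi)) * (exp (- z\<^sup>2 / 2) * (- z))) (at z)"
      by (intro DERIV_cmult) (auto intro!: derivative_eq_intros)
    then show ?thesis unfolding std_normal_density_def[abs_def] by (simp only: mult_ac)
  qed
  have lim0: "((\<lambda>z. ?\<phi> z * g z) \<longlongrightarrow> 0) F" if "(?\<phi> \<longlongrightarrow> 0) F" for F
  proof (rule Lim_null_comparison[where g="\<lambda>z. ?\<phi> z * B"])
    show "\<forall>\<^sub>F z in F. norm (?\<phi> z * g z) \<le> ?\<phi> z * B"
      using B(1) by (intro always_eventually) (auto simp: abs_mult intro!: mult_left_mono)
  qed (use that in \<open>auto intro!: tendsto_eq_intros\<close>)
  have t: "(?\<phi> \<longlongrightarrow> 0) at_top" "(?\<phi> \<longlongrightarrow> 0) at_bot"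
    unfolding std_normal_density_def[abs_def] by real_asymp+
  have "(LBINT z=-\<infinity>..\<infinity>. ?\<phi> z * (g' z - z * g z)) = 0 - 0"
  proof (rule interval_integral_FTC_integrable[where F="\<lambda>z. ?\<phi> z * g z"])
    show "((\<lambda>z. ?\<phi> z * g z) has_vector_derivative ?\<phi> z * (g' z - z * g z)) (at z)" for z
      unfolding has_real_derivative_iff_has_vector_derivative[symmetric]
      by (auto intro!: derivative_eq_intros d g(1) simp: algebra_simps)
    show "isCont (\<lambda>z. ?\<phi> z * (g' z - z * g z)) z" for z
      using cg g(2) by (auto intro!: continuous_intros simp: continuous_on_eq_continuous_at std_normal_density_def)
    show "set_integrable lborel (einterval (- \<infinity>) \<infinity>) (\<lambda>z. ?\<phi> z * (g' z - z * g z))"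
      using il by (simp add: set_integrable_def)
    show "(((\<lambda>z. ?\<phi> z * g z) \<circ> real_of_ereal) \<longlongrightarrow> 0) (at_right (- \<infinity>))"
      by (simp add: ereal_tendsto_simps lim0 t)
    show "(((\<lambda>z. ?\<phi> z * g z) \<circ> real_of_ereal) \<longlongrightarrow> 0) (at_left \<infinity>)"
      by (simp add: ereal_tendsto_simps lim0 t)
  qed auto
  then have "(LINT z|lborel. ?\<phi> z * (g' z - z * g z)) = 0"
    by (simp add: interval_lebesgue_integral_def set_lebesgue_integral_def)
  moreover have "(LINT z|gauss. g' z - z * g z) = (LINT z|lborel. ?\<phi> z * (g' z - z * g z))"
    using m by (subst integral_gauss) simp_all
  ultimately show ?thesis using i1 i2 by simp
qed

text \<open>The heat kernel integral after the substitution \<open>\<xi> = sqrt (2 * t) * z\<close>;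
  the argument is the pair of position and time. The weight no longer depends on time, and at time 0
  the value is \<open>u\<close> itself.\<close>

definition heat :: "(real \<Rightarrow> real) \<Rightarrow> real \<times> real \<Rightarrow> real" where
  "heat u p = (LINT z|gauss. u (fst p - sqrt (2 * snd p) * z))"

lemma heat_0 [simp]: "heat u (x, 0) = u x"
  by (simp add: heat_def gauss.prob_space)

lemma heat_periodic: "smooth_periodic u \<Longrightarrow> heat u (x + 2 * pi, t) = heat u (x, t)"
proof -
  assume "smooth_periodic u"
  then have "u (x + 2 * pi - sqrt (2 * t) * z) = u (x - sqrt (2 * t) * z)" for z
    by (metis (no_types, opaque_lifting) smooth_periodic_def add_diff_eq add.commute add_uminus_conv_diff)
  then show ?thesis by (simp add: heat_def)
qed

lemma integrable_gauss_shift: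
  assumes "smooth_periodic u" 
  shows "integrable gauss (\<lambda>z. u (x - s * z))"
proof -
  obtain B where "\<And>x. \<bar>u x\<bar> \<le> B" using smooth_periodic_bounded[OF assms] by metis
  then show ?thesis
    by (intro integrable_gauss_bounded[of _ B] continuous_on_compose2[OF smooth_periodic_continuous_on[OF assms, of UNIV]])
      (auto intro!: continuous_intros)
qed

lemma heat_DERIV_fst:
  assumes u: "smooth_periodic u"
  shows "((\<lambda>x. heat u (x, t)) has_real_derivative heat (deriv u) (x, t)) (at x)"
  using gauss_integral_DERIV[OF u, of "\<lambda>z. - (sqrt (2 * t) * z)" "\<lambda>z. 1" x]
  by (simp add: heat_def algebra_simps continuous_intros)

text \<open>The flow is Lipschitz in the position and in \<open>sqrt (2 * t)\<close>. The set
  \<open>S\<close> may contain negative times, since the real square root of HOL is continuous on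
  the whole line.\<close>

lemma heat_continuous:
  assumes u: "smooth_periodic u"
  shows "continuous_on S (heat u)"
proof -
  obtain B where B: "B \<ge> 0" "\<And>x. \<bar>deriv u x\<bar> \<le> B"
    using smooth_periodic_bounded[OF smooth_periodic_deriv(2)[OF u]] by metis
  let ?E = "LINT z|gauss. \<bar>z\<bar>"
  have iz: "integrable gauss (\<lambda>z. \<bar>z\<bar>)" using integrable_gauss_moment[of 1] by simp
  have *: "\<bar>heat u p - heat u q\<bar> \<le> B * \<bar>fst p - fst q\<bar> + B * \<bar>sqrt (2 * snd p) - sqrt (2 * snd q)\<bar> * ?E" for p q
  proof -
    let ?s = "sqrt (2 * snd p)" and ?s' = "sqrt (2 * snd q)"
    have "\<bar>heat u p - heat u q\<bar> = \<bar>LINT z|gauss. u (fst p - ?s * z) - u (fst q - ?s' * z)\<bar>"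
      by (simp add: heat_def integrable_gauss_shift[OF u])
    also have "\<dots> \<le> (LINT z|gauss. \<bar>u (fst p - ?s * z) - u (fst q - ?s' * z)\<bar>)"
      by (rule integral_abs_bound)
    also have "\<dots> \<le> (LINT z|gauss. B * \<bar>fst p - fst q\<bar> + B * \<bar>?s - ?s'\<bar> * \<bar>z\<bar>)"
    proof (rule integral_mono)
      fix z
      have "\<bar>u (fst p - ?s * z) - u (fst q - ?s' * z)\<bar> \<le> B * \<bar>(fst p - ?s * z) - (fst q - ?s' * z)\<bar>"
        by (rule Taylor_bound1[OF u B(2)])
      also have "\<bar>(fst p - ?s * z) - (fst q - ?s' * z)\<bar> = \<bar>(fst p - fst q) - (?s - ?s') * z\<bar>"
        by (simp add: algebra_simps)
      also have "\<dots> \<le> \<bar>fst p - fst q\<bar> + \<bar>?s - ?s'\<bar> * \<bar>z\<bar>"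
        by (metis abs_mult abs_triangle_ineq4)
      finally show "\<bar>u (fst p - ?s * z) - u (fst q - ?s' * z)\<bar> \<le> B * \<bar>fst p - fst q\<bar> + B * \<bar>?s - ?s'\<bar> * \<bar>z\<bar>"
        using B(1) by (simp only: distrib_left mult.assoc mult_left_mono)
    qed (use iz in \<open>auto simp: integrable_gauss_shift[OF u]\<close>)
    also have "\<dots> = B * \<bar>fst p - fst q\<bar> + B * \<bar>?s - ?s'\<bar> * ?E"
      using iz by (simp add: gauss.prob_space)
    finally show ?thesis .
  qed
  have "(heat u \<longlongrightarrow> heat u q) (at q within S)" for q
  proof (rule LIM_zero_cancel, rule Lim_null_comparison)
    show "\<forall>\<^sub>F p in at q within S. norm (heat u p - heat u q) \<le>
       B * \<bar>fst p - fst q\<bar> + B * \<bar>sqrt (2 * snd p) - sqrt (2 * snd q)\<bar> * ?E"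
      using * by (auto intro!: always_eventually)
    show "((\<lambda>p. B * \<bar>fst p - fst q\<bar> + B * \<bar>sqrt (2 * snd p) - sqrt (2 * snd q)\<bar> * ?E) \<longlongrightarrow> 0) (at q within S)"
      by (rule tendsto_eq_rhs, (rule tendsto_intros)+) auto
  qed
  then show ?thesis by (auto simp: continuous_on_def)
qed

text \<open>In terms of \<open>s = sqrt (2 * t)\<close> the derivative is the mean of
  \<open>- z * deriv u (x - s * z)\<close>. Gaussian integration by parts turns it into
  \<open>s\<close> times the mean of \<open>u''\<close>, and this \<open>s\<close> cancels against
  \<open>ds/dt = 1 / s\<close>.\<close>

lemma heat_DERIV_snd_pos:
  assumes u: "smooth_periodic u" and t: "t > 0"
  shows "((\<lambda>t. heat u (x, t)) has_real_derivative heat (deriv (deriv u)) (x, t)) (at t)"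
proof -
  note u' = smooth_periodic_deriv(2)[OF u]
  note u'' = smooth_periodic_deriv(2)[OF u']
  obtain B1 B2 where B: "\<And>x. \<bar>deriv u x\<bar> \<le> B1" "\<And>x. \<bar>deriv (deriv u) x\<bar> \<le> B2"
    using smooth_periodic_bounded[OF u'] smooth_periodic_bounded[OF u''] by metis
  let ?s = "sqrt (2 * t)"
  have s: "?s > 0" using t by simp
  have d: "((\<lambda>s. LINT z|gauss. u (x + s * (- z))) has_real_derivative
      (LINT z|gauss. (- z) * deriv u (x + s * (- z)))) (at s)" for s
    using integrable_gauss_moment[of 1] integrable_gauss_moment[of 2]
    by (intro gauss_integral_DERIV[OF u]) (auto intro!: continuous_intros simp: integrable_abs_iff)
  have "(LINT z|gauss. z * deriv u (x - ?s * z)) = (LINT z|gauss. deriv (deriv u) (x - ?s * z) * (- ?s))"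
  proof (rule gauss_integral_by_parts)
    show "((\<lambda>z. deriv u (x - ?s * z)) has_real_derivative deriv (deriv u) (x - ?s * z) * - ?s) (at z)" for z
      by (rule smooth_periodic_DERIV[OF u']) (auto intro!: derivative_eq_intros)
    show "continuous_on UNIV (\<lambda>z. deriv (deriv u) (x - ?s * z) * - ?s)"
      by (intro continuous_intros continuous_on_compose2[OF smooth_periodic_continuous_on[OF u'', of UNIV]]) auto
    show "\<bar>deriv (deriv u) (x - ?s * z) * - ?s\<bar> \<le> B2 * ?s" for z
      using s B(2) by (auto simp: abs_mult intro!: mult_right_mono)
  qed (rule B(1))
  then have eq: "(LINT z|gauss. (- z) * deriv u (x + ?s * (- z))) = ?s * heat (deriv (deriv u)) (x, t)"
    by (simp add: heat_def mult.commute)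
  have "((\<lambda>t. LINT z|gauss. u (x + sqrt (2 * t) * (- z))) has_real_derivative
      (?s * heat (deriv (deriv u)) (x, t)) * (1 / ?s)) (at t)"
    unfolding eq[symmetric]
    by (rule DERIV_chain2[OF d]) (use t in \<open>auto intro!: derivative_eq_intros simp: field_simps\<close>)
  then show ?thesis using s by (simp add: heat_def)
qed

text \<open>The square root is not differentiable at time 0, so the chain rule stops there. The flow
  is however the integral of its continuous time derivative from 0 on, and differentiating that
  integral also gives the one-sided derivative at 0.\<close>

lemma heat_has_vector_derivative_snd:
  assumes u: "smooth_periodic u" and t: "t \<ge> 0"
  shows "((\<lambda>t. heat u (x, t)) has_vector_derivative heat (deriv (deriv u)) (x, t)) (at t within {0..})"
proof -
  let ?g = "\<lambda>t. heat (deriv (deriv u)) (x, t)"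
  have cont: "continuous_on S (\<lambda>t. heat f (x, t))" if "smooth_periodic f" for f S
    by (rule continuous_on_compose2[OF heat_continuous[OF that, of UNIV]]) (auto intro!: continuous_intros)
  note u'' = smooth_periodic_deriv(2)[OF smooth_periodic_deriv(2)[OF u]]
  have *: "(?g has_integral heat u (x, b) - heat u (x, 0)) {0..b}" if "b \<ge> 0" for b
    by (rule fundamental_theorem_of_calculus_interior[OF that cont[OF u]])
      (use heat_DERIV_snd_pos[OF u] in \<open>auto simp: has_real_derivative_iff_has_vector_derivative[symmetric]\<close>)
  have "((\<lambda>b. u x + integral {0..b} ?g) has_vector_derivative 0 + ?g t) (at t within {0..t+1})"
    using t by (intro has_vector_derivative_add has_vector_derivative_const integral_has_vector_derivative[OF cont[OF u'']]) auto
  then have "((\<lambda>t. heat u (x, t)) has_vector_derivative ?g t) (at t within {0..t+1})"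
    unfolding add_0 by (rule has_vector_derivative_transform[rotated 2]) (use t *[THEN integral_unique] in auto)
  moreover have "at t within {0..t+1} = at t within {0..}"
    by (rule at_within_nhd[of t "{..<t+1}"]) auto
  ultimately show ?thesis by simp
qed

text \<open>Both partial derivatives are again heat flows, with initial values \<open>u'\<close> and
  \<open>u''\<close>; hence the induction over all \<open>u\<close>.\<close>

lemma Ck_on_heat: "smooth_periodic u \<Longrightarrow> Ck_on k (heat u) (UNIV \<times> {0..})"
proof (induction k arbitrary: u)
  case 0
  then show ?case using heat_continuous by simp
next
  case (Suc k)
  note u' = smooth_periodic_deriv(2)[OF Suc.prems]
  show ?case
    by (rule Ck_on_partialsI[OF _ _ Suc.IH[OF u'] Suc.IH[OF smooth_periodic_deriv(2)[OF u']]])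
      (use heat_DERIV_fst[OF Suc.prems] heat_has_vector_derivative_snd[OF Suc.prems]
        in \<open>auto simp: has_real_derivative_iff_has_vector_derivative[symmetric]\<close>)
qed

text \<open>Conservation of the mean: the time derivative is the integral of an x-derivative of a
  periodic function over a period.\<close>

lemma heat_integral:
  assumes u: "smooth_periodic u" and t: "t \<ge> 0"
  shows "integral {0..2*pi} (\<lambda>x. heat u (x, t)) = integral {0..2*pi} u"
proof -
  note u' = smooth_periodic_deriv(2)[OF u]
  have z: "integral {0..2*pi} (\<lambda>x. heat (deriv (deriv u)) (x, t)) = 0" for t
  proof -
    have "((\<lambda>x. heat (deriv (deriv u)) (x, t)) has_integral heat (deriv u) (2 * pi, t) - heat (deriv u) (0, t)) {0..2*pi}"
      by (rule fundamental_theorem_of_calculus)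
        (use heat_DERIV_fst[OF u'] in \<open>auto simp: has_real_derivative_iff_has_vector_derivative[symmetric] intro: DERIV_subset\<close>)
    then show ?thesis using heat_periodic[OF u', of 0 t] by (simp add: integral_unique)
  qed
  have "((\<lambda>t. integral (cbox 0 (2*pi)) (\<lambda>x. heat u (x, t))) has_vector_derivative
      integral (cbox 0 (2*pi)) (\<lambda>x. heat (deriv (deriv u)) (x, t))) (at t within {0..})" if "t \<in> {0..}" for t
  proof (rule leibniz_rule_vector_derivative)
    show "(\<lambda>x. heat u (x, t)) integrable_on cbox 0 (2 * pi)" for t
      by (intro integrable_continuous continuous_on_compose2[OF heat_continuous[OF u, of UNIV]])
        (auto intro!: continuous_intros)
    show "continuous_on ({0..} \<times> cbox 0 (2 * pi)) (\<lambda>(t, x). heat (deriv (deriv u)) (x, t))"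
      unfolding case_prod_unfold
      by (intro continuous_on_compose2[OF heat_continuous[OF smooth_periodic_deriv(2)[OF u'], of UNIV]])
        (auto intro!: continuous_intros)
  qed (use that heat_has_vector_derivative_snd[OF u] in auto)
  then have "((\<lambda>t. integral {0..2*pi} (\<lambda>x. heat u (x, t))) has_vector_derivative 0) (at t within {0..})" if "t \<in> {0..}" for t
    using that z by simp
  then have "integral {0..2*pi} (\<lambda>x. heat u (x, t)) = integral {0..2*pi} (\<lambda>x. heat u (x, 0))"
    using t by (intro has_derivative_zero_unique[of "{0..}"]) (auto simp: has_vector_derivative_def)
  then show ?thesis by simp
qed

lemma heat_kernel_integral_eq:
  assumes u: "smooth_periodic u" and t: "t > 0"
  shows "heat_kernel_integral u t x = heat u (x, t) *\<^sub>R cis x + heat (deriv u) (x, t) *\<^sub>R (\<i> * cis x)"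
proof -
  let ?c = "sqrt (2 * t)"
  note u' = smooth_periodic_deriv(2)[OF u]
  have c: "Complex (cos x) (sin x) = cis x" "Complex (- sin x) (cos x) = \<i> * cis x"
    by (auto simp: complex_eq_iff)
  let ?f = "\<lambda>z. u (x - ?c * z) *\<^sub>R cis x + deriv u (x - ?c * z) *\<^sub>R (\<i> * cis x)"
  \<comment> \<open>The Jacobian \<open>?c\<close> of the substitution turns the heat kernel exactly
    into the standard normal density.\<close>
  have k: "?c * (1 / (2 * sqrt (pi * t)) * exp (- (?c * z)\<^sup>2 / (4 * t))) = std_normal_density z" for z
    using t by (simp add: std_normal_density_def power_mult_distrib real_sqrt_mult field_simps)
  have m: "?f \<in> borel_measurable borel"
    by (intro borel_measurable_continuous_onI continuous_intros
        continuous_on_compose2[OF smooth_periodic_continuous_on[OF u, of UNIV]]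
        continuous_on_compose2[OF smooth_periodic_continuous_on[OF u', of UNIV]]) auto
  have "heat_kernel_integral u t x = \<bar>?c\<bar> *\<^sub>R (LINT z|lborel. (1 / (2 * sqrt (pi * t)) * exp (- (0 + ?c * z)\<^sup>2 / (4 * t))) *\<^sub>R
     (u (x - (0 + ?c * z)) *\<^sub>R cis x + deriv u (x - (0 + ?c * z)) *\<^sub>R (\<i> * cis x)))"
    unfolding heat_kernel_integral_def c
    by (rule lborel_integral_real_affine) (use t in auto)
  also have "\<dots> = (LINT z|lborel. \<bar>?c\<bar> *\<^sub>R ((1 / (2 * sqrt (pi * t)) * exp (- (0 + ?c * z)\<^sup>2 / (4 * t))) *\<^sub>R
     (u (x - (0 + ?c * z)) *\<^sub>R cis x + deriv u (x - (0 + ?c * z)) *\<^sub>R (\<i> * cis x))))"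
    by (rule integral_scaleR_right[symmetric])
  also have "\<dots> = (LINT z|lborel. std_normal_density z *\<^sub>R ?f z)"
    using t by (intro Bochner_Integration.integral_cong refl) (simp add: k[symmetric])
  also have "\<dots> = (LINT z|gauss. ?f z)" by (rule integral_gauss[OF m, symmetric])
  also have "\<dots> = heat u (x, t) *\<^sub>R cis x + heat (deriv u) (x, t) *\<^sub>R (\<i> * cis x)"
    using integrable_gauss_shift[OF u, of x ?c] integrable_gauss_shift[OF u', of x ?c]
    by (simp add: heat_def)
  finally show ?thesis .
qed

lemma heat_term_eq:
  assumes u: "smooth_periodic u" and t: "t \<ge> 0"
  shows "heat_term u t x = heat u (x, t) *\<^sub>R cis x + heat (deriv u) (x, t) *\<^sub>R (\<i> * cis x)"
proof (cases "t = 0")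
  case True
  note u' = smooth_periodic_deriv(2)[OF u]
  have *: "((\<lambda>s. heat f (x, s)) \<longlongrightarrow> heat f (x, 0)) (at_right 0)" if "smooth_periodic f" for f
  proof -
    have "continuous_on UNIV (\<lambda>s. heat f (x, s))"
      by (rule continuous_on_compose2[OF heat_continuous[OF that, of UNIV]]) (auto intro!: continuous_intros)
    then show ?thesis by (meson UNIV_I at_le continuous_on_def order_refl subset_UNIV tendsto_mono)
  qed
  have "((\<lambda>s. heat u (x, s) *\<^sub>R cis x + heat (deriv u) (x, s) *\<^sub>R (\<i> * cis x)) \<longlongrightarrow>
     heat u (x, 0) *\<^sub>R cis x + heat (deriv u) (x, 0) *\<^sub>R (\<i> * cis x)) (at_right 0)"
    by (intro tendsto_intros * u u')
  moreover have "\<forall>\<^sub>F s in at_right 0. heat u (x, s) *\<^sub>R cis x + heat (deriv u) (x, s) *\<^sub>R (\<i> * cis x) = heat_kernel_integral u s x"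
    using heat_kernel_integral_eq[OF u] by (auto simp: eventually_at_filter)
  ultimately have "((\<lambda>s. heat_kernel_integral u s x) \<longlongrightarrow>
     heat u (x, 0) *\<^sub>R cis x + heat (deriv u) (x, 0) *\<^sub>R (\<i> * cis x)) (at_right 0)"
    by (rule Lim_transform_eventually)
  then show ?thesis using True by (simp add: heat_term_def tendsto_Lim)
next
  case False
  then show ?thesis using heat_kernel_integral_eq[OF u, of t x] t by (simp add: heat_term_def)
qed

section \<open>Ordinary differential equations\<close>

lemma integral_upto_has_vector_derivative:
  fixes g :: "real \<Rightarrow> 'a::banach"
  assumes "continuous_on {0..<T} g" "t \<in> {0..<T}"
  shows "((\<lambda>t. integral {0..t} g) has_vector_derivative g t) (at t within {0..<T})"
proof -
  \<comment> \<open>The fundamental theorem is applied on a compact interval; any \<open>b\<close>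
    strictly between \<open>t\<close> and \<open>T\<close> gives the same neighbourhood filter at
    \<open>t\<close>.\<close>
  define b where "b = (t + T) / 2"
  have b: "t < b" "b < T" using assms(2) by (auto simp: b_def)
  have "((\<lambda>t. integral {0..t} g) has_vector_derivative g t) (at t within {0..b})"
    using assms b by (intro integral_has_vector_derivative) (auto intro: continuous_on_subset)
  moreover have "at t within {0..b} = at t within {0..<T}"
    by (rule at_within_nhd[of t "{..<b}"]) (use b in auto)
  ultimately show ?thesis by simp
qed

text \<open>Rescaling the integration variable moves the variable upper limit into the integrand, so
  that continuity of parameter integrals over the fixed interval from 0 to 1 applies.\<close>

lemma continuous_on_integral_upto:
  fixes h :: "real \<times> real \<Rightarrow> real"
  assumes h: "continuous_on (UNIV \<times> J) h" and J: "\<And>t. t \<in> J \<Longrightarrow> 0 \<le> t \<and> {0..t} \<subseteq> J"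
  shows "continuous_on (UNIV \<times> J) (\<lambda>p. integral {0..snd p} (\<lambda>s. h (fst p, s)))"
proof -
  have *: "snd p * s \<in> J" if "p \<in> UNIV \<times> J" "s \<in> {0..1}" for p :: "real \<times> real" and s
  proof -
    have "0 \<le> snd p" "{0..snd p} \<subseteq> J" using that J[of "snd p"] by (auto simp: mem_Times_iff)
    then show ?thesis using that mult_left_mono[of s 1 "snd p"] by auto
  qed
  have "integral {0..snd p} (\<lambda>s. h (fst p, s)) = integral {0..1} (\<lambda>s. snd p * h (fst p, snd p * s))"
    if p: "p \<in> UNIV \<times> J" for p
  proof -
    have p: "0 \<le> snd p" "{0..snd p} \<subseteq> J" using J[of "snd p"] p by (auto simp: mem_Times_iff)
    have "((\<lambda>s. snd p *\<^sub>R h (fst p, snd p * s)) has_integral (integral {snd p * 0..snd p * 1} (\<lambda>s. h (fst p, s)))) {0..1}"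
    proof (rule has_integral_substitution[where c=0 and d="snd p"])
      show "(\<lambda>s. snd p * s) ` {0..1} \<subseteq> {0..snd p}"
        using p(1) mult_left_mono[of _ 1 "snd p"] by auto
      show "continuous_on {0..snd p} (\<lambda>s. h (fst p, s))"
        by (rule continuous_on_compose2[OF h]) (use p in \<open>auto intro!: continuous_intros\<close>)
    qed (use p(1) in \<open>auto intro!: derivative_eq_intros\<close>)
    from integral_unique[OF this, symmetric] show ?thesis
      by (simp only: real_scaleR_def mult_zero_right mult_1_right)
  qed
  moreover have "continuous_on ((UNIV \<times> J) \<times> cbox 0 1) (\<lambda>(p, s). snd p * h (fst p, snd p * s))"
    unfolding case_prod_unfold
    by (intro continuous_intros continuous_on_compose2[OF h]) (use * in \<open>auto simp: mem_Times_iff\<close>)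
  then have "continuous_on (UNIV \<times> J) (\<lambda>p. integral {0..1} (\<lambda>s. snd p * h (fst p, snd p * s)))"
    unfolding interval_cbox by (rule integral_continuous_on_param)
  ultimately show ?thesis by (simp cong: continuous_on_cong)
qed

text \<open>The x-derivative is an integral of the same kind with the x-derivative of
  \<open>h\<close> as integrand, and the t-derivative is \<open>h\<close> itself, so the order can
  be raised by induction over all \<open>h\<close>.\<close>

lemma Ck_on_integral_upto:
  fixes h :: "real \<times> real \<Rightarrow> real"
  assumes "Ck_on k h (UNIV \<times> {0..<T})"
  shows "Ck_on k (\<lambda>p. integral {0..snd p} (\<lambda>s. h (fst p, s))) (UNIV \<times> {0..<T})"
  using assms
proof (induction k arbitrary: h)
  case 0
  then show ?case by (auto intro!: continuous_on_integral_upto)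
next
  case (Suc k)
  obtain g where g: "Ck_on k g (UNIV \<times> {0..<T})"
    "\<And>x t. t \<in> {0..<T} \<Longrightarrow> ((\<lambda>x. h (x, t)) has_vector_derivative g (x, t)) (at x)"
    using Ck_on_partial_fst[OF Suc.prems open_UNIV] by auto
  have ch: "continuous_on (UNIV \<times> {0..<T}) h" "continuous_on (UNIV \<times> {0..<T}) g"
    using Ck_on_imp_continuous_on[OF Suc.prems] Ck_on_imp_continuous_on[OF g(1)] .
  show ?case
  proof (rule Ck_on_partialsI[OF _ _ Suc.IH[OF g(1)] Ck_on_Suc_imp[OF Suc.prems]])
    fix x t :: real assume t: "t \<in> {0..<T}"
    have sl: "continuous_on {0..<T} (\<lambda>s. h (x, s))" for x
      by (rule continuous_on_compose2[OF ch(1)]) (auto intro!: continuous_intros)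
    show "((\<lambda>t. integral {0..snd (x, t)} (\<lambda>s. h (fst (x, t), s))) has_vector_derivative h (x, t)) (at t within {0..<T})"
      using integral_upto_has_vector_derivative[OF sl t] by simp
    have "((\<lambda>x. integral (cbox 0 t) (\<lambda>s. h (x, s))) has_vector_derivative integral (cbox 0 t) (\<lambda>s. g (x, s))) (at x within UNIV)"
    proof (rule leibniz_rule_vector_derivative)
      show "(\<lambda>s. h (x, s)) integrable_on cbox 0 t" for x
        using t by (intro integrable_continuous continuous_on_subset[OF sl]) auto
      show "continuous_on (UNIV \<times> cbox 0 t) (\<lambda>(x, s). g (x, s))"
        using t by (simp add: case_prod_unfold) (rule continuous_on_subset[OF ch(2)], auto)
    qed (use g(2) t in auto)
    then show "((\<lambda>x. integral {0..snd (x, t)} (\<lambda>s. h (fst (x, t), s))) has_vector_derivative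
       integral {0..snd (x, t)} (\<lambda>s. g (fst (x, t), s))) (at x within UNIV)"
      by simp
  qed simp
qed

text \<open>The difference of two solutions solves a linear equation whose coefficient
  \<open>q\<close> is the mean of \<open>fx\<close> over the segment between them. The exact formula
  serves twice: with equal initial values it is uniqueness, and divided by the difference of the
  initial values it gives the derivative of the flow.\<close>

lemma ode_difference:
  fixes f fx :: "real \<times> real \<Rightarrow> real"
  assumes U: "convex U"
    and fx: "\<And>x t. x \<in> U \<Longrightarrow> t \<in> {0..<T} \<Longrightarrow> ((\<lambda>x. f (x, t)) has_real_derivative fx (x, t)) (at x)"
    and cfx: "continuous_on (U \<times> {0..<T}) fx"
    and y1: "\<And>t. t \<in> {0..<T} \<Longrightarrow> y1 t \<in> U" "\<And>t. t \<in> {0..<T} \<Longrightarrow> (y1 has_real_derivative f (y1 t, t)) (at t within {0..<T})"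
    and y2: "\<And>t. t \<in> {0..<T} \<Longrightarrow> y2 t \<in> U" "\<And>t. t \<in> {0..<T} \<Longrightarrow> (y2 has_real_derivative f (y2 t, t)) (at t within {0..<T})"
    and t: "t \<in> {0..<T}"
  shows "y2 t - y1 t = (y2 0 - y1 0) * exp (integral {0..t} (\<lambda>s. integral {0..1} (\<lambda>r. fx (y1 s + r * (y2 s - y1 s), s))))"
proof -
  define q where "q s = integral {0..1} (\<lambda>r. fx (y1 s + r * (y2 s - y1 s), s))" for s
  have y12: "y1 s \<in> U" "y2 s \<in> U" if "s \<in> {0..<T}" for s using y1(1) y2(1) that by auto
  have seg: "y1 s + r * (y2 s - y1 s) \<in> U" if "s \<in> {0..<T}" "r \<in> {0..1}" for r s
    using convexD_alt[OF U y12[OF that(1)], of r] that(2)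
    by (simp add: algebra_simps)
  have cy: "continuous_on {0..<T} y1" "continuous_on {0..<T} y2"
    using DERIV_continuous_on[OF y1(2)] DERIV_continuous_on[OF y2(2)] by blast+
  have "continuous_on ({0..<T} \<times> cbox 0 1) (\<lambda>(s, r). fx (y1 s + r * (y2 s - y1 s), s))"
    unfolding case_prod_unfold
    by (rule continuous_on_compose2[OF cfx],
        intro continuous_intros continuous_on_compose2[OF cy(1)] continuous_on_compose2[OF cy(2)])
      (use seg in \<open>auto simp: mem_Times_iff\<close>)
  then have q: "continuous_on {0..<T} q"
    unfolding q_def[abs_def] interval_cbox by (rule integral_continuous_on_param)
  have fq: "f (y2 s, s) - f (y1 s, s) = (y2 s - y1 s) * q s" if s: "s \<in> {0..<T}" for s
  proof -
    have "((\<lambda>r. fx (y1 s + r * (y2 s - y1 s), s) * (y2 s - y1 s)) has_integral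
        f (y1 s + 1 * (y2 s - y1 s), s) - f (y1 s + 0 * (y2 s - y1 s), s)) {0..1}"
    proof (rule fundamental_theorem_of_calculus)
      fix r :: real assume r: "r \<in> {0..1}"
      have "((\<lambda>r. f (y1 s + r * (y2 s - y1 s), s)) has_real_derivative fx (y1 s + r * (y2 s - y1 s), s) * (y2 s - y1 s)) (at r within {0..1})"
        by (rule DERIV_chain2[where f="\<lambda>x. f (x, s)", OF fx])
          (use seg s r in \<open>auto intro!: derivative_eq_intros\<close>)
      then show "((\<lambda>r. f (y1 s + r * (y2 s - y1 s), s)) has_vector_derivative fx (y1 s + r * (y2 s - y1 s), s) * (y2 s - y1 s)) (at r within {0..1})"
        by (simp add: has_real_derivative_iff_has_vector_derivative)
    qed simp
    from integral_unique[OF this] show ?thesis by (simp add: q_def mult.commute)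
  qed
  define E where "E t = (y2 t - y1 t) * exp (- integral {0..t} q)" for t
  have "(E has_real_derivative 0) (at t within {0..<T})" if t: "t \<in> {0..<T}" for t
  proof -
    have "((\<lambda>t. integral {0..t} q) has_real_derivative q t) (at t within {0..<T})"
      using integral_upto_has_vector_derivative[OF q t] by (simp add: has_real_derivative_iff_has_vector_derivative)
    then show ?thesis unfolding E_def[abs_def]
      by (auto intro!: derivative_eq_intros y1(2)[OF t] y2(2)[OF t] simp: fq[OF t, unfolded diff_eq_eq] algebra_simps)
  qed
  then obtain c where "\<And>t. t \<in> {0..<T} \<Longrightarrow> E t = c"
    using has_field_derivative_zero_constant[of "{0..<T}" E] by auto
  from this[OF t] this[of 0] t have "E t = E 0" by simp
  then show ?thesis unfolding q_def[abs_def, symmetric] by (simp add: E_def exp_minus field_simps)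
qed

text \<open>The solution operator is smooth because its derivative with respect to the initial
  value is \<open>Y' \<phi> * exp (\<integral> \<partial>\<^sub>x f)\<close>, which gains one order of differentiability.\<close>

lemma smooth_flow:
  fixes f :: "real \<times> real \<Rightarrow> real" and Y :: "real \<Rightarrow> real"
  assumes U: "open U" "convex U" and f: "smooth_on f (U \<times> {0..<T})"
    and T1: "0 < T1" "T1 < T"
    and fx: "\<forall>x\<in>U. \<forall>t\<in>{0..T1}. \<exists>D. ((\<lambda>x. f (x, t)) has_real_derivative D) (at x) \<and> \<bar>D\<bar> \<le> K"
    and M: "\<forall>x\<in>U. \<forall>t\<in>{0..T1}. \<bar>f (x, t)\<bar> \<le> M"
    and Y: "smooth_on Y UNIV" and r: "r > 0" "\<forall>\<phi> x. \<bar>x - Y \<phi>\<bar> \<le> r \<longrightarrow> x \<in> U"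
  shows "\<exists>T' y. 0 < T' \<and> T' \<le> T1 \<and> smooth_on y (UNIV \<times> {0..<T'}) \<and> (\<forall>\<phi>. y (\<phi>, 0) = Y \<phi>) \<and>
    (\<forall>\<phi>. \<forall>t\<in>{0..<T'}. y (\<phi>, t) \<in> U \<and>
      ((\<lambda>t. y (\<phi>, t)) has_real_derivative f (y (\<phi>, t), t)) (at t within {0..<T'}) \<and>
      (\<exists>E>0. ((\<lambda>x. y (x, t)) has_real_derivative deriv Y \<phi> * E) (at \<phi>)))"
proof -
  note fx = fx[rule_format] and M = M[rule_format] and r = r[rule_format]
  have "Y 0 \<in> U" using r(2)[of "Y 0" 0] r(1) by simp
  then have "0 \<le> M" "0 \<le> K" using M[of "Y 0" 0] fx[of "Y 0" 0] T1 by auto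
  \<comment> \<open>Chosen so that \<open>K * T' \<le> 1 / 2\<close>, which makes the Picard map a
    contraction, and \<open>M * T' \<le> r\<close>, which keeps solutions in \<open>U\<close>. The
    summands 1 prevent division by zero.\<close>
  define T' where "T' = min T1 (min (1 / (2 * (K + 1))) (r / (M + 1)))"
  have T': "0 < T'" "T' \<le> T1" using T1 r(1) \<open>0 \<le> M\<close> \<open>0 \<le> K\<close> by (auto simp: T'_def)
  have "K * T' \<le> K * (1 / (2 * (K + 1)))" "M * T' \<le> M * (r / (M + 1))"
    using \<open>0 \<le> M\<close> \<open>0 \<le> K\<close> by (intro mult_left_mono; simp add: T'_def)+
  moreover have "K * (1 / (2 * (K + 1))) \<le> 1 / 2" "M * (r / (M + 1)) \<le> r"
    using \<open>0 \<le> M\<close> \<open>0 \<le> K\<close> r(1) by (auto simp: field_simps)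
  ultimately have KT: "K * T' \<le> 1 / 2" "M * T' \<le> r" by linarith+
  \<comment> \<open>Clamping the time to \<open>{0..T'}\<close> and the displacement to
    \<open>[-r, r]\<close> lets the Picard map act on all bounded continuous functions on the plane.
    Neither clamp is active at the fixed point, for times in \<open>{0..T'}\<close>.\<close>
  define cl where "cl t = max 0 (min T' t)" for t
  define cr where "cr x = max (- r) (min r x)" for x
  have cl: "cl t \<in> {0..T'}" "t \<in> {0..T'} \<Longrightarrow> cl t = t" for t using T' by (auto simp: cl_def)
  have cr: "\<bar>cr x\<bar> \<le> r" "\<bar>x\<bar> \<le> r \<Longrightarrow> cr x = x" "\<bar>cr x - cr x'\<bar> \<le> \<bar>x - x'\<bar>" for x x'
    using r(1) by (auto simp: cr_def)
  have cU: "Y \<phi> + cr x \<in> U" for \<phi> x using r(2)[of "Y \<phi> + cr x" \<phi>] cr(1) by simp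
  have cf: "continuous_on (U \<times> {0..<T}) f" and cY: "continuous_on UNIV Y"
    using f Y unfolding smooth_on_def by (metis Ck_on.simps(1))+
  have lip: "\<bar>f (a, t) - f (b, t)\<bar> \<le> K * \<bar>a - b\<bar>" if ab: "a \<in> U" "b \<in> U" "t \<in> {0..T1}" for a b t
  proof -
    obtain D where D: "\<And>x. x \<in> U \<Longrightarrow> ((\<lambda>x. f (x, t)) has_real_derivative D x) (at x) \<and> \<bar>D x\<bar> \<le> K"
      using fx[OF _ ab(3)] by metis
    show ?thesis
      using field_differentiable_bound[OF U(2), of "\<lambda>x. f (x, t)" D K a b] D ab
      by (auto intro: has_field_derivative_at_within)
  qed
  \<comment> \<open>The unknown \<open>w\<close> is the displacement from the initial value:
    \<open>Y\<close> may be unbounded, whereas the Banach space consists of bounded functions. All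
    initial values are treated at once, so continuity in \<phi> comes with the fixed point.\<close>
  define h where "h w p = f (Y (fst p) + cr (w p), snd p)" for w :: "real \<times> real \<Rightarrow> real" and p
  have ch: "continuous_on (UNIV \<times> {0..T'}) (h w)" if "continuous_on UNIV w" for w
    unfolding h_def cr_def
    by (intro continuous_on_compose2[OF cf] continuous_intros continuous_on_compose2[OF cY]
        continuous_on_subset[OF that])
      (use cU T' T1 in \<open>auto simp: cr_def\<close>)
  have hM: "\<bar>h w p\<bar> \<le> M" if "snd p \<in> {0..T'}" for w p
    unfolding h_def using M[OF cU, of "snd p"] that T'(2) by auto
  define F where "F w p = integral {0..cl (snd p)} (\<lambda>s. h w (fst p, s))" for w :: "real \<times> real \<Rightarrow> real" and p
  have slice: "continuous_on {0..cl t} (\<lambda>s. h w (\<phi>, s))" if "continuous_on UNIV w" for w \<phi> t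
    by (rule continuous_on_compose2[OF ch[OF that]]) (use cl in \<open>auto intro!: continuous_intros simp: cl_def\<close>)
  have cF: "continuous_on UNIV (F w)" if w: "continuous_on UNIV w" for w
  proof -
    have "continuous_on (UNIV \<times> {0..T'}) (\<lambda>p. integral {0..snd p} (\<lambda>s. h w (fst p, s)))"
      by (rule continuous_on_integral_upto[OF ch[OF w]]) auto
    then have "continuous_on UNIV (\<lambda>p. (\<lambda>p. integral {0..snd p} (\<lambda>s. h w (fst p, s))) (fst p, cl (snd p)))"
      by (rule continuous_on_compose2) (use cl(1) in \<open>auto intro!: continuous_intros simp: cl_def\<close>)
    then show ?thesis by (simp add: F_def[abs_def])
  qed
  have Fr: "\<bar>F w p\<bar> \<le> r" if w: "continuous_on UNIV w" for w p
  proof -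
    have "norm (F w p) \<le> M * (cl (snd p) - 0)"
      unfolding F_def by (rule integral_bound[OF _ slice[OF w]]) (use cl(1)[of "snd p"] hM in auto)
    also have "\<dots> \<le> M * T'" using cl(1)[of "snd p"] \<open>0 \<le> M\<close> by (intro mult_left_mono) auto
    finally show ?thesis using KT(2) by simp
  qed
  have FB: "F w \<in> bcontfun" if "continuous_on UNIV w" for w
    using cF[OF that] Fr[OF that] by (auto simp: bcontfun_def bounded_iff)
  define \<Phi> where "\<Phi> w = Bcontfun (F (apply_bcontfun w))" for w :: "(real \<times> real) \<Rightarrow>\<^sub>C real"
  have \<Phi>: "apply_bcontfun (\<Phi> w) = F (apply_bcontfun w)" for w
    unfolding \<Phi>_def by (rule Bcontfun_inverse[OF FB]) simp
  have "\<exists>!w. \<Phi> w = w"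
  proof (rule banach_fix_type[of "1/2"], safe)
    fix w v :: "(real \<times> real) \<Rightarrow>\<^sub>C real"
    show "dist (\<Phi> w) (\<Phi> v) \<le> 1 / 2 * dist w v"
    proof (rule dist_bound)
      fix p
      have "dist (\<Phi> w p) (\<Phi> v p) = \<bar>integral {0..cl (snd p)} (\<lambda>s. h w (fst p, s) - h v (fst p, s))\<bar>"
        unfolding \<Phi> F_def dist_real_def
        by (subst integral_diff) (auto intro!: integrable_continuous_real slice)
      also have "\<dots> = norm (integral {0..cl (snd p)} (\<lambda>s. h w (fst p, s) - h v (fst p, s)))" by simp
      also have "\<dots> \<le> K * dist w v * (cl (snd p) - 0)"
      proof (rule integral_bound)
        fix s assume s: "s \<in> {0..cl (snd p)}"
        then have s: "s \<in> {0..T1}" using cl(1)[of "snd p"] T' by auto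
        have "\<bar>h w (fst p, s) - h v (fst p, s)\<bar> \<le> K * \<bar>cr (w (fst p, s)) - cr (v (fst p, s))\<bar>"
          using lip[OF cU cU s, of "fst p" "w (fst p, s)" "fst p" "v (fst p, s)"] by (simp add: h_def)
        also have "\<dots> \<le> K * dist w v"
          using cr(3)[of "w (fst p, s)" "v (fst p, s)"] dist_bounded[of w "(fst p, s)" v] \<open>0 \<le> K\<close>
          by (intro mult_left_mono) (auto simp: dist_real_def)
        finally show "norm (h w (fst p, s) - h v (fst p, s)) \<le> K * dist w v" by simp
      qed (use cl(1)[of "snd p"] in \<open>auto intro!: continuous_intros slice\<close>)
      also have "\<dots> \<le> K * dist w v * T'"
        using cl(1)[of "snd p"] \<open>0 \<le> K\<close> by (intro mult_left_mono) auto
      also have "\<dots> = (K * T') * dist w v" by simp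
      also have "\<dots> \<le> 1 / 2 * dist w v" using KT(1) by (intro mult_right_mono) auto
      finally show "dist (\<Phi> w p) (\<Phi> v p) \<le> 1 / 2 * dist w v" .
    qed
  qed auto
  then obtain wb where wb: "\<Phi> wb = wb" by blast
  define w where "w = apply_bcontfun wb"
  have cw: "continuous_on UNIV w" and Fw: "F w = w" using \<Phi>[of wb] wb by (auto simp: w_def)
  have wr: "\<bar>w p\<bar> \<le> r" for p using Fr[OF cw, of p] Fw by simp
  define y where "y p = Y (fst p) + w p" for p
  let ?I = "{0..<T'}"
  have yU: "y p \<in> U" for p using cU[of "fst p" "w p"] cr(2)[OF wr] by (simp add: y_def)
  have cy: "continuous_on S y" for S
    unfolding y_def[abs_def] by (rule continuous_on_subset[of UNIV])
      (auto intro!: continuous_intros cw continuous_on_compose2[OF cY])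
  have hy: "h w = (\<lambda>p. f (y p, snd p))"
    using cr(2)[OF wr] by (auto simp: h_def y_def)
  have weq: "w (\<phi>, t) = integral {0..t} (\<lambda>s. f (y (\<phi>, s), s))" if "t \<in> {0..T'}" for \<phi> t
    using fun_cong[OF Fw, of "(\<phi>, t)"] cl(2)[OF that] by (simp add: F_def hy)
  have y0: "y (\<phi>, 0) = Y \<phi>" for \<phi> using weq[of 0 \<phi>] T' by (simp add: y_def)
  have yt: "((\<lambda>t. y (\<phi>, t)) has_real_derivative f (y (\<phi>, t), t)) (at t within ?I)" if t: "t \<in> ?I" for \<phi> t
  proof -
    have c: "continuous_on ?I (\<lambda>s. f (y (\<phi>, s), s))"
      by (rule continuous_on_compose2[OF cf])
        (use T' T1 yU in \<open>auto intro!: continuous_intros continuous_on_compose2[OF cy[of UNIV]]\<close>)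
    have "((\<lambda>t. Y \<phi> + integral {0..t} (\<lambda>s. f (y (\<phi>, s), s))) has_vector_derivative 0 + f (y (\<phi>, t), t)) (at t within ?I)"
      by (intro has_vector_derivative_add has_vector_derivative_const integral_upto_has_vector_derivative[OF c t])
    then show ?thesis
      unfolding has_real_derivative_iff_has_vector_derivative add_0
      by (rule has_vector_derivative_transform[rotated 2]) (use t weq in \<open>auto simp: y_def\<close>)
  qed
  obtain fx where fx: "smooth_on fx (U \<times> {0..<T})"
    "\<And>x t. x \<in> U \<Longrightarrow> t \<in> {0..<T} \<Longrightarrow> ((\<lambda>x. f (x, t)) has_real_derivative fx (x, t)) (at x)"
    using smooth_on_partial_fst[OF f U(1)] by (auto simp: has_real_derivative_iff_has_vector_derivative)
  have cfx: "continuous_on (U \<times> ?I) fx"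
    using fx(1)[unfolded smooth_on_def, rule_format, of 0] T' T1
    by (auto elim!: continuous_on_subset)
  define dY where "dY x = vector_derivative Y (at x)" for x
  have dY: "(Y has_real_derivative dY x) (at x)" "Ck_on k dY UNIV" for x k
    using smooth_on_vector_derivative[OF Y]
    by (auto simp: dY_def[abs_def] smooth_on_def has_real_derivative_iff_has_vector_derivative)
  define yx where "yx p = dY (fst p) * exp (integral {0..snd p} (\<lambda>s. fx (y (fst p, s), s)))" for p
  have y\<phi>: "((\<lambda>x. y (x, t)) has_real_derivative yx (\<phi>, t)) (at \<phi>)" if t: "t \<in> ?I" for \<phi> t
  proof -
    define Q where "Q p = integral {0..1} (\<lambda>r. fx (y (\<phi>, snd p) + r * (y (fst p, snd p) - y (\<phi>, snd p)), snd p))" for p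
    define E where "E x = exp (integral {0..t} (\<lambda>s. Q (x, s)))" for x
    \<comment> \<open>The factor \<open>Y x - Y \<phi>\<close> carries the whole difference
      quotient, so Caratheodory's criterion asks of the remaining factor \<open>E\<close> only
      continuity at \<phi>.\<close>
    have eq: "y (x, t) - y (\<phi>, t) = (Y x - Y \<phi>) * E x" for x
      using ode_difference[OF U(2) _ cfx yU yt yU yt t, of x \<phi>] fx(2) T' T1
      by (simp add: y0 E_def Q_def)
    have seg: "y (\<phi>, s) + r * (y (x, s) - y (\<phi>, s)) \<in> U" if "r \<in> {0..1}" for r s x
      using convexD_alt[OF U(2) yU yU, of r "(\<phi>, s)" "(x, s)"] that by (simp add: algebra_simps)
    have "continuous_on ((UNIV \<times> ?I) \<times> cbox 0 1)
        (\<lambda>(p, r). fx (y (\<phi>, snd p) + r * (y (fst p, snd p) - y (\<phi>, snd p)), snd p))"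
      unfolding case_prod_unfold
      by (rule continuous_on_compose2[OF cfx],
          intro continuous_intros continuous_on_compose2[OF cy[of UNIV]])
        (use seg in \<open>auto simp: mem_Times_iff\<close>)
    then have "continuous_on (UNIV \<times> ?I) Q"
      unfolding Q_def[abs_def] interval_cbox by (rule integral_continuous_on_param)
    then have "continuous_on (UNIV \<times> ?I) (\<lambda>p. integral {0..snd p} (\<lambda>s. Q (fst p, s)))"
      by (rule continuous_on_integral_upto) auto
    then have "continuous_on UNIV (\<lambda>x. (\<lambda>p. integral {0..snd p} (\<lambda>s. Q (fst p, s))) (x, t))"
      by (rule continuous_on_compose2) (use t in \<open>auto intro!: continuous_intros\<close>)
    then have "continuous_on UNIV E" unfolding E_def[abs_def] by (auto intro!: continuous_intros)
    then have E: "isCont E \<phi>" by (simp add: continuous_on_eq_continuous_at)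
    obtain g where g: "\<And>z. Y z - Y \<phi> = g z * (z - \<phi>)" "isCont g \<phi>" "g \<phi> = dY \<phi>"
      using dY(1)[of \<phi>] by (auto simp: CARAT_DERIV)
    have "Q (\<phi>, s) = fx (y (\<phi>, s), s)" for s by (simp add: Q_def)
    then have "g \<phi> * E \<phi> = yx (\<phi>, t)" by (simp add: g E_def yx_def)
    moreover have "isCont (\<lambda>z. g z * E z) \<phi>" using g(2) E by (rule isCont_mult)
    ultimately show ?thesis
      unfolding CARAT_DERIV using eq g(1) by (intro exI[of _ "\<lambda>z. g z * E z"]) (simp add: mult_ac)
  qed
  have "Ck_on k y (UNIV \<times> ?I)" for k
  proof (induction k)
    case 0
    then show ?case using cy by simp
  next
    case (Suc k)
    have *: "Ck_on k (\<lambda>p. g (y p, snd p)) (UNIV \<times> ?I)" if "smooth_on g (U \<times> {0..<T})" for g :: "real \<times> real \<Rightarrow> real"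
      by (rule Ck_on_compose[OF that[unfolded smooth_on_def, rule_format]])
        (use yU T' T1 in \<open>auto intro!: Ck_on_Pair Suc Ck_on_snd Ck_on_id\<close>)
    have "Ck_on k yx (UNIV \<times> ?I)"
      unfolding yx_def[abs_def]
      by (intro Ck_on_mult Ck_on_exp Ck_on_compose[OF dY(2)[of k]] Ck_on_fst Ck_on_id
          Ck_on_integral_upto[where h="\<lambda>p. fx (y p, snd p)", simplified] *[OF fx(1)]) auto
    then show ?case
      using y\<phi> yt by (intro Ck_on_partialsI[OF _ _ _ *[OF f]]) (auto simp: has_real_derivative_iff_has_vector_derivative)
  qed
  then have "smooth_on y (UNIV \<times> ?I)" by (simp add: smooth_on_def)
  moreover have "\<exists>E>0. ((\<lambda>x. y (x, t)) has_real_derivative deriv Y \<phi> * E) (at \<phi>)" if "t \<in> ?I" for \<phi> t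
    using y\<phi>[OF that, of \<phi>] DERIV_imp_deriv[OF dY(1)]
    by (intro exI[of _ "exp (integral {0..t} (\<lambda>s. fx (y (\<phi>, s), s)))"]) (simp add: yx_def)
  ultimately show ?thesis using T' y0 yU yt by (intro exI[of _ T'] exI[of _ y]) simp
qed

section \<open>Convex curves and their support functions\<close>

lemma inner_cis: "inner (cis x) (cis y) = cos (x - y)" "inner (\<i> * cis x) (cis y) = - sin (x - y)"
  "inner (cis x) (\<i> * cis y) = sin (x - y)"
  by (simp_all add: inner_complex_def cos_diff sin_diff)

lemma complex_cis_decomp: "z = inner z (cis x) *\<^sub>R cis x + inner z (\<i> * cis x) *\<^sub>R (\<i> * cis x)"
proof (rule complex_eqI)
  show "Re z = Re (inner z (cis x) *\<^sub>R cis x + inner z (\<i> * cis x) *\<^sub>R (\<i> * cis x))"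
    by (simp add: inner_complex_def) (use sin_cos_squared_add[of x] in algebra)
  show "Im z = Im (inner z (cis x) *\<^sub>R cis x + inner z (\<i> * cis x) *\<^sub>R (\<i> * cis x))"
    by (simp add: inner_complex_def) (use sin_cos_squared_add[of x] in algebra)
qed

lemma cis_eq_imp_cos: "cis x = cis y \<Longrightarrow> cos (x - y) = 1"
  using inner_cis(1)[of x y] by (simp add: inner_complex_def power2_eq_square[symmetric])

lemma cis_eq_iff: "cis x = cis y \<longleftrightarrow> (\<exists>n::int. x = y + 2 * pi * n)"
proof
  assume "cis x = cis y"
  then have "cos (x - y) = 1" by (rule cis_eq_imp_cos)
  then obtain n :: int where "x - y = n * 2 * pi" by (auto simp: cos_one_2pi_int)
  then show "\<exists>n::int. x = y + 2 * pi * n" by (intro exI[of _ n]) (simp add: algebra_simps)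
next
  assume "\<exists>n::int. x = y + 2 * pi * n"
  then show "cis x = cis y" by (auto simp: cis_mult[symmetric] cis_multiple_2pi)
qed

section \<open>Plane area by vertical slices\<close>

lemma lborel_complex_eq: "lborel = distr (lborel \<Otimes>\<^sub>M lborel) borel (\<lambda>p. Complex (fst p) (snd p))"
proof (rule lborel_eqI)
  have c: "continuous_on UNIV (\<lambda>p. Complex (fst p) (snd p))"
    unfolding Complex_eq by (intro continuous_intros)
  have m [measurable]: "(\<lambda>p. Complex (fst p) (snd p)) \<in> borel_measurable (lborel \<Otimes>\<^sub>M lborel)"
    using borel_measurable_continuous_onI[OF c] by (simp add: borel_prod[symmetric] cong: measurable_cong_sets)
  fix l u :: complex assume lu: "\<And>b. b \<in> Basis \<Longrightarrow> l \<bullet> b \<le> u \<bullet> b"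
  have lu: "Re l \<le> Re u" "Im l \<le> Im u"
    using lu[of 1] lu[of \<i>] by (auto simp: Basis_complex_def inner_complex_def)
  have "(\<lambda>p. Complex (fst p) (snd p)) -` box l u \<inter> space (lborel \<Otimes>\<^sub>M lborel) = {Re l<..<Re u} \<times> {Im l<..<Im u}"
    by (auto simp: box_def Basis_complex_def inner_complex_def space_pair_measure)
  then show "emeasure (distr (lborel \<Otimes>\<^sub>M lborel) borel (\<lambda>p. Complex (fst p) (snd p))) (box l u) = (\<Prod>b\<in>Basis. (u - l) \<bullet> b)"
    using lu by (simp add: emeasure_distr lborel.emeasure_pair_measure_Times Basis_complex_def inner_complex_def ennreal_mult)
qed simp

text \<open>Cavalieri's principle, from Tonelli's theorem for the product measure.\<close>

lemma emeasure_lborel_complex: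
  fixes D :: "complex set"
  assumes "D \<in> sets borel"
  shows "emeasure lborel D = (\<integral>\<^sup>+x. emeasure lborel {y. Complex x y \<in> D} \<partial>lborel)"
proof -
  let ?f = "\<lambda>p. Complex (fst p) (snd p)"
  have c: "continuous_on UNIV ?f"
    unfolding Complex_eq by (intro continuous_intros)
  have m: "?f \<in> borel_measurable (lborel \<Otimes>\<^sub>M lborel)"
    using borel_measurable_continuous_onI[OF c] by (simp add: borel_prod[symmetric] cong: measurable_cong_sets)
  have "emeasure lborel D = emeasure (lborel \<Otimes>\<^sub>M lborel) (?f -` D \<inter> space (lborel \<Otimes>\<^sub>M lborel))"
    by (subst lborel_complex_eq) (rule emeasure_distr[OF m assms])
  also have "\<dots> = (\<integral>\<^sup>+x. emeasure lborel (Pair x -` (?f -` D \<inter> space (lborel \<Otimes>\<^sub>M lborel))) \<partial>lborel)"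
    by (rule lborel.emeasure_pair_measure_alt[OF measurable_sets[OF m assms]])
  also have "\<dots> = (\<integral>\<^sup>+x. emeasure lborel {y. Complex x y \<in> D} \<partial>lborel)"
    by (simp add: space_pair_measure vimage_def)
  finally show ?thesis .
qed

definition support_point :: "(real \<Rightarrow> real) \<Rightarrow> real \<Rightarrow> complex" where
  "support_point u x = u x *\<^sub>R cis x + deriv u x *\<^sub>R (\<i> * cis x)"

definition radius :: "(real \<Rightarrow> real) \<Rightarrow> real \<Rightarrow> real" where
  "radius u x = u x + deriv (deriv u) x"

lemma continuous_on_Icc_attains_inf:
  fixes f :: "real \<Rightarrow> real"
  assumes "continuous_on {a..b} f" "a \<le> b"
  obtains x where "x \<in> {a..b}" "\<And>y. y \<in> {a..b} \<Longrightarrow> f x \<le> f y"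
  using continuous_attains_inf[OF compact_Icc _ assms(1)] assms(2) by auto

text \<open>The line integral of \<open>- y dx\<close> along the curve traversed counterclockwise,
  since \<open>Re P\<close> has derivative \<open>- \<rho> x * sin x\<close>. This unsymmetric form
  of the area is the one that vertical slices produce.\<close>

definition area_integral :: "(real \<Rightarrow> real) \<Rightarrow> real" where
  "area_integral u = integral {0..2 * pi} (\<lambda>x. Im (support_point u x) * radius u x * sin x)"

lemma antiderivative_continuous_UNIV:
  fixes f :: "real \<Rightarrow> real"
  assumes "continuous_on UNIV f"
  obtains F where "\<And>x. (F has_real_derivative f x) (at x)"
proof
  fix x :: real
  \<comment> \<open>A window with both 0 and \<open>x\<close> in its interior; the signed interval
    integral from 0 covers negative \<open>x\<close> as well.\<close>
  let ?S = "{- \<bar>x\<bar> - 1..\<bar>x\<bar> + 1}"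
  have "((\<lambda>y. LBINT z=ereal 0..ereal y. f z) has_vector_derivative f x) (at x within ?S)"
    by (rule interval_integral_FTC2) (auto intro: continuous_on_subset[OF assms])
  moreover have "at x within ?S = at x" by (rule at_within_interior) auto
  ultimately show "((\<lambda>y. LBINT z=ereal 0..ereal y. f z) has_real_derivative f x) (at x)"
    by (simp add: has_real_derivative_iff_has_vector_derivative)
qed

section \<open>The convex body with a given support function\<close>

locale convex_support =
  fixes u :: "real \<Rightarrow> real"
  assumes u: "smooth_periodic u" and radius_pos: "radius u x > 0"
begin

abbreviation "P \<equiv> support_point u"
abbreviation "\<rho> \<equiv> radius u"

lemmas u' = smooth_periodic_deriv(2)[OF u]
lemmas u'' = smooth_periodic_deriv(2)[OF u']
lemmas u_DERIV = smooth_periodic_deriv(1)[OF u, THEN has_field_derivative_at_within]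
lemmas u'_DERIV = smooth_periodic_deriv(1)[OF u', THEN has_field_derivative_at_within]

lemma P_deriv: "(P has_vector_derivative \<rho> x *\<^sub>R (\<i> * cis x)) (at x within S)"
proof -
  have "(P has_vector_derivative (u x *\<^sub>R (\<i> * cis x) + deriv u x *\<^sub>R cis x) +
      (deriv u x *\<^sub>R (\<i> * (\<i> * cis x)) + deriv (deriv u) x *\<^sub>R (\<i> * cis x))) (at x within S)"
    unfolding support_point_def[abs_def]
    by (intro has_vector_derivative_add has_vector_derivative_scaleR has_vector_derivative_mult_right
        has_vector_derivative_cis u_DERIV u'_DERIV)
  moreover have "(u x *\<^sub>R (\<i> * cis x) + deriv u x *\<^sub>R cis x) +
      (deriv u x *\<^sub>R (\<i> * (\<i> * cis x)) + deriv (deriv u) x *\<^sub>R (\<i> * cis x)) = \<rho> x *\<^sub>R (\<i> * cis x)"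
    by (simp add: radius_def complex_eq_iff algebra_simps)
  ultimately show ?thesis by simp
qed

lemma u_int: "u (x + 2 * pi * of_int n) = u x"
  and u'_int: "deriv u (x + 2 * pi * of_int n) = deriv u x"
  by (rule periodic_int; use u u' in \<open>simp add: smooth_periodic_def\<close>)+

lemma cis_int: "cis (x + 2 * pi * of_int n) = cis x"
  using cis_eq_iff by blast

lemma P_int: "P (x + 2 * pi * of_int n) = P x"
  by (simp add: support_point_def u_int u'_int cis_int)

lemma inner_P: "inner (P x) (cis x) = u x" "inner (P x) (\<i> * cis x) = deriv u x"
proof -
  have "inner (\<i> * cis x) (\<i> * cis x) = 1"
    by (simp add: inner_complex_def power2_eq_square[symmetric])
  then show "inner (P x) (cis x) = u x" "inner (P x) (\<i> * cis x) = deriv u x"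
    by (simp_all add: support_point_def inner_add_left inner_cis)
qed

lemma P_eqI: "inner z (cis x) = u x \<Longrightarrow> inner z (\<i> * cis x) = deriv u x \<Longrightarrow> z = P x"
  using complex_cis_decomp[of z x] by (simp add: support_point_def)

lemma inner_P_DERIV: "((\<lambda>y. inner (P y) (cis x)) has_real_derivative \<rho> y * sin (x - y)) (at y within S)"
proof -
  have "((\<lambda>y. inner (P y) (cis x)) has_vector_derivative inner (\<rho> y *\<^sub>R (\<i> * cis y)) (cis x)) (at y within S)"
    by (rule bounded_linear.has_vector_derivative[OF bounded_linear_inner_left P_deriv])
  moreover have "inner (\<rho> y *\<^sub>R (\<i> * cis y)) (cis x) = \<rho> y * sin (x - y)"
    unfolding inner_scaleR_left inner_cis(2) using sin_minus[of "x - y"] by simp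
  ultimately show ?thesis by (simp only: has_real_derivative_iff_has_vector_derivative)
qed

text \<open>As a function of \<open>y\<close>, the height of \<open>P y\<close> in direction
  \<open>cis x\<close> has derivative \<open>\<rho> y * sin (x - y)\<close>: it increases on the
  half turn before \<open>x\<close> and decreases on the half turn after it, so \<open>x\<close> is
  its only maximum in a period.\<close>

lemma support_less:
  assumes "cis y \<noteq> cis x"
  shows "inner (P y) (cis x) < u x"
proof -
  \<comment> \<open>The period is centred at \<open>x\<close>, so the mean value point always lies
    less than a half turn from \<open>x\<close>, where the sine has a strict sign.\<close>
  obtain z n where z: "z \<in> {x - pi..<x - pi + 2 * pi}" "y = z + 2 * pi * of_int n"
    by (rule periodic_representative)
  have eq: "P y = P z" "cis y = cis z" using z(2) by (simp_all add: P_int cis_int)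
  have d: "((\<lambda>y. inner (P y) (cis x)) has_real_derivative \<rho> y * sin (x - y)) (at y)" for y
    by (rule inner_P_DERIV)
  consider "z = x" | "z < x" | "x < z" by linarith
  then have "inner (P z) (cis x) < u x"
  proof cases
    case 1
    then show ?thesis using assms eq by simp
  next
    case 2
    obtain w where w: "z < w" "w < x" "inner (P x) (cis x) - inner (P z) (cis x) = (x - z) * (\<rho> w * sin (x - w))"
      using MVT2[OF 2 d] by blast
    have "sin (x - w) > 0" using z(1) w by (intro sin_gt_zero) auto
    then have "(x - z) * (\<rho> w * sin (x - w)) > 0" using 2 radius_pos[of w] by simp
    then show ?thesis using w(3) by (simp add: inner_P)
  next
    case 3
    obtain w where w: "x < w" "w < z" "inner (P z) (cis x) - inner (P x) (cis x) = (z - x) * (\<rho> w * sin (x - w))"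
      using MVT2[OF 3 d] by blast
    have "sin (w - x) > 0" using z(1) w by (intro sin_gt_zero) auto
    then have "(z - x) * (\<rho> w * sin (w - x)) > 0" using 3 radius_pos[of w] by simp
    moreover have "sin (x - w) = - sin (w - x)" using sin_minus[of "w - x"] by simp
    ultimately show ?thesis using w(3) by (simp add: inner_P)
  qed
  then show ?thesis using eq by simp
qed

lemma support_le: "inner (P y) (cis x) \<le> u x"
proof (cases "cis y = cis x")
  case True
  then obtain n :: int where "y = x + 2 * pi * n" by (auto simp: cis_eq_iff)
  then show ?thesis by (simp add: P_int inner_P)
qed (use support_less in force)

lemma P_eq_iff: "P x = P y \<longleftrightarrow> cis x = cis y"
proof
  assume "P x = P y"
  then show "cis x = cis y" using support_less[of x y] by (auto simp: inner_P)
next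
  assume "cis x = cis y"
  then show "P x = P y" by (auto simp: cis_eq_iff P_int)
qed

definition D :: "complex set" where "D = {z. \<forall>x. inner z (cis x) < u x}"

lemma u_continuous: "continuous_on S u"
  by (rule smooth_periodic_continuous_on[OF u])

text \<open>Infinitely many open half planes are intersected. Compactness of the circle of
  directions gives a smallest gap, and this is the radius of a ball inside \<open>D\<close>.\<close>

lemma open_D: "open D"
  unfolding open_dist
proof
  fix z assume z: "z \<in> D"
  have "continuous_on {0..2*pi} (\<lambda>x. u x - inner z (cis x))"
    by (intro continuous_intros u_continuous)
  then obtain x0 where x0: "x0 \<in> {0..2*pi}"
    "\<And>x. x \<in> {0..2*pi} \<Longrightarrow> u x0 - inner z (cis x0) \<le> u x - inner z (cis x)"
    by (rule continuous_on_Icc_attains_inf) auto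
    let ?m = "u x0 - inner z (cis x0)"
  have "?m > 0" using z by (simp add: D_def)
  moreover have "w \<in> D" if w: "dist w z < ?m" for w
    unfolding D_def
  proof safe
    fix x
    obtain y n where y: "y \<in> {0..<0 + 2 * pi}" "x = y + 2 * pi * of_int n"
      by (rule periodic_representative)
    have "inner w (cis x) = inner z (cis x) + inner (w - z) (cis x)" by (simp add: inner_diff_left)
    also have "inner (w - z) (cis x) \<le> norm (w - z) * norm (cis x)" by (rule norm_cauchy_schwarz)
    also have "\<dots> < ?m" using w by (simp add: dist_norm)
    also have "?m \<le> u y - inner z (cis y)" using x0 y by auto
    also have "\<dots> = u x - inner z (cis x)" by (simp add: y(2) u_int cis_int)
    finally show "inner w (cis x) < u x" by simp
  qed
  ultimately show "\<exists>e>0. \<forall>y. dist y z < e \<longrightarrow> y \<in> D" by blast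
qed

text \<open>The closed body \<open>K\<close> is bounded and convex, its interior is \<open>D\<close>
  and its frontier is the curve; the inside of the frontier of such a set is its interior.\<close>

lemma inside_range_P: "inside (range P) = D"
proof -
  define K where "K = {z. \<forall>x. inner z (cis x) \<le> u x}"
  have K: "K = (\<Inter>x. {z. inner (cis x) z \<le> u x})" by (auto simp: K_def inner_commute)
  have cv: "convex K" and cl: "closed K" unfolding K
    by (intro convex_INT closed_INT ballI convex_halfspace_le closed_halfspace_le)+
  obtain B where B: "\<And>x. \<bar>u x\<bar> \<le> B" using smooth_periodic_bounded[OF u] by metis
  \<comment> \<open>Testing \<open>z\<close> against its own direction bounds its norm by a value of
    \<open>u\<close>.\<close>
  have "norm z \<le> B" if "z \<in> K" for z
  proof -
    have z: "z = norm z *\<^sub>R cis (Arg z)"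
      by (metis Arg_zero cis_Arg_unique cmod_eq_Re norm_zero rcis_cmod_Arg rcis_def scaleR_conv_of_real)
    have "inner z (cis (Arg z)) = norm z"
      by (subst z) (simp add: inner_cis)
    then show ?thesis using that B[of "Arg z"] by (auto simp: K_def dest!: spec[of _ "Arg z"])
  qed
  then have bd: "bounded K" by (auto simp: bounded_iff)
  have int: "interior K = D"
  proof
    show "D \<subseteq> interior K"
      by (rule interior_maximal[OF _ open_D]) (auto simp: D_def K_def less_imp_le)
    show "interior K \<subseteq> D"
    proof
      fix z assume "z \<in> interior K"
      then obtain e where e: "e > 0" "cball z e \<subseteq> K" by (auto simp: mem_interior_cball)
      have "inner z (cis x) < u x" for x
      proof -
        have "z + e *\<^sub>R cis x \<in> K" using e by (auto simp: dist_norm intro!: subsetD[OF e(2)])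
        then have "inner (z + e *\<^sub>R cis x) (cis x) \<le> u x" by (auto simp: K_def)
        then show ?thesis using e(1) by (simp add: inner_add_left inner_cis)
      qed
      then show "z \<in> D" by (simp add: D_def)
    qed
  qed
  have "frontier K = K - D" using cl int by (simp add: frontier_def)
  also have "K - D = range P"
  proof safe
    fix z assume z: "z \<in> K" "z \<notin> D"
    \<comment> \<open>A frontier point touches one of its support lines. The gap
      \<open>u y - inner z (cis y)\<close> is nonnegative and vanishes at \<open>y = x\<close>, so
      its derivative vanishes there too, and these two equations determine \<open>z\<close> as
      \<open>P x\<close>.\<close>
    then obtain x where x: "inner z (cis x) = u x" by (auto simp: K_def D_def) (meson antisym_conv1 leD le_less)
    have "((\<lambda>y. u y - inner z (cis y)) has_real_derivative deriv u x - inner z (\<i> * cis x)) (at x)"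
    proof -
      have "((\<lambda>y. inner z (cis y)) has_vector_derivative inner z (\<i> * cis x)) (at x)"
        by (rule bounded_linear.has_vector_derivative[OF bounded_linear_inner_right has_vector_derivative_cis])
      then show ?thesis
        by (intro DERIV_diff u_DERIV) (simp add: has_real_derivative_iff_has_vector_derivative)
    qed
    moreover have "\<forall>y. \<bar>x - y\<bar> < 1 \<longrightarrow> u x - inner z (cis x) \<le> u y - inner z (cis y)"
      using z(1) x by (auto simp: K_def)
    ultimately have "deriv u x - inner z (\<i> * cis x) = 0"
      by (intro DERIV_local_min[of "\<lambda>y. u y - inner z (cis y)" _ x 1]) auto
    then show "z \<in> range P" using P_eqI[OF x] by auto
  next
    fix x
    show "P x \<in> K" using support_le by (simp add: K_def)
    assume "P x \<in> D"
    then show False using inner_P(1)[of x] by (auto simp: D_def dest!: spec[of _ x])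
  qed
  finally show ?thesis using inside_frontier_eq_interior[OF bd cv] int by simp
qed

text \<open>No direction supports both end points, so in each direction at least one of the two
  support inequalities is strict.\<close>

lemma D_convex_comb:
  assumes "cis a \<noteq> cis b" "0 < r" "r < 1"
  shows "(1 - r) *\<^sub>R P a + r *\<^sub>R P b \<in> D"
  unfolding D_def
proof safe
  fix x
  have "cis a \<noteq> cis x \<or> cis b \<noteq> cis x" using assms(1) by auto
  then have "(1 - r) * inner (P a) (cis x) + r * inner (P b) (cis x) < (1 - r) * u x + r * u x"
    using assms support_less[of a x] support_less[of b x] support_le[of a x] support_le[of b x]
    by (auto intro: add_less_le_mono add_le_less_mono)
  then show "inner ((1 - r) *\<^sub>R P a + r *\<^sub>R P b) (cis x) < u x"
    by (simp add: inner_add_left algebra_simps)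
qed

text \<open>Against directions less than a quarter turn from \<open>x\<close>, moving along
  \<open>- cis x\<close> lowers the height. The opposite closed half circle \<open>?J\<close> is
  compact and keeps a positive gap \<open>?m\<close>, which bounds the admissible step.\<close>

lemma inward_segment:
  obtains e where "e > 0" "\<And>s. 0 < s \<Longrightarrow> s < e \<Longrightarrow> P x - s *\<^sub>R cis x \<in> D"
proof -
  let ?J = "{x + pi / 2..x + 3 * pi / 2}"
  have "continuous_on ?J (\<lambda>y. u y - inner (P x) (cis y))"
    by (intro continuous_intros u_continuous)
  then obtain y0 where y0: "y0 \<in> ?J"
    "\<And>y. y \<in> ?J \<Longrightarrow> u y0 - inner (P x) (cis y0) \<le> u y - inner (P x) (cis y)"
    by (rule continuous_on_Icc_attains_inf) auto
  let ?m = "u y0 - inner (P x) (cis y0)"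
  have "cis x \<noteq> cis y0"
  proof
    assume "cis x = cis y0"
    then have "cos (x - y0) = 1" by (rule cis_eq_imp_cos)
    moreover have "cos (y0 - x - pi) \<ge> 0" using y0(1) by (intro cos_ge_zero) auto
    moreover have "cos (y0 - x - pi) = - cos (x - y0)"
      by (metis cos_minus cos_minus_pi minus_diff_eq)
    ultimately show False by simp
  qed
  then have m: "?m > 0" using support_less[of x y0] by simp
  show thesis
  proof (rule that[OF m])
    fix s assume s: "0 < s" "s < ?m"
    show "P x - s *\<^sub>R cis x \<in> D"
      unfolding D_def
    proof safe
      fix w
      obtain y n where y: "y \<in> {x - pi / 2..<x - pi / 2 + 2 * pi}" "w = y + 2 * pi * of_int n"
        by (rule periodic_representative)
      have *: "inner (P x - s *\<^sub>R cis x) (cis y) = inner (P x) (cis y) - s * cos (x - y)"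
        by (simp add: inner_diff_left inner_cis)
      have "inner (P x - s *\<^sub>R cis x) (cis y) < u y"
      proof (cases "y \<in> ?J")
        case True
        have "- s * cos (x - y) \<le> s * 1" using s(1) cos_ge_minus_one[of "x - y"] mult_left_mono[of "- cos (x - y)" 1 s] by simp
        also have "\<dots> < u y - inner (P x) (cis y)" using s(2) y0(2) True by force
        finally show ?thesis unfolding * by simp
      next
        case False
        then have "y - x < pi / 2" using y(1) by auto
        show ?thesis
        proof (cases "y = x - pi / 2")
          case True
          \<comment> \<open>The window for \<open>y\<close> starts at \<open>x - pi / 2\<close>, a
            full turn before the right end of \<open>?J\<close> and so outside \<open>?J\<close>.
            There the step is orthogonal to \<open>cis y\<close>, and strictness comes from
            \<open>support_less\<close>.\<close>
          then have "cos (x - y) = 0" by simp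
          moreover have "cis x \<noteq> cis y"
            using cis_eq_imp_cos[of x y] \<open>cos (x - y) = 0\<close> by auto
          ultimately show ?thesis unfolding * using support_less[of x y] by simp
        next
          case False
          then have "cos (y - x) > 0" using y(1) \<open>y - x < pi / 2\<close> by (intro cos_gt_zero_pi) auto
          then have "cos (x - y) > 0" by (metis cos_minus minus_diff_eq)
          then have "s * cos (x - y) > 0" using s by simp
          then show ?thesis unfolding * using support_le[of x y] by simp
        qed
      qed
      then show "inner (P x - s *\<^sub>R cis x) (cis w) < u w" by (simp add: y(2) u_int cis_int)
    qed
  qed
qed


lemma P_continuous: "continuous_on S P"
  by (meson P_deriv has_vector_derivative_continuous continuous_on_eq_continuous_within)

lemma radius_continuous: "continuous_on S \<rho>"
  unfolding radius_def[abs_def]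
  by (intro continuous_intros u_continuous smooth_periodic_continuous_on[OF u''])

lemma Re_P_DERIV: "((\<lambda>x. Re (P x)) has_real_derivative - (\<rho> x * sin x)) (at x within S)"
  using bounded_linear.has_vector_derivative[OF bounded_linear_Re P_deriv]
  by (simp add: has_real_derivative_iff_has_vector_derivative)

lemma D_imp_above_below:
  assumes "Complex x y \<in> D" "Re (P a) = x"
  shows "sin a > 0 \<Longrightarrow> y < Im (P a)" "sin a < 0 \<Longrightarrow> y > Im (P a)"
proof -
  have "inner (Complex x y) (cis a) < inner (P a) (cis a)"
    using assms(1) by (simp add: D_def inner_P)
  then have "y * sin a < Im (P a) * sin a" using assms(2) by (simp add: inner_complex_def)
  then show "sin a > 0 \<Longrightarrow> y < Im (P a)" "sin a < 0 \<Longrightarrow> y > Im (P a)" by auto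
qed

text \<open>The upper arc has normal angles in \<open>{0..pi}\<close>, the lower one in
  \<open>{pi..2*pi}\<close>. The support lines at \<open>a\<close> and \<open>b\<close> bound the
  slice, and the open chord between the two points fills it. At the vertical tangents the slice is
  empty and the two points coincide, which is what the equivalences on \<open>a\<close> and
  \<open>b\<close> express.\<close>

lemma D_slice:
  assumes a: "a \<in> {0..pi}" and b: "b \<in> {pi..2*pi}" and eq: "Re (P a) = Re (P b)"
    and ab: "a = 0 \<longleftrightarrow> b = 2 * pi" "a = pi \<longleftrightarrow> b = pi"
  shows "Im (P b) \<le> Im (P a) \<and> {y. Complex (Re (P a)) y \<in> D} = {Im (P b)<..<Im (P a)}"
proof -
  have P0: "P (2 * pi) = P 0" using P_int[of 0 1] by simp
  consider "a = 0" | "a = pi" | "0 < a" "a < pi" using a by fastforce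
  then show ?thesis
  proof cases
    case 1
    then have "Complex (Re (P a)) y \<notin> D" for y
      using inner_P(1)[of 0] by (auto simp: D_def inner_complex_def intro!: exI[of _ 0])
    then show ?thesis using 1 ab P0 by auto
  next
    case 2
    then have "Complex (Re (P a)) y \<notin> D" for y
      using inner_P(1)[of pi] by (auto simp: D_def inner_complex_def intro!: exI[of _ pi])
    then show ?thesis using 2 ab by auto
  next
    case 3
    then have b': "pi < b" "b < 2 * pi" using ab b by force+
    have sa: "sin a > 0" using 3 by (rule sin_gt_zero)
    have sb: "sin b < 0" using b' by (rule sin_lt_zero)
    then have ne: "cis b \<noteq> cis a" using sa by (auto simp: complex_eq_iff)
    have 1: "Complex (Re (P a)) y \<in> D \<Longrightarrow> Im (P b) < y \<and> y < Im (P a)" for y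
      using D_imp_above_below(1)[OF _ refl sa] D_imp_above_below(2)[OF _ eq[symmetric] sb] by blast
    have "(1 - 1/2) *\<^sub>R P b + (1/2) *\<^sub>R P a = Complex (Re (P a)) ((Im (P b) + Im (P a)) / 2)"
      using eq by (simp add: complex_eq_iff)
    then have lt: "Im (P b) < Im (P a)"
      using 1[of "(Im (P b) + Im (P a)) / 2"] D_convex_comb[OF ne, of "1/2"] by simp
    have "Complex (Re (P a)) y \<in> D" if y: "Im (P b) < y" "y < Im (P a)" for y
    proof -
      let ?r = "(y - Im (P b)) / (Im (P a) - Im (P b))"
      have "?r * (Im (P a) - Im (P b)) = y - Im (P b)" using lt by simp
      then have "(1 - ?r) *\<^sub>R P b + ?r *\<^sub>R P a = Complex (Re (P a)) y"
        using eq by (simp add: complex_eq_iff algebra_simps del: nonzero_mult_div_cancel_right times_divide_eq_left times_divide_eq_right)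
      moreover have "0 < ?r" "?r < 1" using y lt by (auto simp: field_simps)
      ultimately show ?thesis using D_convex_comb[OF ne, of ?r] by simp
    qed
    then show ?thesis using 1 lt by auto
  qed
qed

text \<open>The abscissa is strictly monotone on each half turn, so both arcs are graphs over
  \<open>{l..r}\<close>. Integrating the slice lengths and substituting the angle for the abscissa
  turns the measure into an integral over the normal angle.\<close>

lemma emeasure_D: "emeasure lborel D = ennreal (area_integral u) \<and> area_integral u \<ge> 0"
proof -
  define X where "X x = Re (P x)" for x
  define Y where "Y x = Im (P x)" for x
  have dX: "(X has_real_derivative - (\<rho> x * sin x)) (at x within S)" for x S
    unfolding X_def[abs_def] by (rule Re_P_DERIV)
  have cX: "continuous_on S X" and cY: "continuous_on S Y" for S
    unfolding X_def[abs_def] Y_def[abs_def] by (intro continuous_intros P_continuous)+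
  have X2pi: "X (2 * pi) = X 0" using P_int[of 0 1] by (simp add: X_def)
  have dec: "X y < X x" if xy: "x < y" "x \<in> {0..pi}" "y \<in> {0..pi}" for x y
  proof -
    obtain z where z: "x < z" "z < y" "X y - X x = (y - x) * (- (\<rho> z * sin z))"
      using MVT2[OF xy(1) dX] by blast
    then have "sin z > 0" using xy by (intro sin_gt_zero) auto
    then have "(y - x) * (\<rho> z * sin z) > 0" using radius_pos[of z] xy(1) by simp
    then show ?thesis using z(3) by simp
  qed
  have inc: "X x < X y" if xy: "x < y" "x \<in> {pi..2*pi}" "y \<in> {pi..2*pi}" for x y
  proof -
    obtain z where z: "x < z" "z < y" "X y - X x = (y - x) * (- (\<rho> z * sin z))"
      using MVT2[OF xy(1) dX] by blast
    then have "sin z < 0" using xy by (intro sin_lt_zero) auto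
    then have "(y - x) * (\<rho> z * sin z) < 0"
      using radius_pos[of z] xy(1) by (simp add: mult_pos_neg)
    then show ?thesis using z(3) by simp
  qed
  have injs: "inj_on X {0..pi}" "inj_on X {pi..2*pi}"
  proof -
    show "inj_on X {0..pi}" by (rule linorder_inj_onI') (metis dec less_irrefl)
    show "inj_on X {pi..2*pi}" by (rule linorder_inj_onI') (metis inc less_irrefl)
  qed
  define l r where "l = X pi" and "r = X 0"
  have X1: "X ` {0..pi} = {l..r}"
  proof
    show "X ` {0..pi} \<subseteq> {l..r}"
    proof safe
      fix x assume "x \<in> {0..pi}"
      then show "X x \<in> {l..r}"
        using dec[of 0 x] dec[of x pi] by (cases "x = 0 \<or> x = pi") (auto simp: l_def r_def intro: less_imp_le dec)
    qed
    show "{l..r} \<subseteq> X ` {0..pi}"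
      using IVT2'[of X pi _ 0, OF _ _ _ cX] by (force simp: l_def r_def)
  qed
  have X2: "X ` {pi..2*pi} = {l..r}"
  proof
    show "X ` {pi..2*pi} \<subseteq> {l..r}"
    proof safe
      fix x assume "x \<in> {pi..2*pi}"
      then show "X x \<in> {l..r}"
        using inc[of pi x] inc[of x "2*pi"] X2pi
        by (cases "x = pi \<or> x = 2 * pi") (auto simp: l_def r_def intro: less_imp_le dec)
    qed
    show "{l..r} \<subseteq> X ` {pi..2*pi}"
      using IVT'[of X pi _ "2*pi", OF _ _ _ cX] X2pi by (force simp: l_def r_def)
  qed
  \<comment> \<open>Inverses of the abscissa on the two half turns; \<open>Y (a x)\<close> and
    \<open>Y (b x)\<close> are the ends of the slice over \<open>x\<close>.\<close>
  define a where "a = the_inv_into {0..pi} X"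
  define b where "b = the_inv_into {pi..2*pi} X"
  have a: "a x \<in> {0..pi}" "X (a x) = x" and b: "b x \<in> {pi..2*pi}" "X (b x) = x" if "x \<in> {l..r}" for x
    using that the_inv_into_into[OF injs(1) _ subset_refl, of x] f_the_inv_into_f[OF injs(1), of x]
      the_inv_into_into[OF injs(2) _ subset_refl, of x] f_the_inv_into_f[OF injs(2), of x] X1 X2
    by (simp_all add: a_def b_def)
  have aX: "a (X x) = x" if "x \<in> {0..pi}" for x unfolding a_def by (rule the_inv_into_f_f[OF injs(1) that])
  have bX: "b (X x) = x" if "x \<in> {pi..2*pi}" for x unfolding b_def by (rule the_inv_into_f_f[OF injs(2) that])
  have ca: "continuous_on {l..r} a" and cb: "continuous_on {l..r} b"
    using continuous_on_inv_into[OF cX compact_Icc injs(1)] continuous_on_inv_into[OF cX compact_Icc injs(2)]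
    by (simp_all add: X1 X2 a_def b_def)
  have cYa: "continuous_on {l..r} (\<lambda>x. Y (a x))" and cYb: "continuous_on {l..r} (\<lambda>x. Y (b x))"
    by (rule continuous_on_compose2[OF cY[of UNIV]], use ca cb in auto)+
  have slice: "Y (b x) \<le> Y (a x) \<and> {y. Complex x y \<in> D} = {Y (b x)<..<Y (a x)}" if x: "x \<in> {l..r}" for x
  proof -
    have e0: "a x = 0 \<longleftrightarrow> b x = 2 * pi"
      using a[OF x] b[OF x] aX[of 0] bX[of "2 * pi"] X2pi by auto
    have e1: "a x = pi \<longleftrightarrow> b x = pi"
      using a[OF x] b[OF x] aX[of pi] bX[of pi] by auto
    show ?thesis
      using D_slice[OF a(1)[OF x] b(1)[OF x] _ e0 e1] a(2)[OF x] b(2)[OF x] by (simp add: X_def Y_def)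
  qed
  have out: "Complex x y \<notin> D" if "x \<notin> {l..r}" for x y
  proof
    assume "Complex x y \<in> D"
    then have "inner (Complex x y) (cis w) < u w" for w by (simp add: D_def)
    from this[of 0] this[of pi] show False using that inner_P(1)[of 0] inner_P(1)[of pi]
      by (auto simp: inner_complex_def l_def r_def X_def)
  qed
  have "emeasure lborel {y. Complex x y \<in> D} = ennreal (Y (a x) - Y (b x)) * indicator {l..r} x" for x
    using slice[of x] out[of x] by (cases "x \<in> {l..r}") auto
  then have "emeasure lborel D = (\<integral>\<^sup>+x. ennreal (Y (a x) - Y (b x)) * indicator {l..r} x \<partial>lborel)"
    by (simp add: emeasure_lborel_complex[OF borel_open[OF open_D]])
  also have "\<dots> = ennreal (integral {l..r} (\<lambda>x. Y (a x) - Y (b x)))"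
    by (rule nn_integral_has_integral_lebesgue'[OF _ integrable_integral])
      (use slice in \<open>auto intro!: integrable_continuous_real continuous_intros cYa cYb\<close>)
  also have eq: "integral {l..r} (\<lambda>x. Y (a x) - Y (b x)) = area_integral u"
  proof -
    have lr: "l < r" using dec[of 0 pi] by (simp add: l_def r_def)
    \<comment> \<open>On the upper arc \<open>X\<close> runs from \<open>r\<close> down to
      \<open>l\<close>, so the substitution gives the integral of the upper graph with a minus sign;
      the lower arc gives a plus sign.\<close>
    have "((\<lambda>x. - (\<rho> x * sin x) *\<^sub>R Y (a (X x))) has_integral
        (integral {X 0..X pi} (\<lambda>x. Y (a x)) - integral {X pi..X 0} (\<lambda>x. Y (a x)))) {0..pi}"
      by (rule has_integral_substitution_general[of "{}" _ _ X l r])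
        (use X1 dX cX cYa in auto)
    then have "((\<lambda>x. - (\<rho> x * sin x) *\<^sub>R Y (a (X x))) has_integral - integral {l..r} (\<lambda>x. Y (a x))) {0..pi}"
      using lr by (simp add: l_def r_def)
    then have 1: "((\<lambda>x. - (Y x * \<rho> x * sin x)) has_integral - integral {l..r} (\<lambda>x. Y (a x))) {0..pi}"
      by (rule has_integral_eq[rotated]) (simp add: aX)
    have "((\<lambda>x. - (\<rho> x * sin x) *\<^sub>R Y (b (X x))) has_integral
        (integral {X pi..X (2*pi)} (\<lambda>x. Y (b x)) - integral {X (2*pi)..X pi} (\<lambda>x. Y (b x)))) {pi..2*pi}"
      by (rule has_integral_substitution_general[of "{}" _ _ X l r])
        (use X2 dX cX cYb in auto)
    then have "((\<lambda>x. - (\<rho> x * sin x) *\<^sub>R Y (b (X x))) has_integral integral {l..r} (\<lambda>x. Y (b x))) {pi..2*pi}"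
      using lr X2pi by (simp add: l_def r_def)
    then have 2: "((\<lambda>x. - (Y x * \<rho> x * sin x)) has_integral integral {l..r} (\<lambda>x. Y (b x))) {pi..2*pi}"
      by (rule has_integral_eq[rotated]) (simp add: bX)
    have "((\<lambda>x. - (Y x * \<rho> x * sin x)) has_integral - integral {l..r} (\<lambda>x. Y (a x)) + integral {l..r} (\<lambda>x. Y (b x))) {0..2*pi}"
      by (rule has_integral_combine[OF _ _ 1 2]) auto
    from integral_unique[OF has_integral_neg[OF this]]
    have "integral {0..2*pi} (\<lambda>x. Y x * \<rho> x * sin x) = integral {l..r} (\<lambda>x. Y (a x)) - integral {l..r} (\<lambda>x. Y (b x))"
      by simp
    also have "\<dots> = integral {l..r} (\<lambda>x. Y (a x) - Y (b x))"
      by (intro Henstock_Kurzweil_Integration.integral_diff[symmetric] integrable_continuous_real cYa cYb)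
    finally show ?thesis by (simp add: area_integral_def Y_def)
  qed
  finally have "emeasure lborel D = ennreal (area_integral u)" .
  moreover have "area_integral u \<ge> 0"
    unfolding eq[symmetric] by (rule integral_nonneg)
      (use slice in \<open>auto intro!: integrable_continuous_real continuous_intros cYa cYb\<close>)
  ultimately show ?thesis by blast
qed

lemma measure_D: "measure lebesgue D = area_integral u"
  using emeasure_D borel_open[OF open_D] by (simp add: measure_def)

text \<open>This places the area in the domain of \<open>H\<close>. It comes from \<open>D\<close>
  being open and nonempty; the integrand itself can change sign.\<close>

lemma area_integral_pos: "area_integral u > 0"
proof -
  have "cis 0 \<noteq> cis pi" by (simp add: complex_eq_iff)
  then have "D \<noteq> {}" using D_convex_comb[of 0 pi "1/2"] by auto
  then have "\<not> negligible D" by (rule open_not_negligible[OF open_D])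
  moreover have "D \<in> lmeasurable"
    using emeasure_D borel_open[OF open_D] by (intro fmeasurableI) auto
  ultimately have "measure lebesgue D \<noteq> 0" by (simp add: negligible_iff_measure)
  then show ?thesis using measure_D emeasure_D by simp
qed

end

text \<open>A parametrized curve together with a real-valued lift \<theta> of its normal angle. The
  sign \<sigma> is the orientation, and the increment of exactly one turn per period is what makes
  the curve simple.\<close>

locale convex_curve = convex_support +
  fixes \<theta> \<theta>' :: "real \<Rightarrow> real" and \<sigma> :: real and c :: "real \<Rightarrow> complex"
  assumes \<sigma>: "\<sigma> = 1 \<or> \<sigma> = -1"
    and \<theta>: "\<And>\<phi>. (\<theta> has_real_derivative \<theta>' \<phi>) (at \<phi>)" "\<And>\<phi>. \<sigma> * \<theta>' \<phi> > 0"
      "\<And>\<phi>. \<theta> (\<phi> + 2 * pi) = \<theta> \<phi> + 2 * pi * \<sigma>"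
    and c: "\<And>\<phi>. c \<phi> = P (\<theta> \<phi>)" and smooth: "smooth_on c UNIV"
begin

lemma \<theta>_continuous: "continuous_on S \<theta>"
  by (meson \<theta>(1) DERIV_continuous_on has_field_derivative_at_within)

lemma ex_normal_angle: "\<exists>\<phi>. cis (\<theta> \<phi>) = cis x"
proof -
  have 2: "\<theta> (2 * pi) = \<theta> 0 + 2 * pi * \<sigma>" using \<theta>(3)[of 0] by simp
  obtain y n where y: "y \<in> {min (\<theta> 0) (\<theta> (2 * pi))..<min (\<theta> 0) (\<theta> (2 * pi)) + 2 * pi}" "x = y + 2 * pi * of_int n"
    by (rule periodic_representative)
  have "\<exists>\<phi>. \<theta> \<phi> = y"
    using \<sigma>
  proof
    assume "\<sigma> = 1"
    then show ?thesis using IVT'[OF _ _ _ \<theta>_continuous, of 0 y "2 * pi"] y(1) 2 by force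
  next
    assume "\<sigma> = -1"
    then show ?thesis using IVT2'[OF _ _ _ \<theta>_continuous, of "2 * pi" y 0] y(1) 2 by force
  qed
  then show ?thesis using cis_int[of y n] y(2) by auto
qed

lemma \<theta>_strict_mono: "\<phi> < \<psi> \<Longrightarrow> \<sigma> * \<theta> \<phi> < \<sigma> * \<theta> \<psi>"
  using DERIV_pos_imp_increasing[of \<phi> \<psi> "\<lambda>\<phi>. \<sigma> * \<theta> \<phi>"] DERIV_cmult[OF \<theta>(1), of \<sigma>] \<theta>(2) by blast

lemma range_c: "range c = range P"
proof
  show "range c \<subseteq> range P" by (auto simp: c)
  show "range P \<subseteq> range c"
  proof safe
    fix x obtain \<phi> where "cis (\<theta> \<phi>) = cis x" using ex_normal_angle by blast
    then have "P x = c \<phi>" using P_eq_iff c by simp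
    then show "P x \<in> range c" by blast
  qed
qed

lemma c_deriv: "(c has_vector_derivative (\<theta>' \<phi> * \<rho> (\<theta> \<phi>)) *\<^sub>R (\<i> * cis (\<theta> \<phi>))) (at \<phi>)"
proof -
  have "((P \<circ> \<theta>) has_vector_derivative \<theta>' \<phi> *\<^sub>R (\<rho> (\<theta> \<phi>) *\<^sub>R (\<i> * cis (\<theta> \<phi>)))) (at \<phi>)"
    by (rule vector_diff_chain_at[OF _ P_deriv])
      (use \<theta>(1) in \<open>simp add: has_real_derivative_iff_has_vector_derivative\<close>)
  moreover have "P \<circ> \<theta> = c" by (auto simp: c)
  ultimately show ?thesis by simp
qed

lemma \<theta>'_abs: "\<bar>\<theta>' \<phi>\<bar> = \<sigma> * \<theta>' \<phi>"
  using \<sigma> \<theta>(2)[of \<phi>] by auto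

lemma vector_derivative_c:
  "vector_derivative c (at \<phi>) = (\<theta>' \<phi> * \<rho> (\<theta> \<phi>)) *\<^sub>R (\<i> * cis (\<theta> \<phi>))"
  "norm (vector_derivative c (at \<phi>)) = \<sigma> * \<theta>' \<phi> * \<rho> (\<theta> \<phi>)"
  "norm (vector_derivative c (at \<phi>)) > 0"
proof -
  show 1: "vector_derivative c (at \<phi>) = (\<theta>' \<phi> * \<rho> (\<theta> \<phi>)) *\<^sub>R (\<i> * cis (\<theta> \<phi>))"
    by (rule vector_derivative_at[OF c_deriv])
  show 2: "norm (vector_derivative c (at \<phi>)) = \<sigma> * \<theta>' \<phi> * \<rho> (\<theta> \<phi>)"
    using radius_pos[of "\<theta> \<phi>"] by (simp add: 1 norm_mult abs_mult \<theta>'_abs)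
  show "norm (vector_derivative c (at \<phi>)) > 0"
    unfolding 2 using \<theta>(2)[of \<phi>] radius_pos[of "\<theta> \<phi>"] by simp
qed

lemma regular_simple_closed_curve_c: "regular_simple_closed_curve c"
  unfolding regular_simple_closed_curve_def
proof (intro conjI allI smooth)
  fix \<phi>
  obtain n :: int where "\<sigma> = of_int n" using \<sigma> by (metis of_int_1 of_int_minus)
  then show "c (\<phi> + 2 * pi) = c \<phi>" by (simp add: c \<theta>(3) P_int)
  show "vector_derivative c (at \<phi>) \<noteq> 0" using vector_derivative_c(3)[of \<phi>] by auto
next
  show "inj_on c {0..<2 * pi}"
  proof (rule linorder_inj_onI')
    fix \<phi> \<psi> assume *: "\<phi> \<in> {0..<2*pi}" "\<psi> \<in> {0..<2*pi}" "\<phi> < \<psi>"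
    show "c \<phi> \<noteq> c \<psi>"
    proof
      assume "c \<phi> = c \<psi>"
      then obtain n :: int where n: "\<theta> \<psi> = \<theta> \<phi> + 2 * pi * n"
        by (metis c P_eq_iff cis_eq_iff)
      have "\<sigma> * \<theta> \<phi> < \<sigma> * \<theta> \<psi>" "\<sigma> * \<theta> \<psi> < \<sigma> * \<theta> (\<phi> + 2 * pi)"
        using * by (auto intro!: \<theta>_strict_mono)
      \<comment> \<open>Within less than one period the angle moves, in direction \<sigma>, by
        strictly more than 0 and strictly less than one turn, so no integer \<open>n\<close>
        fits.\<close>
      then have "0 < \<sigma> * (2 * pi * n)" "\<sigma> * (2 * pi * n) < \<sigma> * (2 * pi * \<sigma>)"
        unfolding \<theta>(3) n by (auto simp: algebra_simps)
      then show False using \<sigma> by (auto simp: mult_less_cancel_left1 zero_less_mult_iff mult_less_0_iff)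
    qed
  qed
qed

text \<open>Orthogonality to the tangent leaves the two unit vectors along
  \<open>cis (\<theta> \<phi>)\<close>. The positive one leaves the half plane of the support line
  at once, and \<open>inward_segment\<close> confirms the negative one.\<close>

lemma inward_normal_c: "inward_normal c \<phi> = - cis (\<theta> \<phi>)"
  unfolding inward_normal_def range_c inside_range_P
proof (rule the_equality)
  let ?x = "\<theta> \<phi>"
  have orth: "inner (cis x) (\<i> * cis x) = 0" for x by (simp add: inner_cis)
  obtain e where e: "e > 0" "\<And>s. 0 < s \<Longrightarrow> s < e \<Longrightarrow> P ?x - s *\<^sub>R cis ?x \<in> D"
    using inward_segment by blast
  show "norm (- cis ?x) = 1 \<and> inner (- cis ?x) (vector_derivative c (at \<phi>)) = 0 \<and>
    (\<exists>\<epsilon>>0. \<forall>s. 0 < s \<and> s < \<epsilon> \<longrightarrow> c \<phi> + s *\<^sub>R - cis ?x \<in> D)"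
    using e orth[of ?x] by (auto simp: vector_derivative_c(1) c)
  fix N assume N: "norm N = 1 \<and> inner N (vector_derivative c (at \<phi>)) = 0 \<and>
    (\<exists>\<epsilon>>0. \<forall>s. 0 < s \<and> s < \<epsilon> \<longrightarrow> c \<phi> + s *\<^sub>R N \<in> D)"
  have "\<theta>' \<phi> * \<rho> ?x \<noteq> 0" using \<theta>(2)[of \<phi>] radius_pos[of ?x] by auto
  then have "inner N (\<i> * cis ?x) = 0" using N by (simp add: vector_derivative_c(1))
  then have eq: "N = inner N (cis ?x) *\<^sub>R cis ?x" using complex_cis_decomp[of N ?x] by simp
  then have "\<bar>inner N (cis ?x)\<bar> = 1" using N by (metis mult.right_neutral norm_cis norm_scaleR)
  moreover obtain d where d: "d > 0" "\<And>s. 0 < s \<Longrightarrow> s < d \<Longrightarrow> c \<phi> + s *\<^sub>R N \<in> D"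
    using N by blast
  have "inner N (cis ?x) \<noteq> 1"
  proof
    assume "inner N (cis ?x) = 1"
    then have "c \<phi> + (d / 2) *\<^sub>R cis ?x \<in> D" using d(2)[of "d / 2"] d(1) eq by simp
    then have "inner (P ?x + (d / 2) *\<^sub>R cis ?x) (cis ?x) < u ?x" by (simp add: D_def c)
    then show False using d(1) by (simp add: inner_add_left inner_P inner_cis)
  qed
  ultimately have "inner N (cis ?x) = -1" by linarith
  then show "N = - cis ?x" using eq by simp
qed

lemma outward_normal_c: "outward_normal c \<phi> = cis (\<theta> \<phi>)"
  by (simp add: outward_normal_def inward_normal_c)

text \<open>The tangent \<open>\<sigma> *\<^sub>R (\<i> * cis (\<theta> \<phi>))\<close> turns
  inward at rate \<open>\<sigma> * \<theta>' \<phi>\<close>, and the speed is this rate times the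
  radius; the quotient is the same in both orientations.\<close>

lemma curvature_c: "curvature c \<phi> = 1 / \<rho> (\<theta> \<phi>)"
proof -
  have "unit_tangent c = (\<lambda>\<phi>. \<sigma> *\<^sub>R (\<i> * cis (\<theta> \<phi>)))"
  proof
    fix \<phi>
    have "\<theta>' \<phi> * \<rho> (\<theta> \<phi>) / (\<sigma> * \<theta>' \<phi> * \<rho> (\<theta> \<phi>)) = \<sigma>"
      using \<sigma> \<theta>(2)[of \<phi>] radius_pos[of "\<theta> \<phi>"] by (auto simp: field_simps)
    then show "unit_tangent c \<phi> = \<sigma> *\<^sub>R (\<i> * cis (\<theta> \<phi>))"
      unfolding unit_tangent_def vector_derivative_c(2) unfolding vector_derivative_c(1)
      by (simp only: scaleR_scaleR divide_inverse mult.commute)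
  qed
  moreover have "((\<lambda>\<phi>. \<sigma> *\<^sub>R (\<i> * cis (\<theta> \<phi>))) has_vector_derivative \<sigma> *\<^sub>R (\<i> * (\<theta>' \<phi> *\<^sub>R (\<i> * cis (\<theta> \<phi>))))) (at \<phi>)"
  proof -
    have "((cis \<circ> \<theta>) has_vector_derivative \<theta>' \<phi> *\<^sub>R (\<i> * cis (\<theta> \<phi>))) (at \<phi>)"
      by (rule vector_diff_chain_at[OF _ has_vector_derivative_cis])
        (use \<theta>(1) in \<open>simp add: has_real_derivative_iff_has_vector_derivative\<close>)
    then show ?thesis
      by (intro bounded_linear.has_vector_derivative[OF bounded_linear_scaleR_right] has_vector_derivative_mult_right)
        (simp add: o_def)
  qed
  ultimately have v: "vector_derivative (unit_tangent c) (at \<phi>) = \<sigma> *\<^sub>R (\<i> * (\<theta>' \<phi> *\<^sub>R (\<i> * cis (\<theta> \<phi>))))"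
    by (simp add: vector_derivative_at)
  have "\<sigma> *\<^sub>R (\<i> * (\<theta>' \<phi> *\<^sub>R (\<i> * cis (\<theta> \<phi>)))) = (\<sigma> * \<theta>' \<phi>) *\<^sub>R (- cis (\<theta> \<phi>))"
    by (simp add: complex_eq_iff)
  then show ?thesis
    unfolding curvature_def v inward_normal_c vector_derivative_c(2)
    using \<theta>(2)[of \<phi>] radius_pos[of "\<theta> \<phi>"] by (auto simp: inner_cis field_simps)
qed

lemma convex_simple_closed_curve_c: "convex_simple_closed_curve c"
  by (simp add: convex_simple_closed_curve_def regular_simple_closed_curve_c curvature_c radius_pos)

lemma normal_angle_point_c: "normal_angle_point c x = P x"
  unfolding normal_angle_point_def outward_normal_c
proof (rule the_equality)
  obtain \<phi> where "cis (\<theta> \<phi>) = cis x" using ex_normal_angle by blast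
  then show "\<exists>\<phi>. P x = c \<phi> \<and> cis (\<theta> \<phi>) = cis x" using P_eq_iff c by (intro exI[of _ \<phi>]) simp
  show "p = P x" if "\<exists>\<phi>. p = c \<phi> \<and> cis (\<theta> \<phi>) = cis x" for p
    using that P_eq_iff c by auto
qed

lemma support_function_c: "support_function c = u"
  by (auto simp: support_function_def normal_angle_point_c inner_P)

lemma enclosed_area_c: "enclosed_area c = area_integral u"
  by (simp add: enclosed_area_def range_c inside_range_P measure_D)

text \<open>The angle runs over some full turn, forward or backward and from an arbitrary start. An
  antiderivative \<open>R\<close> of the periodic \<rho> has the same increment over every interval
  of length \<open>2 * pi\<close>, which reduces all cases to \<open>{0..2 * pi}\<close>.\<close>

lemma curve_length_c: "curve_length c = integral {0..2 * pi} \<rho>"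
proof -
  obtain R where R: "\<And>x. (R has_real_derivative \<rho> x) (at x)"
    using antiderivative_continuous_UNIV[OF radius_continuous] by blast
  have per: "\<rho> (x + 2 * pi) = \<rho> x" for x
    using u u'' by (simp add: radius_def smooth_periodic_def)
  have "((\<lambda>x. R (x + 2 * pi) - R x) has_real_derivative 0) (at x)" for x
    using DERIV_diff[OF R[of "x + 2 * pi", unfolded DERIV_shift] R[of x]] per by simp
  then have shift: "R (x + 2 * pi) - R x = R (0 + 2 * pi) - R 0" for x
    using DERIV_isconst_all[of "\<lambda>x. R (x + 2 * pi) - R x" x 0] by simp
  have "((\<lambda>\<phi>. \<sigma> * (\<rho> (\<theta> \<phi>) * \<theta>' \<phi>)) has_integral \<sigma> * R (\<theta> (2 * pi)) - \<sigma> * R (\<theta> 0)) {0..2 * pi}"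
    by (rule fundamental_theorem_of_calculus)
      (auto simp: has_real_derivative_iff_has_vector_derivative[symmetric]
        intro!: DERIV_cmult DERIV_chain2[OF R] \<theta>(1)[THEN has_field_derivative_at_within])
  moreover have "\<sigma> * R (\<theta> (2 * pi)) - \<sigma> * R (\<theta> 0) = R (2 * pi) - R 0"
    using \<sigma> \<theta>(3)[of 0] shift[of "\<theta> 0"] shift[of "\<theta> 0 - 2 * pi"] by auto
  ultimately have "integral {0..2 * pi} (\<lambda>\<phi>. \<sigma> * \<theta>' \<phi> * \<rho> (\<theta> \<phi>)) = R (2 * pi) - R 0"
    by (intro integral_unique) (simp add: mult_ac)
  moreover have "(\<rho> has_integral R (2 * pi) - R 0) {0..2 * pi}"
    by (rule fundamental_theorem_of_calculus)
      (auto simp: has_real_derivative_iff_has_vector_derivative[symmetric]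
        intro!: R[THEN has_field_derivative_at_within])
  ultimately show ?thesis
    by (simp add: curve_length_def vector_derivative_c(2) integral_unique)
qed

end

section \<open>The normal angle of a convex curve\<close>

text \<open>The slope is the mean of \<open>f'\<close> over the segment, a parameter integral that
  makes sense and is continuous at step size 0 as well.\<close>

lemma continuous_on_slope:
  fixes f f' :: "real \<Rightarrow> 'a::euclidean_space"
  assumes "\<And>x. (f has_vector_derivative f' x) (at x)" "continuous_on UNIV f'"
  shows "continuous_on UNIV (\<lambda>p. if snd p = 0 then f' (fst p) else (f (fst p + snd p) - f (fst p)) /\<^sub>R snd p)"
proof -
  have "continuous_on (UNIV \<times> cbox 0 1) (\<lambda>(p, r). f' (fst p + r * snd p))"
    unfolding case_prod_unfold by (intro continuous_on_compose2[OF assms(2)] continuous_intros) auto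
  then have "continuous_on UNIV (\<lambda>p. integral (cbox 0 1) (\<lambda>r. f' (fst p + r * snd p)))"
    by (rule integral_continuous_on_param)
  moreover have "integral (cbox 0 1) (\<lambda>r. f' (fst p + r * snd p)) =
      (if snd p = 0 then f' (fst p) else (f (fst p + snd p) - f (fst p)) /\<^sub>R snd p)" for p
  proof (cases "snd p = 0")
    case False
    have "((\<lambda>r. (f (fst p + r * snd p)) /\<^sub>R snd p) has_vector_derivative f' (fst p + r * snd p)) (at r within {0..1})" for r
    proof -
      have "((f \<circ> (\<lambda>r. fst p + r * snd p)) has_vector_derivative snd p *\<^sub>R f' (fst p + r * snd p)) (at r)"
        by (rule vector_diff_chain_at[OF _ assms(1)]) (auto intro!: derivative_eq_intros)
      from bounded_linear.has_vector_derivative[OF bounded_linear_scaleR_right this, of "inverse (snd p)"]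
      show ?thesis using False by (auto simp: o_def intro: has_vector_derivative_at_within)
    qed
    then have "((\<lambda>r. f' (fst p + r * snd p)) has_integral
        (f (fst p + 1 * snd p)) /\<^sub>R snd p - (f (fst p + 0 * snd p)) /\<^sub>R snd p) {0..1}"
      by (intro fundamental_theorem_of_calculus) auto
    then show ?thesis using False by (simp add: integral_unique scaleR_diff_right)
  qed simp
  ultimately show ?thesis by (simp only:)
qed

text \<open>The fibres of \<open>cis\<close> are discrete, while the image of a connected set under
  \<open>f\<close> contains every value between two of its values.\<close>

lemma cis_constant_imp_constant:
  fixes f :: "'a::topological_space \<Rightarrow> real"
  assumes "connected S" "continuous_on S f" "\<And>x. x \<in> S \<Longrightarrow> cis (f x) = z" "a \<in> S" "b \<in> S"
  shows "f a = f b"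
proof -
  have *: False if ab: "a \<in> S" "b \<in> S" "f a < f b" for a b
  proof -
    \<comment> \<open>Capped at \<open>pi\<close> because cosine is strictly monotone on
      \<open>{0..pi}\<close>, so that \<open>cos e = 1\<close> is impossible.\<close>
    define e where "e = min (f b - f a) pi"
    have e: "0 < e" "e \<le> pi" "f a + e \<le> f b" using ab by (auto simp: e_def)
    have "{f a..f b} \<subseteq> f ` S"
      using connected_contains_Icc[OF connected_continuous_image[OF assms(2,1)]] ab by blast
    then have "f a + e \<in> f ` S" using e by auto
    then have "cis (f a + e) = z" "cis (f a) = z" using assms(3) ab by auto
    then have "cos (f a + e - f a) = 1" by (intro cis_eq_imp_cos) simp
    then have "cos e = cos 0" by simp
    then show False using cos_monotone_0_pi[of 0 e] e by simp
  qed
  show ?thesis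
    by (cases "f a" "f b" rule: linorder_cases) (use *[of a b] *[of b a] assms(4,5) in auto)
qed

text \<open>A longer interval would contain \<open>x\<close> and \<open>x + pi\<close> for all
  \<open>x\<close> in a nontrivial interval, and sine would vanish on it. Below, this bounds the
  variation of an argument in the upper half plane.\<close>

lemma sin_nonneg_interval_length:
  fixes a b :: real
  assumes "\<And>x. x \<in> {a..b} \<Longrightarrow> sin x \<ge> 0"
  shows "b - a \<le> pi"
proof (rule ccontr)
  assume "\<not> b - a \<le> pi"
  then have ab: "b > a + pi" by simp
  have z: "sin x = 0" if "x \<in> {a..b - pi}" for x
    using assms[of x] assms[of "x + pi"] that pi_gt_zero by (simp del: pi_gt_zero)
  define e where "e = min (b - pi - a) (pi / 2)"
  have "e \<le> pi / 2" unfolding e_def by (rule min.cobounded2)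
  then have e: "0 < e" "e < pi" "a + e \<le> b - pi" using ab pi_gt_zero by (simp_all add: e_def del: pi_gt_zero)
  have "sin a = 0" "sin (a + e) = 0" using z[of a] z[of "a + e"] e by auto
  then have "cos a * sin e = 0" by (simp add: sin_add)
  moreover have "sin e > 0" using e by (intro sin_gt_zero) auto
  ultimately have "cos a = 0" by simp
  then show False using \<open>sin a = 0\<close> sin_cos_squared_add[of a] by simp
qed

text \<open>Hopf's theorem on turning tangents. The secant \<open>c (s + d) - c s\<close>, divided by \<open>2 sin (d/2)\<close>,
  extends continuously and without zeros to the strip \<open>0 \<le> d \<le> 2\<pi>\<close>, with values \<open>\<plusminus>c' s\<close> on
  the boundary. A continuous argument of it increases from \<open>d = 0\<close> to \<open>d = 2\<pi>\<close> by an odd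
  multiple \<open>m\<pi>\<close> of \<open>\<pi>\<close>, and by symmetry the tangent turns by \<open>2m\<pi>\<close>. All secants from a lowest
  point lie in the upper half plane, so \<open>m = \<plusminus>1\<close>.\<close>

lemma turning_tangents:
  fixes c c' :: "real \<Rightarrow> complex" and r \<alpha> :: "real \<Rightarrow> real"
  assumes c': "\<And>x. (c has_vector_derivative c' x) (at x)" "continuous_on UNIV c'"
    and per: "\<And>x. c (x + 2 * pi) = c x" and inj: "inj_on c {0..<2 * pi}"
    and polar: "\<And>x. c' x = r x *\<^sub>R cis (\<alpha> x)" "\<And>x. r x > 0" and \<alpha>: "continuous_on UNIV \<alpha>"
  shows "\<bar>\<alpha> (x + 2 * pi) - \<alpha> x\<bar> = 2 * pi"
proof -
  have c'nz: "c' x \<noteq> 0" for x using polar(1)[of x] polar(2)[of x] by simp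
  have c'per: "c' (x + 2 * pi) = c' x" for x
  proof -
    have "((\<lambda>x. c (x + 2 * pi)) has_vector_derivative c' (x + 2 * pi)) (at x)"
    proof -
      have "((\<lambda>x. x + 2 * pi) has_vector_derivative 1) (at x)"
        by (auto intro!: derivative_eq_intros simp: has_real_derivative_iff_has_vector_derivative[symmetric])
      from vector_diff_chain_at[OF this c'(1)] show ?thesis by (simp add: o_def)
    qed
    then show ?thesis using c'(1)[of x] per vector_derivative_unique_at by force
  qed
  have cne: "c (s + d) \<noteq> c s" if d: "0 < d" "d < 2 * pi" for s d
  proof
    assume eq: "c (s + d) = c s"
    obtain y n where y: "y \<in> {0..<0 + 2 * pi}" "s = y + 2 * pi * of_int n" by (rule periodic_representative)
    obtain z m where z: "z \<in> {0..<0 + 2 * pi}" "s + d = z + 2 * pi * of_int m" by (rule periodic_representative)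
    have "c y = c z" using eq periodic_int[of c, OF per] y(2) z(2) by metis
    then have "y = z" using inj y(1) z(1) by (auto dest: inj_onD)
    then have "d = 2 * pi * of_int (m - n)" using y(2) z(2) by (simp add: algebra_simps)
    then show False using d by (auto simp: zero_less_mult_iff)
  qed
  define G where "G p = (if snd p = 0 then c' (fst p) else if snd p = 2 * pi then - c' (fst p)
    else (c (fst p + snd p) - c (fst p)) /\<^sub>R (2 * sin (snd p / 2)))" for p
  have sinpos: "sin (d / 2) > 0" if "0 < d" "d < 2 * pi" for d using that by (intro sin_gt_zero) auto
  have sym: "G (s + d, 2 * pi - d) = - G (s, d)" if d: "d \<in> {0..2*pi}" for s d
  proof -
    consider "d = 0" | "d = 2 * pi" | "0 < d" "d < 2 * pi" using d by fastforce
    then show ?thesis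
    proof cases
      case 3
      have "sin ((2 * pi - d) / 2) = sin (d / 2)"
        using sin_pi_minus[of "d / 2"] by (simp add: diff_divide_distrib)
      then show ?thesis using 3 per[of s] by (simp add: G_def add.commute add.left_commute scaleR_diff_right)
    qed (auto simp: G_def c'per)
  qed
  have Gnz: "G p \<noteq> 0" if "p \<in> UNIV \<times> {0..2*pi}" for p
    using that c'nz cne[of "snd p" "fst p"] sinpos[of "snd p"] by (auto simp: G_def mem_Times_iff)
  \<comment> \<open>For \<open>d \<le> pi\<close> the sine vanishes only at \<open>d = 0\<close>.
    There \<open>G\<close> is the quotient of two slopes, those of \<open>c\<close> and of
    \<open>2 * sin (d / 2)\<close>, and the latter is positive.\<close>
  have G1: "continuous_on (UNIV \<times> {0..pi}) G"
  proof -
    let ?Qc = "\<lambda>p. if snd p = 0 then c' (fst p) else (c (fst p + snd p) - c (fst p)) /\<^sub>R snd p"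
    let ?Qs = "\<lambda>p. if snd p = 0 then cos (fst p / 2) else (2 * sin ((fst p + snd p) / 2) - 2 * sin (fst p / 2)) /\<^sub>R snd p"
    have Qs: "continuous_on UNIV ?Qs"
      by (rule continuous_on_slope[of "\<lambda>x. 2 * sin (x / 2)" "\<lambda>x. cos (x / 2)"])
        (auto intro!: derivative_eq_intros continuous_intros simp: has_real_derivative_iff_has_vector_derivative[symmetric])
    have Qs0: "continuous_on (UNIV \<times> {0..pi}) (\<lambda>p :: real \<times> real. ?Qs (0, snd p))"
      by (rule continuous_on_compose2[OF Qs, of _ "\<lambda>p. (0, snd p)"]) (auto intro!: continuous_intros)
    have pos: "?Qs (0, snd p) > 0" if "p \<in> UNIV \<times> {0..pi}" for p :: "real \<times> real"
      using that sinpos[of "snd p"] by (auto simp: mem_Times_iff)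
    have pos': "\<forall>p\<in>UNIV \<times> {0..pi}. ?Qs (0, snd (p :: real \<times> real)) \<noteq> 0"
    proof
      fix p :: "real \<times> real" assume "p \<in> UNIV \<times> {0..pi}"
      from pos[OF this] show "?Qs (0, snd p) \<noteq> 0" by linarith
    qed
    have "continuous_on (UNIV \<times> {0..pi}) (\<lambda>p. ?Qc p /\<^sub>R ?Qs (0, snd p))"
      by (intro continuous_on_scaleR continuous_on_inverse Qs0 pos' continuous_on_subset[OF continuous_on_slope[OF c']])
        auto
    moreover have "?Qc p /\<^sub>R ?Qs (0, snd p) = G p" if "p \<in> UNIV \<times> {0..pi}" for p
      using that by (auto simp: G_def mem_Times_iff)
    ultimately show ?thesis by (simp cong: continuous_on_cong)
  qed
  have G2: "continuous_on (UNIV \<times> {pi..2*pi}) G"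
  proof -
    have "continuous_on (UNIV \<times> {pi..2*pi}) (\<lambda>p. - G (fst p + snd p, 2 * pi - snd p))"
      by (intro continuous_on_minus continuous_on_compose2[OF G1]) (auto intro!: continuous_intros)
    moreover have "- G (fst p + snd p, 2 * pi - snd p) = G p" if "p \<in> UNIV \<times> {pi..2*pi}" for p
      using sym[of "snd p" "fst p"] that pi_ge_zero by (auto simp: mem_Times_iff simp del: pi_ge_zero)
    ultimately show ?thesis by (simp cong: continuous_on_cong)
  qed
  let ?S = "UNIV \<times> {0..2*pi} :: (real \<times> real) set"
  have S: "?S = UNIV \<times> {0..pi} \<union> UNIV \<times> {pi..2*pi}" by auto
  have G: "continuous_on ?S G"
    unfolding S by (rule continuous_on_closed_Un[OF _ _ G1 G2]) (auto intro: closed_Times)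
  have cvx: "convex ?S" by (intro convex_Times) auto
  obtain L where L: "continuous_on ?S L" "\<And>p. p \<in> ?S \<Longrightarrow> G p = exp (L p)"
    using continuous_logarithm_on_contractible[OF G convex_imp_contractible[OF cvx] Gnz] by blast
  define A where "A p = Im (L p)" for p
  have A: "continuous_on ?S A" unfolding A_def by (intro continuous_intros L)
  have GA: "G p = norm (G p) *\<^sub>R cis (A p)" if "p \<in> ?S" for p
    unfolding A_def L(2)[OF that] by (simp add: exp_eq_polar norm_mult scaleR_conv_of_real)
  have nG: "norm (G p) > 0" if "p \<in> ?S" for p using Gnz[OF that] by simp
  \<comment> \<open>Both are continuous arguments of the same nonvanishing function
    \<open>c'\<close>, hence differ by a constant.\<close>
  have \<alpha>A: "\<alpha> s - A (s, 0) = \<alpha> t - A (t, 0)" for s t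
  proof (rule cis_constant_imp_constant[of UNIV "\<lambda>s. \<alpha> s - A (s, 0)" 1])
    show "continuous_on UNIV (\<lambda>s. \<alpha> s - A (s, 0))"
      by (intro continuous_intros \<alpha> continuous_on_compose2[OF A]) auto
    fix s
    have "norm (G (s, 0)) *\<^sub>R cis (A (s, 0)) = r s *\<^sub>R cis (\<alpha> s)"
      using GA[of "(s, 0)"] polar(1)[of s] by (simp add: G_def)
    moreover have "norm (G (s, 0)) = r s" using polar[of s] by (simp add: G_def)
    ultimately have "cis (A (s, 0)) = cis (\<alpha> s)" using polar(2)[of s] by simp
    then show "cis (\<alpha> s - A (s, 0)) = 1" by (metis cis_divide cis_neq_zero divide_self)
  qed auto
  \<comment> \<open>The change of the argument under the reversal of secants; it is an odd multiple
    of \<open>pi\<close> and constant on the strip. At \<open>(s, 0)\<close> it is the increase of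
    the argument from \<open>d = 0\<close> to \<open>d = 2 * pi\<close>.\<close>
  define \<delta> where "\<delta> p = A (fst p + snd p, 2 * pi - snd p) - A p" for p
  have cis\<delta>: "cis (\<delta> p) = -1" if p: "p \<in> ?S" for p
  proof -
    have p': "(fst p + snd p, 2 * pi - snd p) \<in> ?S" using p by auto
    have eq: "G (fst p + snd p, 2 * pi - snd p) = - G p" using sym[of "snd p" "fst p"] p by (auto simp: mem_Times_iff)
    have "norm (G p) *\<^sub>R cis (A (fst p + snd p, 2 * pi - snd p)) = - (norm (G p) *\<^sub>R cis (A p))"
      using GA[OF p'] GA[OF p] unfolding eq by simp
    then have "cis (A (fst p + snd p, 2 * pi - snd p)) = - cis (A p)"
      using nG[OF p] by (metis less_irrefl scaleR_cancel_left scaleR_minus_right)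
    then show ?thesis by (simp add: \<delta>_def flip: cis_divide)
  qed
  have c\<delta>: "continuous_on ?S \<delta>"
    unfolding \<delta>_def[abs_def] by (intro continuous_intros continuous_on_compose2[OF A]) auto
  have \<delta>: "\<delta> p = \<delta> q" if "p \<in> ?S" "q \<in> ?S" for p q
    by (rule cis_constant_imp_constant[OF convex_connected[OF cvx] c\<delta> cis\<delta> that])
  obtain s0 where s0: "\<And>s. Im (c s0) \<le> Im (c s)"
  proof -
    have "continuous_on {0..2*pi} c"
      using c'(1) by (meson continuous_at_imp_continuous_on has_vector_derivative_continuous)
    then have "continuous_on {0..2*pi} (\<lambda>s. Im (c s))" by (intro continuous_intros)
    then obtain s0 where s0: "s0 \<in> {0..2*pi}" "\<And>s. s \<in> {0..2*pi} \<Longrightarrow> Im (c s0) \<le> Im (c s)"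
      by (rule continuous_on_Icc_attains_inf) auto
    have "Im (c s0) \<le> Im (c s)" for s
    proof -
      obtain y n where y: "y \<in> {0..<0 + 2 * pi}" "s = y + 2 * pi * of_int n" by (rule periodic_representative)
      then show ?thesis using s0(2)[of y] periodic_int[of c, OF per] by simp
    qed
    then show thesis by (rule that)
  qed
  \<comment> \<open>At a lowest point the tangent is horizontal, so the boundary values of
    \<open>G\<close> at \<open>d = 0\<close> and \<open>d = 2 * pi\<close> also lie in the closed
    upper half plane.\<close>
  have "Im (c' s0) = 0"
  proof -
    have "((\<lambda>s. Im (c s)) has_real_derivative Im (c' s0)) (at s0)"
      using bounded_linear.has_vector_derivative[OF bounded_linear_Im c'(1)]
      by (simp add: has_real_derivative_iff_has_vector_derivative)
    then show ?thesis by (rule DERIV_local_min[of _ _ _ 1]) (use s0 in auto)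
  qed
  then have ImG: "Im (G (s0, d)) \<ge> 0" if "d \<in> {0..2*pi}" for d
    using that s0[of "s0 + d"] sinpos[of d] by (auto simp: G_def)
  have sinA: "sin (A (s0, d)) \<ge> 0" if "d \<in> {0..2*pi}" for d
  proof -
    have p: "(s0, d) \<in> ?S" using that by simp
    have "Im (G (s0, d)) = norm (G (s0, d)) * sin (A (s0, d))"
      by (subst GA[OF p]) simp
    then show ?thesis using ImG[OF that] nG[OF p] by (simp add: zero_le_mult_iff)
  qed
  have cA: "continuous_on {0..2*pi} (\<lambda>d. A (s0, d))"
    by (rule continuous_on_compose2[OF A]) (auto intro!: continuous_intros)
  have img: "{min (A (s0, 0)) (A (s0, 2 * pi))..max (A (s0, 0)) (A (s0, 2 * pi))} \<subseteq> (\<lambda>d. A (s0, d)) ` {0..2*pi}"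
  proof -
    have "connected ((\<lambda>d. A (s0, d)) ` {0..2*pi})" by (rule connected_continuous_image[OF cA]) simp
    then show ?thesis by (rule connected_contains_Icc) (auto simp: min_def max_def)
  qed
  have "max (A (s0, 0)) (A (s0, 2 * pi)) - min (A (s0, 0)) (A (s0, 2 * pi)) \<le> pi"
    by (rule sin_nonneg_interval_length) (use img sinA in blast)
  then have le: "\<bar>\<delta> (s0, 0)\<bar> \<le> pi" by (simp add: \<delta>_def max_def min_def abs_if split: if_splits)
  have "cos (\<delta> (s0, 0)) = -1" using cis\<delta>[of "(s0, 0)"] by (simp add: complex_eq_iff)
  then have "cos \<bar>\<delta> (s0, 0)\<bar> = cos pi" by simp
  then have "\<bar>\<delta> (s0, 0)\<bar> = pi" using le cos_inj_pi[of "\<bar>\<delta> (s0, 0)\<bar>" pi] by simp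
  moreover have "\<alpha> (x + 2 * pi) - \<alpha> x = 2 * \<delta> (s0, 0)"
  proof -
    \<comment> \<open>The sum telescopes through \<open>A (x, 2 * pi)\<close>: a turn of the tangent
      amounts to crossing the strip twice.\<close>
    have "A (x + 2 * pi, 0) - A (x, 0) = \<delta> (x, 2 * pi) + \<delta> (x, 0)" by (simp add: \<delta>_def)
    then show ?thesis using \<delta>[of "(x, 2 * pi)" "(s0, 0)"] \<delta>[of "(x, 0)" "(s0, 0)"] \<alpha>A[of "x + 2 * pi" x] by simp
  qed
  ultimately show ?thesis by (simp add: abs_mult)
qed


section \<open>Smooth angles and reparametrization by the normal angle\<close>

lemma smooth_on_antiderivative:
  fixes f F :: "real \<Rightarrow> real"
  assumes "smooth_on f UNIV" "\<And>x. (F has_real_derivative f x) (at x)"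
  shows "smooth_on F UNIV"
  unfolding smooth_on_def
proof
  fix k
  have "Ck_on (Suc k) F UNIV"
    using assms by (intro Ck_on_vector_SucI[of _ _ f])
      (auto simp: smooth_on_def has_real_derivative_iff_has_vector_derivative simp del: Ck_on.simps)
  then show "Ck_on k F UNIV" by (rule Ck_on_Suc_imp)
qed

text \<open>The derivative \<open>1 / \<theta>' (\<psi> y)\<close> is as regular as \<psi>, so
  \<psi> gains one order at each step of an induction that starts from continuity.\<close>

lemma smooth_diffeo_inverse:
  fixes \<theta> \<theta>' :: "real \<Rightarrow> real" and \<sigma> :: real
  assumes \<sigma>: "\<sigma> = 1 \<or> \<sigma> = -1"
    and \<theta>: "\<And>x. (\<theta> has_real_derivative \<theta>' x) (at x)" "\<And>x. \<sigma> * \<theta>' x > 0"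
      "\<And>x. \<theta> (x + 2 * pi) = \<theta> x + 2 * pi * \<sigma>" and smooth: "smooth_on \<theta>' UNIV"
  obtains \<psi> where "smooth_on \<psi> UNIV" "\<And>y. \<theta> (\<psi> y) = y" "\<And>x. \<psi> (\<theta> x) = x"
    "\<And>y. (\<psi> has_real_derivative 1 / \<theta>' (\<psi> y)) (at y)"
proof -
  have mono: "\<sigma> * \<theta> x < \<sigma> * \<theta> y" if "x < y" for x y
    using DERIV_pos_imp_increasing[OF that, of "\<lambda>x. \<sigma> * \<theta> x"] DERIV_cmult[OF \<theta>(1), of \<sigma>] \<theta>(2) by blast
  have inj: "inj \<theta>"
    by (rule linorder_inj_onI') (use mono in force)
  have cont: "continuous_on S \<theta>" for S
    by (meson \<theta>(1) DERIV_continuous_on has_field_derivative_at_within)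
  have surj: "\<exists>x. \<theta> x = y" for y
  proof -
    have shift: "\<theta> (x + 2 * pi * of_int n) = \<theta> x + 2 * pi * of_int n * \<sigma>" for x and n :: int
    proof -
      \<comment> \<open>Removing the linear part leaves a periodic function. The resulting shift
        rule extends the values attained on one period to the whole line.\<close>
      have "\<theta> (x + 2 * pi * of_int n) - \<sigma> * (x + 2 * pi * of_int n) = \<theta> x - \<sigma> * x"
        by (rule periodic_int[of "\<lambda>x. \<theta> x - \<sigma> * x"]) (simp add: \<theta>(3) distrib_left mult_ac(2)[of \<sigma> "2 * pi"])
      then show ?thesis by (simp add: algebra_simps)
    qed
    have 2: "\<theta> (2 * pi) = \<theta> 0 + 2 * pi * \<sigma>" using \<theta>(3)[of 0] by simp
    obtain z n where z: "z \<in> {min (\<theta> 0) (\<theta> (2 * pi))..<min (\<theta> 0) (\<theta> (2 * pi)) + 2 * pi}" "y = z + 2 * pi * of_int n"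
      by (rule periodic_representative)
    have "\<exists>x. \<theta> x = z"
      using \<sigma>
    proof
      assume "\<sigma> = 1"
      then show ?thesis using IVT'[OF _ _ _ cont, of 0 z "2 * pi"] z(1) 2 by force
    next
      assume "\<sigma> = -1"
      then show ?thesis using IVT2'[OF _ _ _ cont, of "2 * pi" z 0] z(1) 2 by force
    qed
    then obtain x where x: "\<theta> x = z" by blast
    show ?thesis
      using \<sigma>
    proof
      assume "\<sigma> = 1"
      then show ?thesis using shift[of x n] x z(2) by auto
    next
      assume "\<sigma> = -1"
      then show ?thesis using shift[of x "-n"] x z(2) by auto
    qed
  qed
  define \<psi> where "\<psi> = inv \<theta>"
  have \<theta>\<psi>: "\<theta> (\<psi> y) = y" for y unfolding \<psi>_def by (rule f_inv_into_f) (use surj[of y] in auto)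
  have \<psi>\<theta>: "\<psi> (\<theta> x) = x" for x unfolding \<psi>_def by (rule inv_f_f[OF inj])
  have "isCont \<psi> (\<theta> (\<psi> y))" for y
    by (rule isCont_inverse_function[where f=\<theta> and g=\<psi> and x="\<psi> y" and d=1]) (use \<psi>\<theta> DERIV_isCont[OF \<theta>(1)] in auto)
  then have c\<psi>: "isCont \<psi> y" for y by (simp add: \<theta>\<psi>)
  have nz: "\<theta>' x \<noteq> 0" for x using \<theta>(2)[of x] by auto
  have d: "(\<psi> has_real_derivative 1 / \<theta>' (\<psi> y)) (at y)" for y
    using DERIV_inverse_function[of \<theta> "\<theta>' (\<psi> y)" \<psi> y "y - 1" "y + 1"] \<theta>(1) nz \<theta>\<psi> c\<psi>
    by (simp add: inverse_eq_divide)
  have "Ck_on k \<psi> UNIV" for k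
  proof (induction k)
    case 0
    then show ?case using c\<psi> by (simp add: continuous_at_imp_continuous_on)
  next
    case (Suc k)
    have "Ck_on k (\<lambda>y. 1 / \<theta>' (\<psi> y)) UNIV"
      using nz smooth
      by (intro Ck_on_divide Ck_on_const Ck_on_compose[OF _ Suc, of _ UNIV]) (auto simp: smooth_on_def)
    then show ?case
      using d by (intro Ck_on_vector_SucI[of _ _ "\<lambda>y. 1 / \<theta>' (\<psi> y)"])
        (auto simp: has_real_derivative_iff_has_vector_derivative)
  qed
  then have "smooth_on \<psi> UNIV" by (simp add: smooth_on_def)
  from that[OF this \<theta>\<psi> \<psi>\<theta> d] show thesis .
qed

text \<open>The derivatives \<open>\<alpha>'\<close> and \<beta> are the imaginary and real parts of
  \<open>f' / f\<close>. Integrating them gives a logarithm of \<open>f\<close> up to a constant,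
  with smoothness visible from the formulas.\<close>

lemma polar_lift:
  fixes f f' :: "real \<Rightarrow> complex"
  assumes f: "\<And>x. (f has_vector_derivative f' x) (at x)" "\<And>x. f x \<noteq> 0"
    and smooth: "smooth_on f UNIV" "smooth_on f' UNIV"
  obtains \<alpha> \<alpha>' where "\<And>x. (\<alpha> has_real_derivative \<alpha>' x) (at x)" "smooth_on \<alpha>' UNIV"
    "\<And>x. f x = norm (f x) *\<^sub>R cis (\<alpha> x)"
proof -
  define \<alpha>' where "\<alpha>' x = inner (\<i> * f x) (f' x) / inner (f x) (f x)" for x
  define \<beta> where "\<beta> x = inner (f x) (f' x) / inner (f x) (f x)" for x
  have lin: "bounded_linear ((*) \<i>)" by (rule bounded_linear_mult_right)
  have nz: "inner (f x) (f x) \<noteq> 0" for x using f(2) by simp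
  have s\<alpha>: "smooth_on \<alpha>' UNIV" and s\<beta>: "smooth_on \<beta> UNIV"
    using smooth nz unfolding smooth_on_def \<alpha>'_def[abs_def] \<beta>_def[abs_def]
    by (auto intro!: Ck_on_divide Ck_on_inner Ck_on_linear_compose[OF lin])
  have c: "continuous_on UNIV \<alpha>'" "continuous_on UNIV \<beta>"
    using s\<alpha> s\<beta> unfolding smooth_on_def by (metis Ck_on.simps(1))+
  obtain a where a: "\<And>x. (a has_real_derivative \<alpha>' x) (at x)"
    using antiderivative_continuous_UNIV[OF c(1)] by blast
  obtain b where b: "\<And>x. (b has_real_derivative \<beta> x) (at x)"
    using antiderivative_continuous_UNIV[OF c(2)] by blast
  have f': "f' x = (\<beta> x + \<i> * \<alpha>' x) * f x" for x
  proof -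
    have "inner (f x) (f x) *\<^sub>R f' x = (inner (f x) (f' x) + \<i> * inner (\<i> * f x) (f' x)) * f x"
      by (simp add: complex_eq_iff inner_complex_def algebra_simps)
    then have "f' x = ((inner (f x) (f' x) + \<i> * inner (\<i> * f x) (f' x)) * f x) /\<^sub>R inner (f x) (f x)"
      using nz[of x] by (metis scaleR_scaleR left_inverse scaleR_one)
    also have "\<dots> = (\<beta> x + \<i> * \<alpha>' x) * f x"
      by (simp add: \<alpha>'_def \<beta>_def scaleR_conv_of_real divide_inverse algebra_simps)
    finally show ?thesis .
  qed
  \<comment> \<open>The quotient of \<open>f\<close> by the candidate exponential. Its derivative
    vanishes, and the constant \<open>g 0\<close> supplies the initial modulus and argument.\<close>
  define g where "g x = f x * exp (- (b x + \<i> * a x))" for x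
  have "(g has_vector_derivative 0) (at x)" for x
  proof -
    have "((\<lambda>x. - (b x + \<i> * a x)) has_vector_derivative - (\<beta> x + \<i> * \<alpha>' x)) (at x)"
      using a[of x] b[of x]
      by (intro has_vector_derivative_minus has_vector_derivative_add has_vector_derivative_mult_right
          has_vector_derivative_of_real)
    from field_vector_diff_chain_at[OF this DERIV_exp]
    have "((\<lambda>x. exp (- (b x + \<i> * a x))) has_vector_derivative - (\<beta> x + \<i> * \<alpha>' x) * exp (- (b x + \<i> * a x))) (at x)"
      by (simp add: o_def)
    from has_vector_derivative_mult[OF f(1) this] show ?thesis
      by (simp add: g_def[abs_def] f' algebra_simps)
  qed
  then have "g x = g 0" for x
    by (intro has_derivative_zero_unique[of UNIV g]) (auto simp: has_vector_derivative_def)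
  then have fg: "f x = g 0 * exp (b x + \<i> * a x)" for x
    unfolding g_def by (metis exp_minus_inverse mult.assoc mult.commute mult.right_neutral)
  have "g 0 \<noteq> 0" using fg[of 0] f(2)[of 0] by auto
  show thesis
  proof
    show "((\<lambda>x. a x + Arg (g 0)) has_real_derivative \<alpha>' x) (at x)" for x
      by (auto intro!: derivative_eq_intros a)
    fix x
    have "g 0 = norm (g 0) *\<^sub>R cis (Arg (g 0))"
      by (metis rcis_cmod_Arg rcis_def scaleR_conv_of_real)
    then have "f x = (norm (g 0) * exp (b x)) *\<^sub>R cis (a x + Arg (g 0))"
      by (subst fg) (simp add: exp_add cis_mult[symmetric] cis_conv_exp[symmetric] scaleR_conv_of_real exp_of_real algebra_simps)
    moreover from this have "norm (f x) = norm (g 0) * exp (b x)" by (simp add: abs_mult)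
    ultimately show "f x = norm (f x) *\<^sub>R cis (a x + Arg (g 0))" by simp
  qed (rule s\<alpha>)
qed

text \<open>A zero of \<open>\<alpha>'\<close> would make the curvature vanish, so by connectedness
  \<open>\<alpha>'\<close> has a constant sign \<sigma>. With the total turning known, the normal
  angle is an invertible parameter, and the support function is read off from the reparametrized
  curve.\<close>

lemma convex_simple_closed_curve_normal_angle:
  assumes "convex_simple_closed_curve c"
  obtains u \<theta> \<theta>' \<sigma> where "convex_curve u \<theta> \<theta>' \<sigma> c" "smooth_on \<theta> UNIV"
proof -
  have reg: "smooth_on c UNIV" "\<And>x. c (x + 2 * pi) = c x" "\<And>x. vector_derivative c (at x) \<noteq> 0"
    "inj_on c {0..<2 * pi}" and curv: "\<And>x. curvature c x > 0"
    using assms by (auto simp: convex_simple_closed_curve_def regular_simple_closed_curve_def)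
  define c' where "c' x = vector_derivative c (at x)" for x
  have c': "(c has_vector_derivative c' x) (at x)" "smooth_on c' UNIV" for x
    using smooth_on_vector_derivative[OF reg(1)] by (auto simp: c'_def[abs_def])
  have nz: "c' x \<noteq> 0" for x using reg(3) by (simp add: c'_def)
  obtain \<alpha> \<alpha>' where \<alpha>: "\<And>x. (\<alpha> has_real_derivative \<alpha>' x) (at x)" "smooth_on \<alpha>' UNIV"
    "\<And>x. c' x = norm (c' x) *\<^sub>R cis (\<alpha> x)"
    using polar_lift[OF smooth_on_vector_derivative(1)[OF c'(2)] nz c'(2) smooth_on_vector_derivative(2)[OF c'(2)]]
    by metis
  have cont: "continuous_on UNIV \<alpha>'" "continuous_on UNIV c'"
    using \<alpha>(2) c'(2) unfolding smooth_on_def by (metis Ck_on.simps(1))+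
  have c\<alpha>: "continuous_on UNIV \<alpha>"
    by (meson \<alpha>(1) DERIV_continuous_on has_field_derivative_at_within)
  have "\<alpha>' x \<noteq> 0" for x
  proof
    assume 0: "\<alpha>' x = 0"
    have ut: "unit_tangent c = cis \<circ> \<alpha>"
    proof
      fix x show "unit_tangent c x = (cis \<circ> \<alpha>) x"
        unfolding unit_tangent_def c'_def[symmetric] using nz[of x] by (subst \<alpha>(3)) simp
    qed
    have "(unit_tangent c has_vector_derivative \<alpha>' x *\<^sub>R (\<i> * cis (\<alpha> x))) (at x)"
      unfolding ut by (rule vector_diff_chain_at[OF _ has_vector_derivative_cis])
        (use \<alpha>(1) in \<open>simp add: has_real_derivative_iff_has_vector_derivative\<close>)
    then have "vector_derivative (unit_tangent c) (at x) = 0"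
      using 0 by (simp add: vector_derivative_at)
    then show False using curv[of x] by (simp add: curvature_def)
  qed
  then obtain \<sigma> :: real where \<sigma>: "\<sigma> = 1 \<or> \<sigma> = -1" "\<And>x. \<sigma> * \<alpha>' x > 0"
  proof -
    have "connected (range \<alpha>')" using connected_continuous_image[OF cont(1)] by simp
    moreover have "0 \<notin> range \<alpha>'" using \<open>\<And>x. \<alpha>' x \<noteq> 0\<close> by (metis rangeE)
    ultimately have *: "\<not> (\<alpha>' x < 0 \<and> 0 < \<alpha>' y)" for x y
      using subsetD[OF connected_contains_Icc[of "range \<alpha>'" "\<alpha>' x" "\<alpha>' y"], of 0] by auto
    show thesis
    proof (cases "\<alpha>' 0 > 0")
      case True
      show thesis using that[of 1] *[of _ 0] True \<open>\<And>x. \<alpha>' x \<noteq> 0\<close> by (metis linorder_neqE mult_1)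
    next
      case False
      then have "\<alpha>' x < 0" for x using *[of 0 x] \<open>\<And>x. \<alpha>' x \<noteq> 0\<close> by (metis linorder_neqE)
      then show thesis using that[of "-1"] by simp
    qed
  qed
  have abs: "\<bar>\<alpha> (x + 2 * pi) - \<alpha> x\<bar> = 2 * pi" for x
    by (rule turning_tangents[OF c'(1) cont(2) reg(2,4) \<alpha>(3) _ c\<alpha>]) (use nz in simp)
  have mono: "\<sigma> * \<alpha> x < \<sigma> * \<alpha> y" if "x < y" for x y
    using DERIV_pos_imp_increasing[OF that, of "\<lambda>x. \<sigma> * \<alpha> x"] DERIV_cmult[OF \<alpha>(1), of \<sigma>] \<sigma>(2) by blast
  have turn: "\<alpha> (x + 2 * pi) = \<alpha> x + 2 * pi * \<sigma>" for x
    using abs[of x] mono[of x "x + 2 * pi"] \<sigma>(1) by (auto simp: abs_if split: if_splits)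
  \<comment> \<open>The tangent is \<open>\<sigma> *\<^sub>R (\<i> * cis (\<theta> x))\<close>, a
    quarter turn from the outward normal in the direction given by the orientation.\<close>
  define \<theta> where "\<theta> x = \<alpha> x - \<sigma> * pi / 2" for x
  have \<theta>: "(\<theta> has_real_derivative \<alpha>' x) (at x)" "\<theta> (x + 2 * pi) = \<theta> x + 2 * pi * \<sigma>" for x
    unfolding \<theta>_def[abs_def] by (auto intro!: derivative_eq_intros \<alpha>(1) simp: turn)
  have cis\<theta>: "cis (\<alpha> x) = \<sigma> *\<^sub>R (\<i> * cis (\<theta> x))" for x
    using \<sigma>(1) by (auto simp: \<theta>_def complex_eq_iff cos_diff sin_diff cos_add sin_add)
  obtain \<psi> where \<psi>: "smooth_on \<psi> UNIV" "\<And>y. \<theta> (\<psi> y) = y" "\<And>x. \<psi> (\<theta> x) = x"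
    "\<And>y. (\<psi> has_real_derivative 1 / \<alpha>' (\<psi> y)) (at y)"
    using smooth_diffeo_inverse[OF \<sigma>(1) \<theta>(1) \<sigma>(2) \<theta>(2) \<alpha>(2)] by blast
  define q where "q y = c (\<psi> y)" for y
  \<comment> \<open>Speed over turning rate, \<sigma> being its own inverse: the radius of curvature
    at normal angle \<open>y\<close>. It reappears below as \<open>u + u''\<close>, which makes the
    radius positive.\<close>
  define \<kappa> where "\<kappa> y = norm (c' (\<psi> y)) * \<sigma> / \<alpha>' (\<psi> y)" for y
  have q': "(q has_vector_derivative \<kappa> y *\<^sub>R (\<i> * cis y)) (at y)" for y
  proof -
    have "((c \<circ> \<psi>) has_vector_derivative (1 / \<alpha>' (\<psi> y)) *\<^sub>R c' (\<psi> y)) (at y)"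
      by (rule vector_diff_chain_at[OF _ c'(1)])
        (use \<psi>(4) in \<open>simp add: has_real_derivative_iff_has_vector_derivative\<close>)
    moreover have "(1 / \<alpha>' (\<psi> y)) *\<^sub>R c' (\<psi> y) = \<kappa> y *\<^sub>R (\<i> * cis y)"
      using \<alpha>(3)[of "\<psi> y"] cis\<theta>[of "\<psi> y"] by (simp add: \<psi>(2) \<kappa>_def) (metis mult.commute scaleR_scaleR times_divide_eq_right mult_1 divide_inverse)
    ultimately show ?thesis by (simp add: q_def[abs_def] o_def)
  qed
  have \<kappa>: "\<kappa> y > 0" for y
    using \<sigma>(1) \<sigma>(2)[of "\<psi> y"] nz[of "\<psi> y"] by (auto simp: \<kappa>_def divide_pos_neg)
  define u where "u y = inner (q y) (cis y)" for y
  have u': "(u has_real_derivative inner (q y) (\<i> * cis y)) (at y)" for y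
    using bounded_bilinear.has_vector_derivative[OF bounded_bilinear_inner q' has_vector_derivative_cis, of y]
    by (simp add: u_def[abs_def] inner_cis has_real_derivative_iff_has_vector_derivative)
  then have du: "deriv u = (\<lambda>y. inner (q y) (\<i> * cis y))" by (intro ext DERIV_imp_deriv)
  have "((\<lambda>y. inner (q y) (\<i> * cis y)) has_vector_derivative inner (q y) (\<i> * (\<i> * cis y)) + inner (\<kappa> y *\<^sub>R (\<i> * cis y)) (\<i> * cis y)) (at y)" for y
    by (rule bounded_bilinear.has_vector_derivative[OF bounded_bilinear_inner q'])
      (intro has_vector_derivative_mult_right has_vector_derivative_cis)
  moreover have "inner (q y) (\<i> * (\<i> * cis y)) + inner (\<kappa> y *\<^sub>R (\<i> * cis y)) (\<i> * cis y) = \<kappa> y - u y" for y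
  proof -
    have "inner (\<i> * cis y) (\<i> * cis y) = 1" by (simp add: inner_complex_def power2_eq_square[symmetric])
    moreover have "inner (q y) (\<i> * (\<i> * cis y)) = - u y" by (simp add: u_def inner_complex_def)
    ultimately show ?thesis by simp
  qed
  ultimately have "(deriv u has_real_derivative \<kappa> y - u y) (at y)" for y
    unfolding du by (simp add: has_real_derivative_iff_has_vector_derivative)
  then have ddu: "deriv (deriv u) y = \<kappa> y - u y" for y by (rule DERIV_imp_deriv)
  have qper: "q (y + 2 * pi) = q y" for y
  proof -
    obtain n :: int where n: "\<sigma> = of_int n" using \<sigma>(1) by (metis of_int_1 of_int_minus)
    \<comment> \<open>Since \<open>\<sigma> * \<sigma> = 1\<close>, moving the parameter by \<sigma>
      periods advances the angle by one positive turn in both orientations.\<close>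
    have sh: "\<theta> (\<psi> y + 2 * pi * \<sigma>) = y + 2 * pi"
    proof (cases "\<sigma> = 1")
      case True
      then show ?thesis using \<theta>(2)[of "\<psi> y"] \<psi>(2) by simp
    next
      case False
      then show ?thesis using \<sigma>(1) \<theta>(2)[of "\<psi> y - 2 * pi"] \<psi>(2)[of y] by simp
    qed
    have "\<psi> (y + 2 * pi) = \<psi> y + 2 * pi * of_int n"
      using \<psi>(3)[of "\<psi> y + 2 * pi * \<sigma>"] sh n by simp
    then show ?thesis using periodic_int[of c, OF reg(2)] by (simp add: q_def)
  qed
  have "smooth_on q UNIV"
    unfolding q_def[abs_def] smooth_on_def
  proof
    fix k show "Ck_on k (\<lambda>y. c (\<psi> y)) UNIV"
      by (rule Ck_on_compose[OF reg(1)[unfolded smooth_on_def, rule_format] \<psi>(1)[unfolded smooth_on_def, rule_format]]) simp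
  qed
  then have su: "smooth_on u UNIV"
    unfolding u_def[abs_def] by (simp add: smooth_on_def Ck_on_inner Ck_on_cis)
  have "u (y + 2 * pi) = u y" for y
    by (simp add: u_def qper cis_mult[symmetric])
  with su have sp: "smooth_periodic u" by (simp add: smooth_periodic_def)
  have P: "c x = support_point u (\<theta> x)" for x
    using complex_cis_decomp[of "q (\<theta> x)" "\<theta> x"] by (simp add: support_point_def du u_def q_def \<psi>(3))
  have "convex_curve u \<theta> \<alpha>' \<sigma> c"
    by unfold_locales (use sp \<kappa> ddu \<sigma> \<theta> P reg(1) in \<open>simp_all add: radius_def\<close>)
  moreover have "smooth_on \<theta> UNIV" by (rule smooth_on_antiderivative[OF \<alpha>(2) \<theta>(1)])
  ultimately show thesis by (rule that)
qed

section \<open>The nonlocal flow\<close>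

text \<open>The width \<open>l\<close> is a parameter apart from \<open>t\<close>, because its
  equation is solved later; differentiation in \<open>x\<close> removes it, so derivatives appear
  with width 0.\<close>

definition evolved :: "(real \<Rightarrow> real) \<Rightarrow> real \<Rightarrow> real \<Rightarrow> real \<Rightarrow> real" where
  "evolved u l t x = exp t * heat u (x, t) + l"

lemma smooth_periodic_evolved:
  assumes u: "smooth_periodic u" and t: "t \<ge> 0"
  shows "smooth_periodic (evolved u l t)"
proof -
  have "Ck_on k (\<lambda>x. exp t * heat u (x, t) + l) UNIV" for k
    using t by (intro Ck_on_add Ck_on_mult Ck_on_const Ck_on_slice_fst[OF Ck_on_heat[OF u]]) auto
  then show ?thesis using heat_periodic[OF u] by (simp add: smooth_periodic_def smooth_on_def evolved_def[abs_def])
qed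

lemma deriv_evolved:
  assumes u: "smooth_periodic u"
  shows "deriv (evolved u l t) = evolved (deriv u) 0 t"
proof
  fix x show "deriv (evolved u l t) x = evolved (deriv u) 0 t x"
    unfolding evolved_def[abs_def] by (auto intro!: DERIV_imp_deriv derivative_eq_intros heat_DERIV_fst[OF u])
qed

lemma evolved_0: "evolved u 0 0 = u"
  by (auto simp: evolved_def)

lemma radius_evolved:
  assumes u: "smooth_periodic u"
  shows "radius (evolved u l t) x = evolved u l t x + evolved (deriv (deriv u)) 0 t x"
  by (simp add: radius_def deriv_evolved u smooth_periodic_deriv(2))

lemma support_point_evolved:
  assumes u: "smooth_periodic u"
  shows "support_point (evolved u l t) x = evolved u l t x *\<^sub>R cis x + evolved (deriv u) 0 t x *\<^sub>R (\<i> * cis x)"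
  by (simp add: support_point_def deriv_evolved u)

lemma Ck_on_evolved: "smooth_periodic u \<Longrightarrow> Ck_on k (\<lambda>p. evolved u 0 (snd p) (fst p)) (UNIV \<times> {0..})"
  unfolding evolved_def
  using Ck_on_heat[of u k] by (auto intro!: Ck_on_add Ck_on_mult Ck_on_exp Ck_on_snd Ck_on_id Ck_on_const)

lemma integral_deriv_periodic:
  assumes "smooth_periodic u"
  shows "integral {0..2*pi} (deriv u) = 0"
proof -
  have "(deriv u has_integral u (2*pi) - u 0) {0..2*pi}"
    by (rule fundamental_theorem_of_calculus)
      (use smooth_periodic_deriv(1)[OF assms] in
        \<open>auto simp: has_real_derivative_iff_has_vector_derivative[symmetric] intro: has_field_derivative_at_within\<close>)
  moreover have "u (2 * pi) = u 0" using assms unfolding smooth_periodic_def by (metis add_0)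
  ultimately show ?thesis by (simp add: integral_unique)
qed

lemma smooth_periodic_integrable: "smooth_periodic u \<Longrightarrow> u integrable_on {0..2*pi}"
  by (intro integrable_continuous_real smooth_periodic_continuous_on)

lemma integral_radius:
  assumes u: "smooth_periodic u"
  shows "integral {0..2*pi} (radius u) = integral {0..2*pi} u"
proof -
  note u' = smooth_periodic_deriv(2)[OF u]
  have "integral {0..2*pi} (\<lambda>x. u x + deriv (deriv u) x) = integral {0..2*pi} u + integral {0..2*pi} (deriv (deriv u))"
    by (intro Henstock_Kurzweil_Integration.integral_add smooth_periodic_integrable u smooth_periodic_deriv(2)[OF u'])
  then show ?thesis by (simp add: radius_def[abs_def] integral_deriv_periodic[OF u'])
qed

text \<open>This is the length: \<open>u''\<close> integrates to zero over a period and the mean of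
  the heat flow is conserved, so only the factor \<open>exp t\<close> and the constant
  \<open>l\<close> are felt.\<close>

lemma integral_radius_evolved:
  assumes u: "smooth_periodic u" and t: "t \<ge> 0"
  shows "integral {0..2*pi} (radius (evolved u l t)) = exp t * integral {0..2*pi} (radius u) + 2 * pi * l"
proof -
  have "(\<lambda>x. heat u (x, t)) integrable_on {0..2*pi}"
    by (intro integrable_continuous_real continuous_on_compose2[OF heat_continuous[OF u, of UNIV]])
      (auto intro!: continuous_intros)
  then have "integral {0..2*pi} (evolved u l t) = exp t * integral {0..2*pi} (\<lambda>x. heat u (x, t)) + 2 * pi * l"
    unfolding evolved_def[abs_def]
    by (subst Henstock_Kurzweil_Integration.integral_add) (auto intro: integrable_on_mult_right)
  then show ?thesis by (simp add: integral_radius u smooth_periodic_evolved t heat_integral)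
qed

lemma Ck_on_integral_fst:
  fixes F :: "real \<times> real \<Rightarrow> real"
  assumes "Ck_on k F (UNIV \<times> I)" "convex I"
  shows "Ck_on k (\<lambda>t. integral {a..b} (\<lambda>x. F (x, t))) I"
  using assms(1)
proof (induction k arbitrary: F)
  case 0
  have "continuous_on (I \<times> cbox a b) (\<lambda>(t, x). F (x, t))"
    unfolding case_prod_unfold
    by (rule continuous_on_compose2[OF Ck_on_imp_continuous_on[OF 0]]) (auto intro!: continuous_intros)
  from integral_continuous_on_param[OF this] show ?case by simp
next
  case (Suc k)
  obtain g where g: "Ck_on k g (UNIV \<times> I)"
    "\<And>x t. t \<in> I \<Longrightarrow> ((\<lambda>t. F (x, t)) has_vector_derivative g (x, t)) (at t within I)"
    using Ck_on_partial_snd[OF Suc.prems] by auto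
  note cF = Ck_on_imp_continuous_on[OF Suc.prems] and cg = Ck_on_imp_continuous_on[OF g(1)]
  show ?case
  proof (rule Ck_on_vector_SucI[OF _ Suc.IH[OF g(1)]])
    fix t assume t: "t \<in> I"
    have "((\<lambda>t. integral (cbox a b) (\<lambda>x. F (x, t))) has_vector_derivative integral (cbox a b) (\<lambda>x. g (x, t))) (at t within I)"
    proof (rule leibniz_rule_vector_derivative[OF _ _ _ t assms(2)])
      show "(\<lambda>x. F (x, t)) integrable_on cbox a b" if "t \<in> I" for t
        using that by (intro integrable_continuous continuous_on_compose2[OF cF]) (auto intro!: continuous_intros)
      show "continuous_on (I \<times> cbox a b) (\<lambda>(t, x). g (x, t))"
        unfolding case_prod_unfold by (rule continuous_on_compose2[OF cg]) (auto intro!: continuous_intros)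
    qed (rule g(2))
    then show "((\<lambda>t. integral {a..b} (\<lambda>x. F (x, t))) has_vector_derivative integral {a..b} (\<lambda>x. g (x, t))) (at t within I)"
      by simp
  qed
qed

lemma smooth_area_evolved:
  assumes u: "smooth_periodic u"
  shows "smooth_on (\<lambda>p. area_integral (evolved u (fst p) (snd p))) (UNIV \<times> {0..})"
  unfolding smooth_on_def
proof
  fix k
  note u' = smooth_periodic_deriv(2)[OF u]
  note u'' = smooth_periodic_deriv(2)[OF u']
  let ?I = "\<lambda>F t. integral {0..2*pi} (\<lambda>x. F (x, t))"
  define y where "y p = evolved u 0 (snd p) (fst p) * sin (fst p) + evolved (deriv u) 0 (snd p) (fst p) * cos (fst p)" for p
  define r where "r p = evolved u 0 (snd p) (fst p) + evolved (deriv (deriv u)) 0 (snd p) (fst p)" for p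
  \<comment> \<open>Adding \<open>l\<close> to the support function adds \<open>l * sin x\<close> to
    the height \<open>y\<close> and \<open>l\<close> to the radius \<open>r\<close>;
    \<open>F0\<close> and \<open>F1\<close> are the coefficients of order 0 and 1 in
    \<open>l\<close>, and the one of order 2 is the square of the sine.\<close>
  define F0 where "F0 p = y p * r p * sin (fst p)" for p
  define F1 where "F1 p = (y p + r p * sin (fst p)) * sin (fst p)" for p
  have Ck_sin: "Ck_on k (\<lambda>p. sin (fst p)) S" and Ck_cos: "Ck_on k (\<lambda>p. cos (fst p)) S" for S :: "(real \<times> real) set"
    using Ck_on_linear_compose[OF bounded_linear_Im Ck_on_cis_compose[OF Ck_on_fst[OF Ck_on_id]]]
      Ck_on_linear_compose[OF bounded_linear_Re Ck_on_cis_compose[OF Ck_on_fst[OF Ck_on_id]]] by auto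
  have y: "Ck_on k y (UNIV \<times> {0..})" and r: "Ck_on k r (UNIV \<times> {0..})"
    unfolding y_def[abs_def] r_def[abs_def]
    by (intro Ck_on_add Ck_on_mult Ck_on_evolved u u' u'' Ck_sin Ck_cos)+
  have F: "Ck_on k F0 (UNIV \<times> {0..})" "Ck_on k F1 (UNIV \<times> {0..})"
    unfolding F0_def[abs_def] F1_def[abs_def] by (intro Ck_on_add Ck_on_mult y r Ck_sin)+
  have int: "(\<lambda>x. F (x, t)) integrable_on {0..2*pi}" if "Ck_on k F (UNIV \<times> {0..})" "t \<ge> 0" for F :: "real \<times> real \<Rightarrow> real" and t
    using that(2) by (intro integrable_continuous_real continuous_on_compose2[OF Ck_on_imp_continuous_on[OF that(1)]])
      (auto intro!: continuous_intros)
  let ?A = "\<lambda>p. ?I F0 (snd p) + fst p * ?I F1 (snd p) + fst p * fst p * integral {0..2*pi} (\<lambda>x. sin x * sin x)"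
  have "area_integral (evolved u l t) = ?A (l, t)" if t: "t \<ge> 0" for l t
  proof -
    have "area_integral (evolved u l t) = integral {0..2*pi} (\<lambda>x. F0 (x, t) + l * F1 (x, t) + l * l * (sin x * sin x))"
      unfolding area_integral_def support_point_evolved[OF u] radius_evolved[OF u]
      by (intro Henstock_Kurzweil_Integration.integral_cong)
        (simp add: F0_def F1_def y_def r_def evolved_def algebra_simps)
    also have "\<dots> = ?A (l, t)"
    proof -
      have "(\<lambda>x::real. sin x * sin x) integrable_on {0..2*pi}"
        by (intro integrable_continuous_real continuous_intros)
      note hs = integrable_integral[OF this]
      have "((\<lambda>x. F0 (x, t) + l * F1 (x, t) + l * l * (sin x * sin x)) has_integral
          ?I F0 t + l * ?I F1 t + l * l * integral {0..2*pi} (\<lambda>x. sin x * sin x)) {0..2*pi}"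
        by (intro has_integral_add has_integral_mult_right hs integrable_integral int F t)
      then show ?thesis by (simp add: integral_unique)
    qed
    finally show ?thesis .
  qed
  then have eq: "area_integral (evolved u (fst p) (snd p)) = ?A p" if "p \<in> UNIV \<times> {0..}" for p
    using that by (auto simp: mem_Times_iff)
  have I: "Ck_on k (\<lambda>p. ?I F (snd p)) (UNIV \<times> {0..})" if "Ck_on k F (UNIV \<times> {0..})" for F :: "real \<times> real \<Rightarrow> real"
    by (rule Ck_on_compose[OF Ck_on_integral_fst[OF that]]) (auto intro: Ck_on_snd Ck_on_id)
  have "Ck_on k ?A (UNIV \<times> {0..})"
    by (intro Ck_on_add Ck_on_mult I F Ck_on_fst Ck_on_id Ck_on_const)
  then show "Ck_on k (\<lambda>p. area_integral (evolved u (fst p) (snd p))) (UNIV \<times> {0..})"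
    by (subst Ck_on_cong[OF eq])
qed

lemma compact_bound:
  fixes f :: "'a::topological_space \<Rightarrow> real"
  assumes "continuous_on S f" "compact K" "K \<subseteq> S"
  obtains B where "\<And>x. x \<in> K \<Longrightarrow> \<bar>f x\<bar> \<le> B"
  using compact_imp_bounded[OF compact_continuous_image[OF continuous_on_subset[OF assms(1,3)] assms(2)]]
  by (auto simp: bounded_iff)

text \<open>The width \<open>l t\<close> is the term \<open>(L t - L 0 exp t) / (2\<pi>)\<close> by which the support function exceeds
  the rescaled heat flow; it carries the whole nonlocal part of the evolution.\<close>

lemma width_ode:
  fixes H :: "real \<Rightarrow> real \<Rightarrow> real"
  assumes "convex_support u" and H: "smooth_on (\<lambda>(p, q). H p q) ({0<..} \<times> {0<..})"
  obtains T l where "T > 0" "smooth_on l {0..<T}" "l 0 = 0"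
    "\<And>t. t \<in> {0..<T} \<Longrightarrow> (l has_real_derivative
      l t - H (integral {0..2*pi} (radius (evolved u (l t) t))) (area_integral (evolved u (l t) t))) (at t within {0..<T})"
proof -
  interpret convex_support u by fact
  define L0 where "L0 = integral {0..2*pi} (radius u)"
  define L where "L p = exp (snd p) * L0 + 2 * pi * fst p" for p
  define A where "A p = area_integral (evolved u (fst p) (snd p))" for p
  have Leq: "L (l, t) = integral {0..2*pi} (radius (evolved u l t))" if "t \<ge> 0" for l t
    using integral_radius_evolved[OF u that] by (simp add: L_def L0_def)
  have CL: "Ck_on k L S" for k S
    unfolding L_def[abs_def] by (intro Ck_on_add Ck_on_mult Ck_on_exp Ck_on_snd Ck_on_fst Ck_on_id Ck_on_const)
  have CA: "Ck_on k A (UNIV \<times> {0..})" for k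
    using smooth_area_evolved[OF u] by (simp add: smooth_on_def A_def[abs_def])
  have "L0 > 0"
  proof -
    obtain x where x: "x \<in> {0..2*pi}" "\<And>y. y \<in> {0..2*pi} \<Longrightarrow> \<rho> x \<le> \<rho> y"
      by (rule continuous_on_Icc_attains_inf[OF radius_continuous, of 0 "2*pi"]) auto
    have "integral {0..2*pi} (\<lambda>_. \<rho> x) \<le> L0"
      unfolding L0_def by (rule integral_le) (use x in \<open>auto intro!: integrable_continuous_real radius_continuous\<close>)
    then have "2 * pi * \<rho> x \<le> L0" by simp
    moreover have "2 * pi * \<rho> x > 0" using radius_pos by simp
    ultimately show ?thesis by linarith
  qed
  then have "L (0, 0) > 0" by (simp add: L_def)
  have "A (0, 0) > 0" using area_integral_pos by (simp add: A_def evolved_0)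
  \<comment> \<open>\<open>H\<close> is smooth for positive arguments. Following the smaller of
    length and area, one continuity argument yields a box around \<open>(0, 0)\<close> where both
    are positive.\<close>
  define m where "m p = min (L p) (A p)" for p
  have "continuous_on (UNIV \<times> {0..}) m"
    unfolding m_def by (intro continuous_on_min Ck_on_imp_continuous_on CL CA)
  moreover have m0: "m (0, 0) > 0" using \<open>L (0, 0) > 0\<close> \<open>A (0, 0) > 0\<close> by (simp add: m_def)
  ultimately obtain d where d: "d > 0" "\<And>p. p \<in> UNIV \<times> {0..} \<Longrightarrow> dist p (0, 0) < d \<Longrightarrow> dist (m p) (m (0, 0)) < m (0, 0)"
    unfolding continuous_on_iff by (metis SigmaI UNIV_I atLeast_iff order_refl)
  define e where "e = d / 2"
  have e: "e > 0" using d by (simp add: e_def)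
  have mpos: "m (l, t) > 0" if "l \<in> {-e<..<e}" "t \<in> {0..<e}" for l t
  proof -
    have "dist (l, t) (0, 0) \<le> \<bar>l\<bar> + \<bar>t\<bar>" using norm_Pair_le[of l t] by (simp add: dist_norm)
    also have "\<dots> < d" using that by (auto simp: e_def)
    finally show ?thesis using d(2)[of "(l, t)"] that by (auto simp: dist_real_def)
  qed
  define f where "f p = fst p - H (L p) (A p)" for p
  have f: "smooth_on f ({-e<..<e} \<times> {0..<e})"
    unfolding smooth_on_def
  proof
    fix k
    have "Ck_on k (\<lambda>p. (case (L p, A p) of (p, q) \<Rightarrow> H p q)) ({-e<..<e} \<times> {0..<e})"
    proof (rule Ck_on_compose[OF H[unfolded smooth_on_def, rule_format]])
      show "Ck_on k (\<lambda>p. (L p, A p)) ({-e<..<e} \<times> {0..<e})"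
        by (intro Ck_on_Pair CL Ck_on_subset[OF CA]) auto
    qed (use mpos in \<open>auto simp: m_def\<close>)
    then show "Ck_on k f ({-e<..<e} \<times> {0..<e})"
      unfolding f_def[abs_def] by (intro Ck_on_diff Ck_on_fst Ck_on_id) simp
  qed
  obtain fx where fx: "smooth_on fx ({-e<..<e} \<times> {0..<e})"
    "\<And>x t. x \<in> {-e<..<e} \<Longrightarrow> t \<in> {0..<e} \<Longrightarrow> ((\<lambda>x. f (x, t)) has_vector_derivative fx (x, t)) (at x)"
    using smooth_on_partial_fst[OF f] by auto
  have cont: "continuous_on ({-e<..<e} \<times> {0..<e}) f" "continuous_on ({-e<..<e} \<times> {0..<e}) fx"
    using f fx(1) unfolding smooth_on_def by (metis Ck_on.simps(1))+
  \<comment> \<open>The bounds of \<open>f\<close> and \<open>fx\<close> come from compactness,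
    hence the halved box; the radius \<open>e / 4\<close> used below leaves room for the
    displacement inside \<open>?U\<close>.\<close>
  have sub: "{-e/2..e/2} \<times> {0..e/2} \<subseteq> {-e<..<e} \<times> {0..<e}" using e by auto
  obtain M where M: "\<And>p. p \<in> {-e/2..e/2} \<times> {0..e/2} \<Longrightarrow> \<bar>f p\<bar> \<le> M"
    by (rule compact_bound[OF cont(1) _ sub]) (auto intro: compact_Times)
  obtain K where K: "\<And>p. p \<in> {-e/2..e/2} \<times> {0..e/2} \<Longrightarrow> \<bar>fx p\<bar> \<le> K"
    by (rule compact_bound[OF cont(2) _ sub]) (auto intro: compact_Times)
  let ?U = "{-e/2<..<e/2}"
  have f': "smooth_on f (?U \<times> {0..<e})"
    unfolding smooth_on_def
  proof
    fix k show "Ck_on k f (?U \<times> {0..<e})"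
      by (rule Ck_on_subset[OF f[unfolded smooth_on_def, rule_format]]) (use e in auto)
  qed
  have U: "open ?U" "convex ?U" by simp_all
  have e2: "0 < e / 2" "e / 2 < e" and e4: "e / 4 > 0" using e by auto
  have fxb: "\<forall>x\<in>?U. \<forall>t\<in>{0..e/2}. \<exists>D. ((\<lambda>x. f (x, t)) has_real_derivative D) (at x) \<and> \<bar>D\<bar> \<le> K"
  proof safe
    fix x t assume "x \<in> ?U" "t \<in> {0..e/2}"
    then show "\<exists>D. ((\<lambda>x. f (x, t)) has_real_derivative D) (at x) \<and> \<bar>D\<bar> \<le> K"
      using fx(2)[of x t] K[of "(x, t)"] e
      by (intro exI[of _ "fx (x, t)"]) (auto simp: has_real_derivative_iff_has_vector_derivative)
  qed
  have Mb: "\<forall>x\<in>?U. \<forall>t\<in>{0..e/2}. \<bar>f (x, t)\<bar> \<le> M" by (intro ballI M) auto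
  have r: "\<forall>(\<phi> :: real) x. \<bar>x - 0\<bar> \<le> e / 4 \<longrightarrow> x \<in> ?U"
    using e by (auto simp: abs_if split: if_splits)
  \<comment> \<open>\<open>smooth_flow\<close> solves for a whole family of initial values; here the
    family is constantly 0, and its member at parameter 0 is kept.\<close>
  have Y: "smooth_on (\<lambda>_ :: real. 0 :: real) UNIV" by (simp add: smooth_on_def Ck_on_const)
  obtain T and y :: "real \<times> real \<Rightarrow> real" where y: "0 < T" "T \<le> e / 2" "smooth_on y (UNIV \<times> {0..<T})" "\<And>\<phi>. y (\<phi>, 0) = 0"
    "\<And>\<phi> t. t \<in> {0..<T} \<Longrightarrow> ((\<lambda>t. y (\<phi>, t)) has_real_derivative f (y (\<phi>, t), t)) (at t within {0..<T})"
    using smooth_flow[OF U f' e2 fxb Mb Y e4 r] by blast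
  define l where "l t = y (0, t)" for t
  show thesis
  proof (rule that)
    show "smooth_on l {0..<T}"
      using y(3) unfolding smooth_on_def l_def[abs_def] by (auto intro: Ck_on_slice_snd)
    show "(l has_real_derivative l t - H (integral {0..2*pi} (radius (evolved u (l t) t))) (area_integral (evolved u (l t) t))) (at t within {0..<T})"
      if "t \<in> {0..<T}" for t
      using y(5)[OF that, of 0] that Leq[of t "l t"] by (simp add: l_def[symmetric] f_def A_def)
  qed (use y in \<open>auto simp: l_def\<close>)
qed

text \<open>The position moves with time, so the total derivative of the heat flow is composed with
  the path \<open>(g t, t)\<close>. The four terms stem from the factor \<open>exp t\<close>, the
  motion of \<open>g\<close>, the heat equation and the width; the first has width 0 because
  \<open>exp t\<close> multiplies the heat part alone.\<close>

lemma evolved_along: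
  assumes u: "smooth_periodic u" and I: "I \<subseteq> {0..}" "t \<in> I"
    and g: "(g has_real_derivative g') (at t within I)" and l: "(l has_real_derivative l') (at t within I)"
  shows "((\<lambda>t. evolved u (l t) t (g t)) has_real_derivative
    evolved u 0 t (g t) + evolved (deriv u) 0 t (g t) * g' + evolved (deriv (deriv u)) 0 t (g t) + l') (at t within I)"
proof -
  note u' = smooth_periodic_deriv(2)[OF u]
  have heat: "(heat u has_derivative (\<lambda>v. fst v *\<^sub>R heat (deriv u) p + snd v *\<^sub>R heat (deriv (deriv u)) p)) (at p within UNIV \<times> {0..})"
    if "p \<in> UNIV \<times> {0..}" for p
    by (rule has_derivative_continuous_partials[OF _ _ heat_continuous[OF smooth_periodic_deriv(2)[OF u']] _ that])
      (use heat_DERIV_fst[OF u] heat_has_vector_derivative_snd[OF u]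
        in \<open>auto simp: has_real_derivative_iff_has_vector_derivative[symmetric]\<close>)
  have "((\<lambda>t. (g t, t)) has_derivative (\<lambda>h. (h *\<^sub>R g', h))) (at t within I)"
    using g by (auto intro!: has_derivative_Pair has_derivative_ident
        simp: has_real_derivative_iff_has_vector_derivative has_vector_derivative_def)
  from diff_chain_within[OF this has_derivative_subset[OF heat[of "(g t, t)"], of "(\<lambda>t. (g t, t)) ` I"]] I
  have "((\<lambda>t. heat u (g t, t)) has_derivative
      (\<lambda>h. (h *\<^sub>R g') *\<^sub>R heat (deriv u) (g t, t) + h *\<^sub>R heat (deriv (deriv u)) (g t, t))) (at t within I)"
    by (auto simp: o_def)
  then have d: "((\<lambda>t. heat u (g t, t)) has_real_derivative
      heat (deriv u) (g t, t) * g' + heat (deriv (deriv u)) (g t, t)) (at t within I)"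
    by (simp add: has_field_derivative_def algebra_simps)
      (erule has_derivative_eq_rhs, auto simp: algebra_simps)
  show ?thesis
    unfolding evolved_def by (auto intro!: derivative_eq_intros d l simp: algebra_simps)
qed


lemma Ck_on_evolved_width:
  assumes "smooth_periodic u" "smooth_on l {0..<T}"
  shows "Ck_on k (\<lambda>p. evolved u (l (snd p)) (snd p) (fst p)) (UNIV \<times> {0..<T})"
proof -
  have "Ck_on k (\<lambda>p. evolved u 0 (snd p) (fst p)) (UNIV \<times> {0..<T})"
    by (rule Ck_on_subset[OF Ck_on_evolved[OF assms(1)]]) auto
  moreover have "Ck_on k (\<lambda>p. l (snd p)) (UNIV \<times> {0..<T})"
    by (rule Ck_on_compose[OF assms(2)[unfolded smooth_on_def, rule_format] Ck_on_snd[OF Ck_on_id]]) auto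
  ultimately have "Ck_on k (\<lambda>p. evolved u 0 (snd p) (fst p) + l (snd p)) (UNIV \<times> {0..<T})"
    by (rule Ck_on_add)
  then show ?thesis by (simp add: evolved_def)
qed

lemma evolved_periodic: "smooth_periodic u \<Longrightarrow> evolved u l t (x + 2 * pi) = evolved u l t x"
  by (simp add: evolved_def heat_periodic)

text \<open>Uniform continuity over one period gives a time, common to all angles, in which the
  radius changes by less than its initial minimum.\<close>

lemma radius_evolved_pos:
  assumes "convex_support u" and l: "smooth_on l {0..<T}" "l 0 = 0" and "T > 0"
  obtains T' where "0 < T'" "T' \<le> T" "\<And>t x. t \<in> {0..<T'} \<Longrightarrow> radius (evolved u (l t) t) x > 0"
proof -
  interpret convex_support u by fact
  define r where "r p = radius (evolved u (l (snd p)) (snd p)) (fst p)" for p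
  have "continuous_on (UNIV \<times> {0..<T}) r"
    unfolding r_def[abs_def] radius_evolved[OF u]
    by (intro continuous_on_add Ck_on_imp_continuous_on Ck_on_evolved_width u l
        Ck_on_evolved_width[where l="\<lambda>_. 0", OF u'']) (simp add: smooth_on_def Ck_on_const)
  then have "uniformly_continuous_on ({0..2*pi} \<times> {0..T/2}) r"
    using \<open>T > 0\<close> by (intro compact_uniformly_continuous compact_Times)
      (auto elim!: continuous_on_subset)
  moreover obtain x0 where x0: "x0 \<in> {0..2*pi}" "\<And>y. y \<in> {0..2*pi} \<Longrightarrow> \<rho> x0 \<le> \<rho> y"
    by (rule continuous_on_Icc_attains_inf[OF radius_continuous, of 0 "2*pi"]) auto
  ultimately obtain d where d: "d > 0" "\<And>p q. p \<in> {0..2*pi} \<times> {0..T/2} \<Longrightarrow> q \<in> {0..2*pi} \<times> {0..T/2} \<Longrightarrow>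
      dist p q < d \<Longrightarrow> dist (r p) (r q) < \<rho> x0"
    unfolding uniformly_continuous_on_def using radius_pos[of x0] by metis
  show thesis
  proof (rule that)
    show "0 < min d (T / 2)" "min d (T / 2) \<le> T" using d(1) \<open>T > 0\<close> by auto
    fix t x assume t: "t \<in> {0..<min d (T / 2)}"
    obtain y n where y: "y \<in> {0..<0 + 2 * pi}" "x = y + 2 * pi * of_int n" by (rule periodic_representative)
    have "dist (y, t) (y, 0) < d" using t by (simp add: dist_Pair_Pair)
    then have "dist (r (y, t)) (r (y, 0)) < \<rho> x0" using t y(1) by (intro d(2)) auto
    moreover have "r (y, 0) = \<rho> y" by (simp add: r_def l(2) evolved_0)
    ultimately have "r (y, t) > 0" using x0(2)[of y] y(1) by (auto simp: dist_real_def)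
    moreover have "radius (evolved u (l t) t) x = r (y, t)"
      unfolding y(2) r_def radius_evolved[OF u] fst_conv snd_conv
      by (rule periodic_int) (simp add: evolved_periodic u u'')
    ultimately show "radius (evolved u (l t) t) x > 0" by simp
  qed
qed

text \<open>Moving with purely normal velocity, a material point changes its normal angle at the rate
  \<open>- \<rho>' / \<rho>\<close>, where \<open>\<rho>\<close> is the radius of curvature as a function of the normal angle.\<close>

lemma normal_angle_ode:
  fixes \<theta>\<^sub>0 :: "real \<Rightarrow> real" and \<sigma> :: real
  assumes u: "smooth_periodic u" and l: "smooth_on l {0..<T}" and "T > 0"
    and pos: "\<forall>t\<in>{0..<T}. \<forall>x. radius (evolved u (l t) t) x > 0"
    and \<sigma>: "\<sigma> = 1 \<or> \<sigma> = -1" and \<theta>0: "smooth_on \<theta>\<^sub>0 UNIV" "\<And>\<phi>. \<theta>\<^sub>0 (\<phi> + 2 * pi) = \<theta>\<^sub>0 \<phi> + 2 * pi * \<sigma>"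
  obtains T' \<theta> where "0 < T'" "T' \<le> T" "smooth_on \<theta> (UNIV \<times> {0..<T'})" "\<And>\<phi>. \<theta> (\<phi>, 0) = \<theta>\<^sub>0 \<phi>"
    "\<And>\<phi> t. t \<in> {0..<T'} \<Longrightarrow> ((\<lambda>t. \<theta> (\<phi>, t)) has_real_derivative
      - radius (evolved (deriv u) 0 t) (\<theta> (\<phi>, t)) / radius (evolved u (l t) t) (\<theta> (\<phi>, t))) (at t within {0..<T'})"
    "\<And>\<phi> t. t \<in> {0..<T'} \<Longrightarrow> \<exists>E>0. ((\<lambda>\<phi>. \<theta> (\<phi>, t)) has_real_derivative deriv \<theta>\<^sub>0 \<phi> * E) (at \<phi>)"
    "\<And>\<phi> t. t \<in> {0..<T'} \<Longrightarrow> \<theta> (\<phi> + 2 * pi, t) = \<theta> (\<phi>, t) + 2 * pi * \<sigma>"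
proof -
  note u1 = smooth_periodic_deriv(2)[OF u]
  note u2 = smooth_periodic_deriv(2)[OF u1]
  note u3 = smooth_periodic_deriv(2)[OF u2]
  define r where "r p = radius (evolved u (l (snd p)) (snd p)) (fst p)" for p
  define r1 where "r1 p = radius (evolved (deriv u) 0 (snd p)) (fst p)" for p
  define G where "G p = - r1 p / r p" for p
  have s0: "smooth_on (\<lambda>_. 0 :: real) {0..<T}" by (simp add: smooth_on_def Ck_on_const)
  have r: "Ck_on k r (UNIV \<times> {0..<T})" "Ck_on k r1 (UNIV \<times> {0..<T})" for k
    unfolding r_def[abs_def] r1_def[abs_def] radius_evolved[OF u] radius_evolved[OF u1]
    by (intro Ck_on_add Ck_on_evolved_width u l u1 Ck_on_evolved_width[OF _ s0] u2 u3)+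
  have G: "smooth_on G (UNIV \<times> {0..<T})"
    unfolding smooth_on_def G_def[abs_def]
    using pos by (intro allI Ck_on_divide Ck_on_uminus r) (auto simp: r_def less_imp_neq[symmetric])
  \<comment> \<open>The lifted angle ranges over the whole line; periodicity turns the bounds over
    one compact period into global ones, so that \<open>smooth_flow\<close> applies with
    \<open>UNIV\<close>.\<close>
  have Gper: "G (x + 2 * pi, t) = G (x, t)" for x t
    by (simp add: G_def r_def r1_def radius_evolved u u1 u2 u3 evolved_periodic)
  have Gint: "G (x + 2 * pi * of_int n, t) = G (x, t)" for x t n
    by (rule periodic_int[of "\<lambda>x. G (x, t)", OF Gper])
  obtain Gx where Gx: "smooth_on Gx (UNIV \<times> {0..<T})"
    "\<And>x t. t \<in> {0..<T} \<Longrightarrow> ((\<lambda>x. G (x, t)) has_real_derivative Gx (x, t)) (at x)"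
    using smooth_on_partial_fst[OF G open_UNIV] by (auto simp: has_real_derivative_iff_has_vector_derivative)
  have Gxint: "Gx (x + 2 * pi * of_int n, t) = Gx (x, t)" if "t \<in> {0..<T}" for x t n
  proof -
    have "((\<lambda>x. G (x + 2 * pi * of_int n, t)) has_real_derivative Gx (x + 2 * pi * of_int n, t)) (at x)"
      using Gx(2)[OF that, of "x + 2 * pi * of_int n"] by (simp add: DERIV_shift)
    then show ?thesis using Gx(2)[OF that, of x] by (auto simp: Gint intro: DERIV_unique)
  qed
  have cont: "continuous_on (UNIV \<times> {0..<T}) G" "continuous_on (UNIV \<times> {0..<T}) Gx"
    using G Gx(1) unfolding smooth_on_def by (metis Ck_on.simps(1))+
  have sub: "{0..2*pi} \<times> {0..T/2} \<subseteq> UNIV \<times> {0..<T}" using \<open>T > 0\<close> by auto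
  obtain M where M: "\<And>p. p \<in> {0..2*pi} \<times> {0..T/2} \<Longrightarrow> \<bar>G p\<bar> \<le> M"
    by (rule compact_bound[OF cont(1) _ sub]) (auto intro: compact_Times)
  obtain K where K: "\<And>p. p \<in> {0..2*pi} \<times> {0..T/2} \<Longrightarrow> \<bar>Gx p\<bar> \<le> K"
    by (rule compact_bound[OF cont(2) _ sub]) (auto intro: compact_Times)
  have b: "\<bar>G (x, t)\<bar> \<le> M" "\<bar>Gx (x, t)\<bar> \<le> K" if t: "t \<in> {0..T/2}" for x t
  proof -
    obtain y n where y: "y \<in> {0..<0 + 2 * pi}" "x = y + 2 * pi * of_int n" by (rule periodic_representative)
    have "t \<in> {0..<T}" using t \<open>T > 0\<close> by auto
    then show "\<bar>G (x, t)\<bar> \<le> M" "\<bar>Gx (x, t)\<bar> \<le> K"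
      using M[of "(y, t)"] K[of "(y, t)"] y t by (auto simp: Gint Gxint)
  qed
  have bx: "\<forall>x\<in>UNIV. \<forall>t\<in>{0..T/2}. \<exists>D. ((\<lambda>x. G (x, t)) has_real_derivative D) (at x) \<and> \<bar>D\<bar> \<le> K"
  proof safe
    fix x t assume t: "t \<in> {0..T/2}"
    then have "t \<in> {0..<T}" using \<open>T > 0\<close> by auto
    then show "\<exists>D. ((\<lambda>x. G (x, t)) has_real_derivative D) (at x) \<and> \<bar>D\<bar> \<le> K"
      using Gx(2) b(2)[OF t] by blast
  qed
  have T2: "0 < T / 2" "T / 2 < T" using \<open>T > 0\<close> by auto
  have "\<forall>x\<in>UNIV. \<forall>t\<in>{0..T/2}. \<bar>G (x, t)\<bar> \<le> M" using b(1) by blast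
  from smooth_flow[OF open_UNIV convex_UNIV G T2 bx this \<theta>0(1), of 1]
  obtain T' \<theta> where *: "0 < T'" "T' \<le> T / 2" "smooth_on \<theta> (UNIV \<times> {0..<T'})" "\<And>\<phi>. \<theta> (\<phi>, 0) = \<theta>\<^sub>0 \<phi>"
    "\<And>\<phi> t. t \<in> {0..<T'} \<Longrightarrow> ((\<lambda>t. \<theta> (\<phi>, t)) has_real_derivative G (\<theta> (\<phi>, t), t)) (at t within {0..<T'})"
    "\<And>\<phi> t. t \<in> {0..<T'} \<Longrightarrow> \<exists>E>0. ((\<lambda>\<phi>. \<theta> (\<phi>, t)) has_real_derivative deriv \<theta>\<^sub>0 \<phi> * E) (at \<phi>)"
    by auto
  \<comment> \<open>Both sides solve the angle equation, \<sigma> being an integer and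
    \<open>G\<close> periodic. Their initial values agree, so the factor before the exponential in
    \<open>ode_difference\<close> is zero.\<close>
  have "\<theta> (\<phi> + 2 * pi, t) = \<theta> (\<phi>, t) + 2 * pi * \<sigma>" if t: "t \<in> {0..<T'}" for \<phi> t
  proof -
    obtain n :: int where n: "\<sigma> = of_int n" using \<sigma> by (metis of_int_1 of_int_minus)
    have d: "((\<lambda>t. \<theta> (\<phi>, t) + 2 * pi * \<sigma>) has_real_derivative G (\<theta> (\<phi>, t) + 2 * pi * \<sigma>, t)) (at t within {0..<T'})"
      if "t \<in> {0..<T'}" for t
      unfolding n Gint by (auto intro!: derivative_eq_intros *(5)[OF that])
    have "\<theta> (\<phi> + 2 * pi, t) - (\<theta> (\<phi>, t) + 2 * pi * \<sigma>) =
      (\<theta> (\<phi> + 2 * pi, 0) - (\<theta> (\<phi>, 0) + 2 * pi * \<sigma>)) * exp (integral {0..t} (\<lambda>s. integral {0..1}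
        (\<lambda>q. Gx ((\<theta> (\<phi>, s) + 2 * pi * \<sigma>) + q * (\<theta> (\<phi> + 2 * pi, s) - (\<theta> (\<phi>, s) + 2 * pi * \<sigma>)), s))))"
      by (rule ode_difference[OF convex_UNIV Gx(2) _ _ d _ *(5) t])
        (use *(2) T2 in \<open>auto elim!: continuous_on_subset intro: continuous_on_subset[OF cont(2)]\<close>)
    then show ?thesis by (simp add: *(4) \<theta>0(2))
  qed
  moreover have "G p = - radius (evolved (deriv u) 0 (snd p)) (fst p) / radius (evolved u (l (snd p)) (snd p)) (fst p)" for p
    by (simp add: G_def r_def r1_def)
  note *(5)[unfolded this fst_conv snd_conv]
  moreover have "T' \<le> T" using *(2) T2 by simp
  ultimately show thesis using *(1,3,4,6) by (intro that[of T' \<theta>])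
qed

theorem theorem2:
  fixes X\<^sub>0 :: "real \<Rightarrow> complex" and H :: "real \<Rightarrow> real \<Rightarrow> real"
  assumes "convex_simple_closed_curve X\<^sub>0"
    and "smooth_on (\<lambda>(p, q). H p q) ({0<..} \<times> {0<..})"
  shows "\<exists>T>0. \<exists>X. smooth_convex_solution H X\<^sub>0 T X \<and>
    (\<forall>\<theta>. \<forall>t\<in>{0..<T}.
       normal_angle_point (\<lambda>\<phi>. X \<phi> t) \<theta> =
         exp t *\<^sub>R heat_term (support_function X\<^sub>0) t \<theta> +
         (curve_length (\<lambda>\<phi>. X \<phi> t) / (2 * pi) - curve_length (\<lambda>\<phi>. X \<phi> 0) / (2 * pi) * exp t) *\<^sub>R
           Complex (cos \<theta>) (sin \<theta>))"
proof -
  obtain u \<theta>\<^sub>0 \<theta>\<^sub>0' \<sigma> where cc: "convex_curve u \<theta>\<^sub>0 \<theta>\<^sub>0' \<sigma> X\<^sub>0" and s\<theta>0: "smooth_on \<theta>\<^sub>0 UNIV"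
    using convex_simple_closed_curve_normal_angle[OF assms(1)] by blast
  interpret X0: convex_curve u \<theta>\<^sub>0 \<theta>\<^sub>0' \<sigma> X\<^sub>0 by fact
  have cs: "convex_support u" by unfold_locales
  note su = X0.u and su1 = X0.u'
  obtain T1 l where l1: "T1 > 0" "smooth_on l {0..<T1}" "l 0 = 0"
    "\<And>t. t \<in> {0..<T1} \<Longrightarrow> (l has_real_derivative
      l t - H (integral {0..2*pi} (radius (evolved u (l t) t))) (area_integral (evolved u (l t) t))) (at t within {0..<T1})"
    using width_ode[OF cs assms(2)] by blast
  obtain T2 where T2: "0 < T2" "T2 \<le> T1" "\<And>t x. t \<in> {0..<T2} \<Longrightarrow> radius (evolved u (l t) t) x > 0"
    using radius_evolved_pos[OF cs l1(2,3,1)] by blast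
  have l2: "smooth_on l {0..<T2}"
    unfolding smooth_on_def
  proof
    fix k show "Ck_on k l {0..<T2}"
      by (rule Ck_on_subset[OF l1(2)[unfolded smooth_on_def, rule_format]]) (use T2 in auto)
  qed
  obtain T and \<theta> :: "real \<times> real \<Rightarrow> real" where T: "0 < T" "T \<le> T2" and ang: "smooth_on \<theta> (UNIV \<times> {0..<T})" "\<And>\<phi>. \<theta> (\<phi>, 0) = \<theta>\<^sub>0 \<phi>"
    "\<And>\<phi> t. t \<in> {0..<T} \<Longrightarrow> ((\<lambda>t. \<theta> (\<phi>, t)) has_real_derivative
      - radius (evolved (deriv u) 0 t) (\<theta> (\<phi>, t)) / radius (evolved u (l t) t) (\<theta> (\<phi>, t))) (at t within {0..<T})"
    "\<And>\<phi> t. t \<in> {0..<T} \<Longrightarrow> \<exists>E>0. ((\<lambda>\<phi>. \<theta> (\<phi>, t)) has_real_derivative deriv \<theta>\<^sub>0 \<phi> * E) (at \<phi>)"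
    "\<And>\<phi> t. t \<in> {0..<T} \<Longrightarrow> \<theta> (\<phi> + 2 * pi, t) = \<theta> (\<phi>, t) + 2 * pi * \<sigma>"
    by (rule normal_angle_ode[OF su l2 T2(1) _ X0.\<sigma> s\<theta>0 X0.\<theta>(3)]) (use T2(3) in blast)+
  let ?I = "{0..<T}"
  have l: "smooth_on l ?I"
    unfolding smooth_on_def
  proof
    fix k show "Ck_on k l ?I"
      by (rule Ck_on_subset[OF l2[unfolded smooth_on_def, rule_format]]) (use T in auto)
  qed
  have ld: "(l has_real_derivative
      l t - H (integral {0..2*pi} (radius (evolved u (l t) t))) (area_integral (evolved u (l t) t))) (at t within ?I)"
    if "t \<in> ?I" for t
    using DERIV_subset[OF l1(4)[of t], of ?I] that T T2 by auto
  define X where "X \<phi> t = support_point (evolved u (l t) t) (\<theta> (\<phi>, t))" for \<phi> t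
  have X: "X \<phi> t = evolved u (l t) t (\<theta> (\<phi>, t)) *\<^sub>R cis (\<theta> (\<phi>, t)) +
      evolved (deriv u) 0 t (\<theta> (\<phi>, t)) *\<^sub>R (\<i> * cis (\<theta> (\<phi>, t)))" for \<phi> t
    unfolding X_def by (rule support_point_evolved[OF su])
  have smX: "Ck_on k (\<lambda>p. X (fst p) (snd p)) (UNIV \<times> ?I)" for k
  proof -
    have c\<theta>: "Ck_on k \<theta> (UNIV \<times> ?I)" using ang(1) by (simp add: smooth_on_def)
    have e: "Ck_on k (\<lambda>p. evolved f (g (snd p)) (snd p) (\<theta> p)) (UNIV \<times> ?I)"
      if "smooth_periodic f" "smooth_on g ?I" for f g
    proof -
      have "(\<lambda>p. (\<theta> p, snd p)) ` (UNIV \<times> ?I) \<subseteq> UNIV \<times> ?I" by auto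
      from Ck_on_compose[OF Ck_on_evolved_width[OF that, of k] Ck_on_Pair[OF c\<theta> Ck_on_snd[OF Ck_on_id]] this]
      show ?thesis by simp
    qed
    have s0: "smooth_on (\<lambda>_. 0 :: real) ?I" by (simp add: smooth_on_def Ck_on_const)
    have "Ck_on k (\<lambda>p. evolved u (l (snd p)) (snd p) (\<theta> p) *\<^sub>R cis (\<theta> p) +
        evolved (deriv u) 0 (snd p) (\<theta> p) *\<^sub>R (\<i> * cis (\<theta> p))) (UNIV \<times> ?I)"
      by (intro Ck_on_add Ck_on_scaleR Ck_on_mult Ck_on_const Ck_on_cis_compose c\<theta> e[OF su l] e[OF su1 s0])
    then show ?thesis by (simp add: X)
  qed
  \<comment> \<open>The factor \<open>E\<close> is positive and the increment per period is
    preserved, so the angle stays a normal angle of orientation \<sigma> at each time; all geometric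
    quantities then come from the locale.\<close>
  have curve: "\<exists>\<theta>'. convex_curve (evolved u (l t) t) (\<lambda>\<phi>. \<theta> (\<phi>, t)) \<theta>' \<sigma> (\<lambda>\<phi>. X \<phi> t)" if t: "t \<in> ?I" for t
  proof -
    obtain E where E: "\<And>\<phi>. E \<phi> > 0 \<and> ((\<lambda>\<phi>. \<theta> (\<phi>, t)) has_real_derivative deriv \<theta>\<^sub>0 \<phi> * E \<phi>) (at \<phi>)"
      using ang(4)[OF t] by metis
    have pos: "\<sigma> * (deriv \<theta>\<^sub>0 \<phi> * E \<phi>) > 0" for \<phi>
      using X0.\<theta>(2)[of \<phi>] E[of \<phi>] DERIV_imp_deriv[OF X0.\<theta>(1)[of \<phi>]]
      by (simp flip: mult.assoc)
    have "smooth_on (\<lambda>\<phi>. X \<phi> t) UNIV"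
      using Ck_on_slice_fst[OF smX t] by (simp add: smooth_on_def)
    then show ?thesis
      by (intro exI[of _ "\<lambda>\<phi>. deriv \<theta>\<^sub>0 \<phi> * E \<phi>"], unfold_locales)
        (use t T T2(3)[of t] E pos X0.\<sigma> ang(5)[OF t] smooth_periodic_evolved[OF su] in \<open>auto simp: X_def\<close>)
  qed
  have "smooth_convex_solution H X\<^sub>0 T X"
    unfolding smooth_convex_solution_def
  proof (intro conjI allI ballI)
    show "smooth_on (\<lambda>(\<phi>, t). X \<phi> t) (UNIV \<times> ?I)" using smX by (simp add: smooth_on_def case_prod_unfold)
    show "X \<phi> 0 = X\<^sub>0 \<phi>" for \<phi> by (simp add: X_def l1(3) evolved_0 ang(2) X0.c)
    fix t assume t: "t \<in> ?I"
    obtain \<theta>' where c: "convex_curve (evolved u (l t) t) (\<lambda>\<phi>. \<theta> (\<phi>, t)) \<theta>' \<sigma> (\<lambda>\<phi>. X \<phi> t)"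
      using curve[OF t] by blast
    interpret convex_curve "evolved u (l t) t" "\<lambda>\<phi>. \<theta> (\<phi>, t)" \<theta>' \<sigma> "\<lambda>\<phi>. X \<phi> t" by fact
    show "convex_simple_closed_curve (\<lambda>\<phi>. X \<phi> t)" by (rule convex_simple_closed_curve_c)
    fix \<phi>
    define q where "q = \<theta> (\<phi>, t)"
    define h where "h = H (integral {0..2*pi} (radius (evolved u (l t) t))) (area_integral (evolved u (l t) t))"
    define r where "r = radius (evolved u (l t) t) q"
    define \<theta>t where "\<theta>t = - radius (evolved (deriv u) 0 t) q / r"
    have rpos: "r > 0" unfolding r_def by (rule radius_pos)
    have I: "?I \<subseteq> {0..}" by auto
    have d\<theta>: "((\<lambda>t. \<theta> (\<phi>, t)) has_real_derivative \<theta>t) (at t within ?I)"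
      using ang(3)[OF t] by (simp add: \<theta>t_def r_def q_def)
    \<comment> \<open>\<open>a'\<close> and \<open>b'\<close> are the time derivatives of the
      coefficients of \<open>cis\<close> and \<open>\<i> * cis\<close> along the moving angle of one
      material point.\<close>
    define a' where "a' = evolved u 0 t q + evolved (deriv u) 0 t q * \<theta>t + evolved (deriv (deriv u)) 0 t q + (l t - h)"
    define b' where "b' = evolved (deriv u) 0 t q + evolved (deriv (deriv u)) 0 t q * \<theta>t + evolved (deriv (deriv (deriv u))) 0 t q"
    have da: "((\<lambda>t. evolved u (l t) t (\<theta> (\<phi>, t))) has_real_derivative a') (at t within ?I)"
      unfolding a'_def h_def q_def by (rule evolved_along[OF su I t d\<theta>[unfolded q_def] ld[OF t]])
    have db: "((\<lambda>t. evolved (deriv u) 0 t (\<theta> (\<phi>, t))) has_real_derivative b') (at t within ?I)"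
      using evolved_along[OF su1 I t d\<theta>, of "\<lambda>_. 0" 0] by (simp add: b'_def q_def)
    have dcis: "((\<lambda>t. cis (\<theta> (\<phi>, t))) has_vector_derivative \<theta>t *\<^sub>R (\<i> * cis q)) (at t within ?I)"
      using has_derivative_cis[OF d\<theta>[unfolded has_real_derivative_iff_has_vector_derivative has_vector_derivative_def]]
      by (simp add: has_vector_derivative_def q_def)
    have "((\<lambda>t. X \<phi> t) has_vector_derivative
        (evolved u (l t) t q *\<^sub>R (\<theta>t *\<^sub>R (\<i> * cis q)) + a' *\<^sub>R cis q) +
        (evolved (deriv u) 0 t q *\<^sub>R (\<i> * (\<theta>t *\<^sub>R (\<i> * cis q))) + b' *\<^sub>R (\<i> * cis q))) (at t within ?I)"
      unfolding X q_def
      by (intro has_vector_derivative_add has_vector_derivative_scaleR has_vector_derivative_mult_right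
          da db dcis[unfolded q_def])
    also have "(evolved u (l t) t q *\<^sub>R (\<theta>t *\<^sub>R (\<i> * cis q)) + a' *\<^sub>R cis q) +
        (evolved (deriv u) 0 t q *\<^sub>R (\<i> * (\<theta>t *\<^sub>R (\<i> * cis q))) + b' *\<^sub>R (\<i> * cis q)) =
        (a' - evolved (deriv u) 0 t q * \<theta>t) *\<^sub>R cis q + (evolved u (l t) t q * \<theta>t + b') *\<^sub>R (\<i> * cis q)"
      by (simp add: complex_eq_iff algebra_simps)
    \<comment> \<open>Normal component of the velocity: the rotation of the frame cancels the motion
      of the angle, and the radius minus the nonlocal term remains.\<close>
    also have "a' - evolved (deriv u) 0 t q * \<theta>t = r - h"
      by (simp add: a'_def r_def radius_evolved[OF su] evolved_def)
    \<comment> \<open>Tangential component of the velocity; its vanishing is what dictates the rate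
      \<open>\<theta>t\<close>.\<close>
    also have "evolved u (l t) t q * \<theta>t + b' = 0"
    proof -
      have "evolved u (l t) t q * \<theta>t + b' = r * \<theta>t + radius (evolved (deriv u) 0 t) q"
        by (simp add: b'_def r_def radius_evolved[OF su] radius_evolved[OF su1] algebra_simps)
      then show ?thesis using rpos by (simp add: \<theta>t_def)
    qed
    finally have "((\<lambda>t. X \<phi> t) has_vector_derivative (h - r) *\<^sub>R (- cis q)) (at t within ?I)"
      by (simp add: algebra_simps)
    then show "((\<lambda>s. X \<phi> s) has_vector_derivative
        (H (curve_length (\<lambda>\<psi>. X \<psi> t)) (enclosed_area (\<lambda>\<psi>. X \<psi> t))
          - 1 / curvature (\<lambda>\<psi>. X \<psi> t) \<phi>) *\<^sub>R inward_normal (\<lambda>\<psi>. X \<psi> t) \<phi>) (at t within ?I)"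
      by (simp add: curve_length_c enclosed_area_c curvature_c inward_normal_c h_def r_def q_def)
  qed
  moreover have "normal_angle_point (\<lambda>\<phi>. X \<phi> t) x =
      exp t *\<^sub>R heat_term (support_function X\<^sub>0) t x +
      (curve_length (\<lambda>\<phi>. X \<phi> t) / (2 * pi) - curve_length (\<lambda>\<phi>. X \<phi> 0) / (2 * pi) * exp t) *\<^sub>R
        Complex (cos x) (sin x)" if t: "t \<in> ?I" for x t
  proof -
    obtain \<theta>' where c: "convex_curve (evolved u (l t) t) (\<lambda>\<phi>. \<theta> (\<phi>, t)) \<theta>' \<sigma> (\<lambda>\<phi>. X \<phi> t)"
      using curve[OF t] by blast
    interpret convex_curve "evolved u (l t) t" "\<lambda>\<phi>. \<theta> (\<phi>, t)" \<theta>' \<sigma> "\<lambda>\<phi>. X \<phi> t" by fact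
    have t0: "t \<ge> 0" using t by simp
    have "(\<lambda>\<phi>. X \<phi> 0) = X\<^sub>0" by (auto simp: X_def l1(3) evolved_0 ang(2) X0.c)
    moreover have "curve_length (\<lambda>\<phi>. X \<phi> t) = exp t * curve_length X\<^sub>0 + 2 * pi * l t"
      by (simp add: curve_length_c X0.curve_length_c integral_radius_evolved[OF su t0])
    ultimately have "curve_length (\<lambda>\<phi>. X \<phi> t) / (2 * pi) - curve_length (\<lambda>\<phi>. X \<phi> 0) / (2 * pi) * exp t = l t"
      by (simp add: field_simps)
    moreover have "Complex (cos x) (sin x) = cis x" by (simp add: complex_eq_iff)
    moreover have "normal_angle_point (\<lambda>\<phi>. X \<phi> t) x =
        exp t *\<^sub>R (heat u (x, t) *\<^sub>R cis x + heat (deriv u) (x, t) *\<^sub>R (\<i> * cis x)) + l t *\<^sub>R cis x"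
      unfolding normal_angle_point_c support_point_evolved[OF su]
      by (simp add: evolved_def algebra_simps)
    ultimately show ?thesis by (simp add: heat_term_eq[OF su t0] X0.support_function_c)
  qed
  ultimately show ?thesis using T(1) by blast
qed

end
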